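(* Let $N\ge1$ be an integer, $\alpha\in(0,N)$, $p>1$ and $q>1$. Suppose $(u,v)$ is a weak solution of $$-\Delta u+u=\tfrac{2p}{p+q}(I_\alpha*|v|^q)|u|^{p-2}u,\qquad -\Delta v+v=\tfrac{2q}{p+q}(I_\alpha*|u|^p)|v|^{q-2}v\qquad\text{in }\mathbb{R}^N,$$ with $u\in H^1(\mathbb{R}^N)\cap W^{2,2}_{loc}(\mathbb{R}^N)\cap W^{1,\theta_1p}(\mathbb{R}^N)$ and $v\in H^1(\mathbb{R}^N)\cap W^{2,2}_{loc}(\mathbb{R}^N)\cap W^{1,\theta_2q}(\mathbb{R}^N)$ for some $\theta_1>1$, $\theta_2>1$ with $\frac1{\theta_1}+\frac1{\theta_2}=\frac{N+\alpha}{N}$. If $$(p+q)N\le 2(N+\alpha)\quad\text{or}\quad (p+q)(N-2)\ge 2(N+\alpha),$$ then $u=v=0$ in $\mathbb{R}^N$.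
   Context: The Riesz potential is $I_\alpha(x)=\frac{\Gamma((N-\alpha)/2)}{\Gamma(\alpha/2)\pi^{N/2}2^\alpha}|x|^{-(N-\alpha)}$, and $*$ is convolution on $\mathbb{R}^N$. Functions are real-valued. Weak solution means that for all $\varphi,\psi\in C_c^\infty(\mathbb{R}^N)$, $$\int_{\mathbb{R}^N}(\nabla u\nabla\varphi+u\varphi)\,dx=\tfrac{2p}{p+q}\int_{\mathbb{R}^N}(I_\alpha*|v|^q)|u|^{p-2}u\varphi\,dx,\qquad \int_{\mathbb{R}^N}(\nabla v\nabla\psi+v\psi)\,dx=\tfrac{2q}{p+q}\int_{\mathbb{R}^N}(I_\alpha*|u|^p)|v|^{q-2}v\psi\,dx.$$ (The right-hand sides are finite by the Hardy–Littlewood–Sobolev inequality, since $|u|^p\in L^{\theta_1}$ and $|v|^q\in L^{\theta_2}$.) *)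

theory Defs
  imports "HOL-Analysis.Analysis"
begin

section \<open>Test functions\<close>

definition partial_deriv :: "'a::euclidean_space \<Rightarrow> ('a \<Rightarrow> real) \<Rightarrow> 'a \<Rightarrow> real" where
  "partial_deriv b f x = frechet_derivative f (at x) b"

text \<open>A multi-index is encoded as a list of basis vectors; its order is the length of the list.
  On smooth functions the order of the entries does not matter.\<close>

fun iter_partial_deriv :: "'a::euclidean_space list \<Rightarrow> ('a \<Rightarrow> real) \<Rightarrow> 'a \<Rightarrow> real" where
  "iter_partial_deriv [] f = f"
| "iter_partial_deriv (b # bs) f = partial_deriv b (iter_partial_deriv bs f)"

definition smooth :: "('a::euclidean_space \<Rightarrow> real) \<Rightarrow> bool" where
  "smooth f \<longleftrightarrow>
     (\<forall>bs. set bs \<subseteq> Basis \<longrightarrow> (\<forall>x. iter_partial_deriv bs f differentiable (at x)))"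

definition test_functions :: "'a::euclidean_space set \<Rightarrow> ('a \<Rightarrow> real) set" where
  "test_functions \<Omega> = {\<phi>. smooth \<phi> \<and> compact (closure {x. \<phi> x \<noteq> 0}) \<and>
     closure {x. \<phi> x \<noteq> 0} \<subseteq> \<Omega>}"

section \<open>Lebesgue and Sobolev spaces\<close>

text \<open>The elements of these spaces are functions rather than classes modulo equality almost
  everywhere; every notion below is invariant under changes on a null set.\<close>

definition Lp_space :: "real \<Rightarrow> 'a::euclidean_space set \<Rightarrow> ('a \<Rightarrow> real) set" where
  "Lp_space p \<Omega> = {f. set_borel_measurable lebesgue \<Omega> f \<and>
     set_integrable lebesgue \<Omega> (\<lambda>x. \<bar>f x\<bar> powr p)}"

definition locally_integrable :: "'a::euclidean_space set \<Rightarrow> ('a \<Rightarrow> real) \<Rightarrow> bool" where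
  "locally_integrable \<Omega> f \<longleftrightarrow>
     (\<forall>K. compact K \<and> K \<subseteq> \<Omega> \<longrightarrow> set_integrable lebesgue K f)"

definition has_weak_deriv ::
    "'a::euclidean_space set \<Rightarrow> 'a list \<Rightarrow> ('a \<Rightarrow> real) \<Rightarrow> ('a \<Rightarrow> real) \<Rightarrow> bool" where
  "has_weak_deriv \<Omega> bs f g \<longleftrightarrow> locally_integrable \<Omega> f \<and> locally_integrable \<Omega> g \<and>
     (\<forall>\<phi>\<in>test_functions \<Omega>.
        (LINT x:\<Omega>|lebesgue. f x * iter_partial_deriv bs \<phi> x) =
        (- 1) ^ length bs * (LINT x:\<Omega>|lebesgue. g x * \<phi> x))"

definition sobolev :: "nat \<Rightarrow> real \<Rightarrow> 'a::euclidean_space set \<Rightarrow> ('a \<Rightarrow> real) set" where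
  "sobolev k p \<Omega> = {f \<in> Lp_space p \<Omega>.
     \<forall>bs. set bs \<subseteq> Basis \<and> length bs \<le> k \<longrightarrow>
       (\<exists>g\<in>Lp_space p \<Omega>. has_weak_deriv \<Omega> bs f g)}"

definition sobolev_loc :: "nat \<Rightarrow> real \<Rightarrow> 'a::euclidean_space set \<Rightarrow> ('a \<Rightarrow> real) set" where
  "sobolev_loc k p \<Omega> = {f. \<forall>\<Omega>'. open \<Omega>' \<and> compact (closure \<Omega>') \<and> closure \<Omega>' \<subseteq> \<Omega> \<longrightarrow>
     f \<in> sobolev k p \<Omega>'}"

definition has_weak_gradient :: "('a::euclidean_space \<Rightarrow> real) \<Rightarrow> ('a \<Rightarrow> 'a) \<Rightarrow> bool" where
  "has_weak_gradient f G \<longleftrightarrow> (\<forall>b\<in>Basis. has_weak_deriv UNIV [b] f (\<lambda>x. G x \<bullet> b))"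

definition gradient :: "('a::euclidean_space \<Rightarrow> real) \<Rightarrow> 'a \<Rightarrow> 'a" where
  "gradient f x = (\<Sum>b\<in>Basis. partial_deriv b f x *\<^sub>R b)"

section \<open>The Choquard-type system\<close>

definition riesz_potential :: "real \<Rightarrow> 'a::euclidean_space \<Rightarrow> real" where
  "riesz_potential \<alpha> x =
     Gamma ((real DIM('a) - \<alpha>) / 2) /
       (Gamma (\<alpha> / 2) * pi powr (real DIM('a) / 2) * 2 powr \<alpha>) *
     norm x powr (- (real DIM('a) - \<alpha>))"

definition convolution ::
    "('a::euclidean_space \<Rightarrow> real) \<Rightarrow> ('a \<Rightarrow> real) \<Rightarrow> 'a \<Rightarrow> real" where
  "convolution f g x = (LINT y|lebesgue. f (x - y) * g y)"

text \<open>The weak gradients are unique up to a null set, so the choice of \<open>Du\<close> and \<open>Dv\<close> is immaterial.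
  For \<open>p < 2\<close> the expression \<open>\<bar>u\<bar> powr (p - 2) * u\<close> is 0 where \<open>u\<close> vanishes, as it should be.\<close>

definition weak_solution ::
    "real \<Rightarrow> real \<Rightarrow> real \<Rightarrow> ('a::euclidean_space \<Rightarrow> real) \<Rightarrow> ('a \<Rightarrow> real) \<Rightarrow> bool" where
  "weak_solution \<alpha> p q u v \<longleftrightarrow>
     (\<exists>Du Dv. has_weak_gradient u Du \<and> has_weak_gradient v Dv \<and>
       (\<forall>\<phi>\<in>test_functions UNIV.
          (LINT x|lebesgue. Du x \<bullet> gradient \<phi> x + u x * \<phi> x) =
          2 * p / (p + q) *
          (LINT x|lebesgue. convolution (riesz_potential \<alpha>) (\<lambda>y. \<bar>v y\<bar> powr q) x *
             (\<bar>u x\<bar> powr (p - 2) * u x) * \<phi> x)) \<and>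
       (\<forall>\<psi>\<in>test_functions UNIV.
          (LINT x|lebesgue. Dv x \<bullet> gradient \<psi> x + v x * \<psi> x) =
          2 * q / (p + q) *
          (LINT x|lebesgue. convolution (riesz_potential \<alpha>) (\<lambda>y. \<bar>u y\<bar> powr p) x *
             (\<bar>v x\<bar> powr (q - 2) * v x) * \<psi> x)))"

end

theory Submission
  imports Defs
begin

text \<open>
  The theorem is Pohozaev's argument. Write \<open>N\<close> for the dimension, \<open>a\<close> for the sum of the integrals of
  \<open>\<bar>\<nabla>u\<bar>\<^sup>2\<close> and \<open>\<bar>\<nabla>v\<bar>\<^sup>2\<close>, \<open>b\<close> for that of \<open>u\<^sup>2\<close> and \<open>v\<^sup>2\<close>, and \<open>D\<close> for the double integral of
  \<open>I\<^sub>\<alpha> (x - y) \<bar>u x\<bar>\<^sup>p \<bar>v y\<bar>\<^sup>q\<close>. Testing the equations with \<open>u\<close> and \<open>v\<close> and adding gives \<open>a + b = 2 D\<close>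
  (\<open>energy_identity\<close>). Testing them with \<open>x \<bullet> \<nabla>u\<close> and \<open>x \<bullet> \<nabla>v\<close>, the derivatives along dilations,
  gives \<open>(N - 2) / 2 * a + N / 2 * b = 2 (N + \<alpha>) / (p + q) * D\<close>: the local part is \<open>pohozaev_limit\<close>, and the
  nonlocal part comes from the homogeneity of the kernel (\<open>virial_identity\<close>). Eliminating \<open>D\<close> leaves a
  linear relation between the nonnegative numbers \<open>a\<close> and \<open>b\<close>. In the first range of exponents it forces
  \<open>a = 0\<close>, so that \<open>u\<close> and \<open>v\<close> have no gradient and vanish, being square integrable
  (\<open>zero_gradient_imp_zero\<close>); in the second it forces \<open>b = 0\<close>.

  Neither \<open>u\<close> nor \<open>x \<bullet> \<nabla>u\<close> is a test function. The dilation field is multiplied by a cutoff of radius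
  \<open>R\<close>, which tends to infinity at the very end. At fixed radius the test function is
  \<open>\<rho> * (X \<bullet> \<nabla>(\<rho> * u))\<close> with a smooth even mollifier \<open>\<rho>\<close> and a compactly supported field \<open>X\<close>. The outer
  convolution can be moved onto the equation (\<open>mollified_equation\<close>), which makes both factors of every
  product on the left smooth; the integrations by parts are then classical (\<open>mollified_pohozaev\<close>), and only
  \<open>u\<close> and its first derivatives survive in the limit (\<open>pohozaev_half\<close>). The mollifier is
  removed by dominated convergence along a subsequence on which finitely many \<open>L\<^sup>s\<close>-convergent sequences are
  dominated and converge almost everywhere (\<open>dominated_subsequence\<close>).

  The nonlocal terms are absolutely convergent by the Hardy--Littlewood--Sobolev inequality, which is
  needed here as a statement about finiteness (\<open>hls_integrable\<close>). The kernel is singular on the diagonal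
  and its gradient need not be integrable, so the integration by parts is done with
  \<open>(\<bar>z\<bar>\<^sup>2 + \<delta>\<^sup>2)\<^bsup>-(N-\<alpha>)/2\<^esup>\<close>. After adding the identities of the two equations the gradient of this kernel is
  paired with \<open>X x - X y\<close>; as \<open>X\<close> is Lipschitz, the pairing is bounded by the kernel itself,
  uniformly in \<open>\<delta>\<close>, and also uniformly in the radius of the cutoff.
\<close>

section \<open>Smooth mollifiers\<close>

text \<open>Smoothness quantifies over all iterated partial derivatives. It is proved by exhibiting a set of
  differentiable functions whose partial derivatives are polynomials in members of the set; the induction
  over multi-indices is then done once, for the algebra that the set generates.\<close>

inductive_set generated_algebra :: "('a \<Rightarrow> real) set \<Rightarrow> ('a \<Rightarrow> real) set"
  for G :: "('a \<Rightarrow> real) set" where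
  generator: "g \<in> G \<Longrightarrow> g \<in> generated_algebra G"
| const: "(\<lambda>x. c) \<in> generated_algebra G"
| add: "f \<in> generated_algebra G \<Longrightarrow> g \<in> generated_algebra G \<Longrightarrow>
    (\<lambda>x. f x + g x) \<in> generated_algebra G"
| mult: "f \<in> generated_algebra G \<Longrightarrow> g \<in> generated_algebra G \<Longrightarrow>
    (\<lambda>x. f x * g x) \<in> generated_algebra G"

lemma partial_deriv_eq:
  assumes "(f has_derivative f') (at x)"
  shows "partial_deriv b f x = f' b"
  unfolding partial_deriv_def using frechet_derivative_at[OF assms] by simp

lemma generated_algebra_closed:
  fixes G :: "('a::euclidean_space \<Rightarrow> real) set"
  assumes G: "\<And>g x. g \<in> G \<Longrightarrow> g differentiable (at x)"
    "\<And>g b. g \<in> G \<Longrightarrow> b \<in> Basis \<Longrightarrow> partial_deriv b g \<in> generated_algebra G"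
    and f: "f \<in> generated_algebra G"
  shows "(\<forall>x. f differentiable (at x)) \<and> (\<forall>b\<in>Basis. partial_deriv b f \<in> generated_algebra G)"
  using f
proof induction
  case (generator g)
  then show ?case using G by auto
next
  case (const c)
  have "partial_deriv b (\<lambda>x. c) = (\<lambda>x::'a. 0)" for b
    by (rule ext, rule partial_deriv_eq[where f'="\<lambda>_. 0"]) auto
  then show ?case using generated_algebra.const by auto
next
  case (add f g)
  have "partial_deriv b (\<lambda>x. f x + g x) = (\<lambda>x. partial_deriv b f x + partial_deriv b g x)" for b
  proof
    fix x
    from add obtain f' g' where d: "(f has_derivative f') (at x)" "(g has_derivative g') (at x)"
      unfolding differentiable_def by blast
    show "partial_deriv b (\<lambda>x. f x + g x) x = partial_deriv b f x + partial_deriv b g x"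
      by (simp add: partial_deriv_eq[OF has_derivative_add[OF d]] partial_deriv_eq[OF d(1)]
          partial_deriv_eq[OF d(2)])
  qed
  then show ?case using add by (auto intro!: generated_algebra.add)
next
  case (mult f g)
  have "partial_deriv b (\<lambda>x. f x * g x) =
      (\<lambda>x. f x * partial_deriv b g x + partial_deriv b f x * g x)" for b
  proof
    fix x
    from mult obtain f' g' where d: "(f has_derivative f') (at x)" "(g has_derivative g') (at x)"
      unfolding differentiable_def by blast
    show "partial_deriv b (\<lambda>x. f x * g x) x = f x * partial_deriv b g x + partial_deriv b f x * g x"
      by (simp add: partial_deriv_eq[OF has_derivative_mult[OF d]] partial_deriv_eq[OF d(1)]
          partial_deriv_eq[OF d(2)])
  qed
  then show ?case using mult by (auto intro!: generated_algebra.add generated_algebra.mult)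
qed

lemma smooth_generated_algebra:
  fixes G :: "('a::euclidean_space \<Rightarrow> real) set"
  assumes G: "\<And>g x. g \<in> G \<Longrightarrow> g differentiable (at x)"
    "\<And>g b. g \<in> G \<Longrightarrow> b \<in> Basis \<Longrightarrow> partial_deriv b g \<in> generated_algebra G"
    and f: "f \<in> generated_algebra G"
  shows "smooth f"
proof -
  have "iter_partial_deriv bs f \<in> generated_algebra G" if "set bs \<subseteq> Basis" for bs
    using that by (induction bs) (use f generated_algebra_closed[OF G] in auto)
  then show ?thesis
    unfolding smooth_def using generated_algebra_closed[OF G] by blast
qed

text \<open>The factors \<open>t\<^bsup>-k\<^esup>\<close> make the family closed under differentiation up to linear combinations.\<close>

definition flat_exp :: "nat \<Rightarrow> real \<Rightarrow> real" where
  "flat_exp k t = (if t > 0 then (1 / t) ^ k * exp (- (1 / t)) else 0)"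

lemma flat_exp_tendsto_0: "(flat_exp k \<longlongrightarrow> 0) (at 0)"
proof -
  have "((\<lambda>t::real. (1 / t) ^ k / exp (1 / t)) \<longlongrightarrow> 0) (at_right 0)"
    using filterlim_compose[OF tendsto_power_div_exp_0 filterlim_inverse_at_top_right]
    by (simp add: inverse_eq_divide)
  then have "(flat_exp k \<longlongrightarrow> 0) (at_right 0)"
    by (rule Lim_transform_eventually)
      (auto simp: eventually_at_filter flat_exp_def exp_minus field_simps)
  moreover have "(flat_exp k \<longlongrightarrow> 0) (at_left 0)"
    by (rule Lim_transform_eventually[OF tendsto_const])
      (auto simp: eventually_at_filter flat_exp_def)
  ultimately show ?thesis
    by (simp add: filterlim_split_at)
qed

text \<open>At the origin the difference quotient of one member of the family is the next member, which tends
  to 0; so the one-sided gluing is smooth.\<close>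

lemma flat_exp_deriv:
  "(flat_exp k has_real_derivative (flat_exp (k + 2) t - real k * flat_exp (k + 1) t)) (at t)"
proof -
  consider "t > 0" | "t < 0" | "t = 0" by linarith
  then show ?thesis
  proof cases
    case 1
    have "((\<lambda>t. (1 / t) ^ k * exp (- (1 / t))) has_real_derivative
        (flat_exp (k + 2) t - real k * flat_exp (k + 1) t)) (at t)"
      using 1
    proof -
      have r: "((\<lambda>t::real. 1 / t) has_real_derivative - ((1 / t) * (1 / t))) (at t)"
        using 1 by (auto intro!: derivative_eq_intros)
      show ?thesis
        by (rule derivative_eq_intros r refl | (use 1 in \<open>cases k; simp add: flat_exp_def algebra_simps\<close>))+
    qed
    then show ?thesis
      by (rule has_field_derivative_transform_within_open[of _ _ _ "{0<..}"])
        (use 1 in \<open>auto simp: flat_exp_def\<close>)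
  next
    case 2
    have "((\<lambda>t. 0) has_real_derivative (flat_exp (k + 2) t - real k * flat_exp (k + 1) t)) (at t)"
      using 2 by (auto simp: flat_exp_def)
    then show ?thesis
      by (rule has_field_derivative_transform_within_open[of _ _ _ "{..<0}"])
        (use 2 in \<open>auto simp: flat_exp_def\<close>)
  next
    case 3
    have "((\<lambda>h. (flat_exp k (0 + h) - flat_exp k 0) / h) \<longlongrightarrow> 0) (at 0)"
      by (rule Lim_transform_eventually[OF flat_exp_tendsto_0[of "k+1"]])
        (auto simp: eventually_at_filter flat_exp_def field_simps)
    then show ?thesis using 3 by (simp add: DERIV_def flat_exp_def)
  qed
qed

text \<open>A product over the coordinates, rather than a function of the norm: each factor is a \<open>flat_exp\<close> of an
  affine function, so that the partial derivatives stay in the generated algebra.\<close>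

definition box_bump :: "real \<Rightarrow> 'a::euclidean_space \<Rightarrow> real" where
  "box_bump c x = (\<Prod>b\<in>Basis. flat_exp 0 (1 + c * (x \<bullet> b)) * flat_exp 0 (1 - c * (x \<bullet> b)))"

lemma generated_algebra_prod:
  assumes "finite I" "\<And>i. i \<in> I \<Longrightarrow> f i \<in> generated_algebra G"
  shows "(\<lambda>x. \<Prod>i\<in>I. f i x) \<in> generated_algebra G"
  using assms by (induction I) (auto intro: generated_algebra.const generated_algebra.mult)

lemma smooth_box_bump: "smooth (box_bump c :: 'a::euclidean_space \<Rightarrow> real)"
proof -
  define G where "G = {\<lambda>x::'a. flat_exp k (1 + s * (x \<bullet> b)) | k s b. True}"
  have g: "((\<lambda>x. flat_exp k (1 + s * (x \<bullet> b))) has_derivative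
      (\<lambda>h. (s * (h \<bullet> b)) * (flat_exp (k + 2) (1 + s * (x \<bullet> b)) - real k * flat_exp (k + 1) (1 + s * (x \<bullet> b)))))
      (at x)" for k s b and x :: 'a
  proof -
    have "((\<lambda>x::'a. 1 + s * (x \<bullet> b)) has_derivative (\<lambda>h. s * (h \<bullet> b))) (at x)"
      by (auto intro!: derivative_eq_intros)
    from DERIV_compose_FDERIV[OF flat_exp_deriv this] show ?thesis .
  qed
  show ?thesis
  proof (rule smooth_generated_algebra[of G])
    show "g differentiable at x" if "g \<in> G" for g x
      using that g unfolding G_def differentiable_def by blast
    show "partial_deriv d f \<in> generated_algebra G" if fG: "f \<in> G" and "d \<in> Basis" for f d
    proof -
      obtain k s b where f: "f = (\<lambda>x. flat_exp k (1 + s * (x \<bullet> b)))"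
        using fG unfolding G_def by blast
      have "partial_deriv d f = (\<lambda>x. (s * (d \<bullet> b)) * (flat_exp (k + 2) (1 + s * (x \<bullet> b))
          + (- real k) * flat_exp (k + 1) (1 + s * (x \<bullet> b))))"
        unfolding f by (rule ext, subst partial_deriv_eq[OF g]) simp
      also have "\<dots> \<in> generated_algebra G"
        by (intro generated_algebra.mult generated_algebra.const generated_algebra.add
            generated_algebra.generator) (auto simp: G_def)
      finally show ?thesis .
    qed
    have "(\<lambda>x::'a. flat_exp 0 (1 - c * (x \<bullet> b))) \<in> G" for b
      unfolding G_def by (simp, rule exI[of _ 0], rule exI[of _ "-c"], rule exI[of _ b]) simp
    then show "(box_bump c :: 'a \<Rightarrow> real) \<in> generated_algebra G"
      unfolding box_bump_def
      by (intro generated_algebra_prod generated_algebra.mult generated_algebra.generator)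
        (auto simp: G_def)
  qed
qed

lemma box_bump_nonneg: "0 \<le> box_bump c x"
  unfolding box_bump_def flat_exp_def by (intro prod_nonneg) auto

lemma box_bump_even: "box_bump c (- x) = box_bump c x"
  unfolding box_bump_def by (intro prod.cong refl) (simp add: mult.commute)

lemma box_bump_support:
  fixes x :: "'a::euclidean_space"
  assumes "c > 0" "box_bump c x \<noteq> 0"
  shows "norm x \<le> real DIM('a) / c"
proof -
  have "\<bar>x \<bullet> b\<bar> \<le> 1 / c" if "b \<in> Basis" for b
  proof -
    have "flat_exp 0 (1 + c * (x \<bullet> b)) * flat_exp 0 (1 - c * (x \<bullet> b)) \<noteq> 0"
      using assms(2) that unfolding box_bump_def by simp
    then have "1 + c * (x \<bullet> b) > 0" "1 - c * (x \<bullet> b) > 0"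
      by (auto simp: flat_exp_def split: if_splits)
    then show ?thesis using assms(1) by (simp add: field_simps abs_le_iff)
  qed
  then have "(\<Sum>b\<in>Basis. \<bar>x \<bullet> b\<bar>) \<le> (\<Sum>b\<in>(Basis::'a set). 1 / c)" by (intro sum_mono) auto
  with norm_le_l1[of x] show ?thesis by simp
qed

lemma smooth_differentiable: "smooth f \<Longrightarrow> f differentiable (at x)"
  unfolding smooth_def by (metis bot.extremum iter_partial_deriv.simps(1) list.set(1))

lemma smooth_partial: "smooth f \<Longrightarrow> b \<in> Basis \<Longrightarrow> smooth (partial_deriv b f)"
  unfolding smooth_def
proof (intro allI impI)
  fix bs :: "'a list" and x
  assume f: "\<forall>bs. set bs \<subseteq> Basis \<longrightarrow> (\<forall>x. iter_partial_deriv bs f differentiable at x)"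
    and b: "b \<in> Basis" "set bs \<subseteq> Basis"
  have "iter_partial_deriv bs (partial_deriv b f) = iter_partial_deriv (bs @ [b]) f"
    by (induction bs) auto
  then show "iter_partial_deriv bs (partial_deriv b f) differentiable at x"
    using f b by auto
qed

lemma smooth_has_derivative:
  assumes "smooth f"
  shows "(f has_derivative (\<lambda>h. \<Sum>b\<in>Basis. (h \<bullet> b) * partial_deriv b f x)) (at x)"
proof -
  from smooth_differentiable[OF assms] obtain f' where f': "(f has_derivative f') (at x)"
    unfolding differentiable_def by blast
  have "f' h = (\<Sum>b\<in>Basis. (h \<bullet> b) * partial_deriv b f x)" for h
  proof -
    interpret bounded_linear f' using f' by (rule has_derivative_bounded_linear)
    have "f' h = f' (\<Sum>b\<in>Basis. (h \<bullet> b) *\<^sub>R b)" by (simp add: euclidean_representation)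
    also have "\<dots> = (\<Sum>b\<in>Basis. (h \<bullet> b) * partial_deriv b f x)"
      by (simp add: sum scaleR partial_deriv_eq[OF f'])
    finally show ?thesis .
  qed
  with f' show ?thesis by (metis (no_types, lifting) ext)
qed

lemma smooth_continuous: "smooth f \<Longrightarrow> continuous_on A f"
  by (simp add: continuous_at_imp_continuous_on differentiable_imp_continuous_within smooth_differentiable)

lemma smooth_borel [measurable_dest]: "smooth f \<Longrightarrow> f \<in> borel_measurable borel"
  by (rule borel_measurable_continuous_onI) (rule smooth_continuous)

lemma test_functions_UNIV:
  "\<phi> \<in> test_functions UNIV \<longleftrightarrow> smooth \<phi> \<and> (\<exists>R. \<forall>x. \<phi> x \<noteq> 0 \<longrightarrow> norm x \<le> R)"
  unfolding test_functions_def by (auto simp: bounded_iff)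

lemma test_function_partial:
  assumes "\<phi> \<in> test_functions UNIV" "b \<in> Basis"
  shows "partial_deriv b \<phi> \<in> test_functions UNIV"
proof -
  obtain R where R: "\<And>x. \<phi> x \<noteq> 0 \<Longrightarrow> norm x \<le> R" and s: "smooth \<phi>"
    using assms unfolding test_functions_UNIV by blast
  have "partial_deriv b \<phi> x = 0" if "norm x > R" for x
  proof -
    have "(\<phi> has_derivative (\<lambda>h. 0)) (at x)"
    proof (rule has_derivative_transform_within_open[of "\<lambda>x. 0" "\<lambda>h. 0" x UNIV "- cball 0 R"])
      show "\<And>y. y \<in> - cball 0 R \<Longrightarrow> 0 = \<phi> y" using R by force
    qed (use that in auto)
    from partial_deriv_eq[OF this] show ?thesis .
  qed
  then show ?thesis using smooth_partial[OF s assms(2)] unfolding test_functions_UNIV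
    by (intro conjI exI[of _ R]) force+
qed

text \<open>Evenness makes convolution with \<open>\<rho> n\<close> a symmetric operator, see \<open>moll_adjoint\<close>.\<close>

definition mollifier :: "(nat \<Rightarrow> 'a::euclidean_space \<Rightarrow> real) \<Rightarrow> bool" where
  "mollifier \<rho> \<longleftrightarrow> (\<forall>n. \<rho> n \<in> test_functions UNIV \<and> (\<forall>x. 0 \<le> \<rho> n x) \<and> (\<forall>x. \<rho> n (- x) = \<rho> n x) \<and>
     integrable lborel (\<rho> n) \<and> (LINT x|lborel. \<rho> n x) = 1 \<and>
     (\<forall>x. \<rho> n x \<noteq> 0 \<longrightarrow> norm x \<le> 1 / real (Suc n)))"

lemma mollifier_exists: "\<exists>\<rho> :: nat \<Rightarrow> 'a::euclidean_space \<Rightarrow> real. mollifier \<rho>"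
proof -
  \<comment> \<open>This scale puts the support into the ball of radius \<open>1 / Suc n\<close>.\<close>
  define c where "c n = real DIM('a) * real (Suc n)" for n
  define Z where "Z n = (LINT x|lborel. box_bump (c n) (x::'a))" for n
  have c0: "c n > 0" for n unfolding c_def by simp
  have supp: "norm x \<le> 1 / real (Suc n)" if "box_bump (c n) (x::'a) \<noteq> 0" for x n
    using box_bump_support[OF c0 that] by (simp add: c_def)
  have cont: "continuous_on A (box_bump (c n) :: 'a \<Rightarrow> real)" for A n
    by (rule smooth_continuous[OF smooth_box_bump])
  have int: "integrable lborel (box_bump (c n) :: 'a \<Rightarrow> real)" for n
  proof -
    have "set_integrable lborel (cball 0 1) (box_bump (c n) :: 'a \<Rightarrow> real)"
      unfolding set_integrable_def by (rule borel_integrable_compact) (use cont in auto)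
    moreover have "(\<lambda>x. indicator (cball 0 1) x *\<^sub>R box_bump (c n) x) = (box_bump (c n) :: 'a \<Rightarrow> real)"
    proof
      fix x :: 'a
      have "1 / real (Suc n) \<le> 1" by simp
      with supp[of n x] have "box_bump (c n) x \<noteq> 0 \<Longrightarrow> norm x \<le> 1" by linarith
      then show "indicator (cball 0 1) x *\<^sub>R box_bump (c n) x = box_bump (c n) x"
        by (cases "box_bump (c n) x = 0") (simp_all add: indicator_def)
    qed
    ultimately show ?thesis unfolding set_integrable_def by simp
  qed
  have Zpos: "Z n > 0" for n
  proof -
    have "Z n \<ge> 0" unfolding Z_def by (simp add: box_bump_nonneg)
    moreover have "Z n \<noteq> 0"
    proof
      assume "Z n = 0"
      then have "AE x in lborel. box_bump (c n) (x::'a) = 0"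
        unfolding Z_def by (subst (asm) integral_nonneg_eq_0_iff_AE) (auto simp: int box_bump_nonneg)
      then have ae: "AE x in lborel. x \<notin> {x. box_bump (c n) (x::'a) \<noteq> 0}" by simp
      have op: "open {x. box_bump (c n) (x::'a) \<noteq> 0}"
        using cont[of UNIV n] by (auto intro!: open_Collect_neq continuous_intros)
      have "box_bump (c n) (0::'a) \<noteq> 0" by (simp add: box_bump_def flat_exp_def)
      then have "{x. box_bump (c n) (x::'a) \<noteq> 0} \<noteq> {}" by blast
      then have "{x. box_bump (c n) (x::'a) \<noteq> 0} \<notin> null_sets lborel"
        using op open_not_negligible negligible_iff_null_sets null_sets_completionI by blast
      moreover have "{x. box_bump (c n) (x::'a) \<noteq> 0} \<in> null_sets lborel"
        by (subst AE_iff_null_sets) (use op ae in auto)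
      ultimately show False by blast
    qed
    ultimately show ?thesis by linarith
  qed
  have "mollifier (\<lambda>n x. (1 / Z n) * box_bump (c n) (x::'a))"
    unfolding mollifier_def
  proof (intro allI conjI)
    fix n
    have sm: "smooth (\<lambda>x. (1 / Z n) * box_bump (c n) (x::'a))"
    proof (rule smooth_generated_algebra[of "{iter_partial_deriv bs (box_bump (c n)) | bs. set bs \<subseteq> Basis}"])
      fix g b assume "g \<in> {iter_partial_deriv bs (box_bump (c n)) |bs. set bs \<subseteq> (Basis::'a set)}" "b \<in> (Basis::'a set)"
      then obtain bs where "g = iter_partial_deriv bs (box_bump (c n))" "set (b # bs) \<subseteq> Basis" by auto
      then show "partial_deriv b g \<in> generated_algebra {iter_partial_deriv bs (box_bump (c n)) |bs. set bs \<subseteq> Basis}"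
        by (intro generated_algebra.generator) (metis (mono_tags, lifting) CollectI iter_partial_deriv.simps(2))
    next
      have "box_bump (c n) = iter_partial_deriv [] (box_bump (c n))" by simp
      then have "box_bump (c n) \<in> {iter_partial_deriv bs (box_bump (c n)) |bs. set bs \<subseteq> (Basis::'a set)}"
        by (metis (mono_tags, lifting) CollectI bot.extremum list.set(1))
      then show "(\<lambda>x. (1 / Z n) * box_bump (c n) (x::'a)) \<in> generated_algebra {iter_partial_deriv bs (box_bump (c n)) |bs. set bs \<subseteq> Basis}"
        by (intro generated_algebra.mult generated_algebra.const generated_algebra.generator)
    qed (use smooth_box_bump in \<open>auto simp: smooth_def\<close>)
    show "(\<lambda>x. 1 / Z n * box_bump (c n) (x::'a)) \<in> test_functions UNIV"
      unfolding test_functions_UNIV using sm supp[of n] by auto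
    show "0 \<le> 1 / Z n * box_bump (c n) x" for x :: 'a
      using Zpos[of n] by (simp add: box_bump_nonneg)
    show "1 / Z n * box_bump (c n) (- x) = 1 / Z n * box_bump (c n) x" for x :: 'a
      by (simp add: box_bump_even)
    show "integrable lborel (\<lambda>x::'a. 1 / Z n * box_bump (c n) x)"
      using int by simp
    show "(LINT x|lborel. 1 / Z n * box_bump (c n) (x::'a)) = 1"
      using Zpos[of n] by (simp add: Z_def[symmetric])
    show "1 / Z n * box_bump (c n) x \<noteq> 0 \<longrightarrow> norm x \<le> 1 / real (Suc n)" for x :: 'a
      using supp[of n x] by auto
  qed
  then show ?thesis by blast
qed

section \<open>Convolution with a test function\<close>

lemma lborel_distr_translate: "distr lborel borel (\<lambda>x. x - z) = (lborel :: 'a::euclidean_space measure)"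
  using lborel_distr_plus[of "- z"] by (simp add: add.commute cong: distr_cong)

lemma lborel_distr_reflect: "distr lborel borel (\<lambda>x. z - x) = (lborel :: 'a::euclidean_space measure)"
  by (subst (2) lborel_affine[of "-1" z]) (auto simp: density_1 one_ennreal_def[symmetric])

lemma nn_integral_translate:
  fixes f :: "'a::euclidean_space \<Rightarrow> ennreal"
  assumes [measurable]: "f \<in> borel_measurable borel"
  shows "(\<integral>\<^sup>+x. f (x - z) \<partial>lborel) = (\<integral>\<^sup>+x. f x \<partial>lborel)"
  by (subst (2) lborel_distr_translate[of z, symmetric]) (simp add: nn_integral_distr)

lemma nn_integral_reflect:
  fixes f :: "'a::euclidean_space \<Rightarrow> ennreal"
  assumes [measurable]: "f \<in> borel_measurable borel"
  shows "(\<integral>\<^sup>+x. f (z - x) \<partial>lborel) = (\<integral>\<^sup>+x. f x \<partial>lborel)"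
  by (subst (2) lborel_distr_reflect[of z, symmetric]) (simp add: nn_integral_distr)

lemma integral_translate:
  fixes f :: "'a::euclidean_space \<Rightarrow> real"
  assumes [measurable]: "f \<in> borel_measurable borel"
  shows "(LINT x|lborel. f (x - z)) = (LINT x|lborel. f x)"
  by (subst (2) lborel_distr_translate[of z, symmetric]) (simp add: integral_distr)

lemma integral_reflect:
  fixes f :: "'a::euclidean_space \<Rightarrow> real"
  assumes [measurable]: "f \<in> borel_measurable borel"
  shows "(LINT x|lborel. f (z - x)) = (LINT x|lborel. f x)"
  by (subst (2) lborel_distr_reflect[of z, symmetric]) (simp add: integral_distr)

lemma integrable_translate:
  fixes f :: "'a::euclidean_space \<Rightarrow> real"
  assumes "integrable lborel f"
  shows "integrable lborel (\<lambda>x. f (x - z))"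
proof -
  have [measurable]: "f \<in> borel_measurable borel" using borel_measurable_integrable[OF assms] by simp
  have "integrable (distr lborel borel (\<lambda>x. x - z)) f" using assms by (simp add: lborel_distr_translate)
  then show ?thesis by (subst (asm) integrable_distr_eq) auto
qed

definition bounded_support :: "('a::euclidean_space \<Rightarrow> real) \<Rightarrow> bool" where
  "bounded_support F \<longleftrightarrow> F \<in> borel_measurable borel \<and>
     (\<exists>C R. \<forall>x. \<bar>F x\<bar> \<le> C \<and> (R < norm x \<longrightarrow> F x = 0))"

definition locally_bounded :: "('a::euclidean_space \<Rightarrow> real) \<Rightarrow> bool" where
  "locally_bounded F \<longleftrightarrow> F \<in> borel_measurable borel \<and> (\<forall>R. \<exists>C. \<forall>x. norm x \<le> R \<longrightarrow> \<bar>F x\<bar> \<le> C)"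

text \<open>The Borel counterpart of the local integrability in the definition of weak derivatives; all the
  analysis below is done with Borel functions on \<open>lborel\<close>, whose measurability is preserved by translations and products.\<close>

definition loc_integrable :: "('a::euclidean_space \<Rightarrow> real) \<Rightarrow> bool" where
  "loc_integrable h \<longleftrightarrow> h \<in> borel_measurable borel \<and>
     (\<forall>R. integrable lborel (\<lambda>x. indicator (cball 0 R) x * h x))"

lemma bounded_support_borel [measurable_dest]: "bounded_support F \<Longrightarrow> F \<in> borel_measurable borel"
  unfolding bounded_support_def by blast

lemma locally_bounded_borel [measurable_dest]: "locally_bounded F \<Longrightarrow> F \<in> borel_measurable borel"
  unfolding locally_bounded_def by blast

lemma loc_integrable_borel [measurable_dest]: "loc_integrable F \<Longrightarrow> F \<in> borel_measurable borel"
  unfolding loc_integrable_def by blast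

lemma bounded_supportE:
  assumes "bounded_support F"
  obtains C R where "C > 0" "R > 0" "\<And>x. \<bar>F x\<bar> \<le> C" "\<And>x. R < norm x \<Longrightarrow> F x = 0"
proof -
  from assms obtain C R where "\<And>x. \<bar>F x\<bar> \<le> C" "\<And>x. R < norm x \<Longrightarrow> F x = 0"
    unfolding bounded_support_def by blast
  then show ?thesis by (intro that[of "max C 1" "max R 1"]) (auto intro: le_max_iff_disj[THEN iffD2])
qed

lemma bounded_supportI:
  "F \<in> borel_measurable borel \<Longrightarrow> (\<And>x. \<bar>F x\<bar> \<le> C) \<Longrightarrow> (\<And>x. R < norm x \<Longrightarrow> F x = 0) \<Longrightarrow>
    bounded_support F"
  unfolding bounded_support_def by blast

lemma bounded_support_locally_bounded: "bounded_support F \<Longrightarrow> locally_bounded F"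
  unfolding bounded_support_def locally_bounded_def by blast

lemma locally_boundedE:
  assumes "locally_bounded F"
  obtains C where "C > 0" "\<And>x. norm x \<le> R \<Longrightarrow> \<bar>F x\<bar> \<le> C"
proof -
  from assms obtain C where "\<And>x. norm x \<le> R \<Longrightarrow> \<bar>F x\<bar> \<le> C"
    unfolding locally_bounded_def by blast
  then show ?thesis by (intro that[of "max C 1"]) (auto intro: le_max_iff_disj[THEN iffD2])
qed

lemma locally_bounded_const [intro, simp]: "locally_bounded (\<lambda>x. c)"
  unfolding locally_bounded_def by auto

lemma locally_bounded_add [intro]:
  assumes "locally_bounded F" "locally_bounded G"
  shows "locally_bounded (\<lambda>x. F x + G x)"
proof -
  note [measurable] = assms
  show ?thesis
    unfolding locally_bounded_def
  proof (intro conjI allI)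
    fix R
    obtain C D where "\<And>x. norm x \<le> R \<Longrightarrow> \<bar>F x\<bar> \<le> C" "\<And>x. norm x \<le> R \<Longrightarrow> \<bar>G x\<bar> \<le> D"
      using assms unfolding locally_bounded_def by meson
    then show "\<exists>C. \<forall>x. norm x \<le> R \<longrightarrow> \<bar>F x + G x\<bar> \<le> C"
      by (intro exI[of _ "C + D"]) (meson abs_triangle_ineq add_mono order_trans)
  qed measurable
qed

lemma locally_bounded_mult [intro]:
  assumes "locally_bounded F" "locally_bounded G"
  shows "locally_bounded (\<lambda>x. F x * G x)"
proof -
  note [measurable] = assms
  show ?thesis
    unfolding locally_bounded_def
  proof (intro conjI allI)
    fix R
    obtain C where C: "C > 0" "\<And>x. norm x \<le> R \<Longrightarrow> \<bar>F x\<bar> \<le> C" using assms(1) by (rule locally_boundedE[where R=R]) blast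
    obtain D where D: "D > 0" "\<And>x. norm x \<le> R \<Longrightarrow> \<bar>G x\<bar> \<le> D" using assms(2) by (rule locally_boundedE[where R=R]) blast
    show "\<exists>C. \<forall>x. norm x \<le> R \<longrightarrow> \<bar>F x * G x\<bar> \<le> C"
      using C D by (intro exI[of _ "C * D"]) (auto simp: abs_mult intro!: mult_mono)
  qed measurable
qed

lemma bounded_support_mult [intro]:
  assumes "bounded_support F" "locally_bounded G"
  shows "bounded_support (\<lambda>x. F x * G x)"
proof -
  note [measurable] = assms
  obtain C R where C: "C > 0" "\<And>x. \<bar>F x\<bar> \<le> C" "\<And>x. R < norm x \<Longrightarrow> F x = 0"
    using assms(1) by (rule bounded_supportE) blast
  obtain D where D: "D > 0" "\<And>x. norm x \<le> R \<Longrightarrow> \<bar>G x\<bar> \<le> D" using assms(2) by (rule locally_boundedE[where R=R]) blast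
  have "\<bar>F x * G x\<bar> \<le> C * D" for x
    using C D by (cases "norm x \<le> R") (auto simp: abs_mult intro!: mult_mono)
  then show ?thesis
    by (rule bounded_supportI[where R=R, rotated]) (use C(3) in auto)
qed

lemma bounded_support_zero [intro, simp]: "bounded_support (\<lambda>x. 0)"
  unfolding bounded_support_def by auto

lemma bounded_support_add [intro]:
  assumes "bounded_support F" "bounded_support G"
  shows "bounded_support (\<lambda>x. F x + G x)"
proof -
  note [measurable] = assms
  obtain C R where C: "\<And>x. \<bar>F x\<bar> \<le> C" "\<And>x. R < norm x \<Longrightarrow> F x = 0"
    using assms(1) by (rule bounded_supportE) blast
  obtain D S where D: "\<And>x. \<bar>G x\<bar> \<le> D" "\<And>x. S < norm x \<Longrightarrow> G x = 0"
    using assms(2) by (rule bounded_supportE) blast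
  have "\<bar>F x + G x\<bar> \<le> C + D" for x using C(1)[of x] D(1)[of x] by linarith
  then show ?thesis
    by (rule bounded_supportI[where R="max R S", rotated]) (use C(2) D(2) in auto)
qed

lemma bounded_support_sum [intro]:
  "(\<And>i. i \<in> I \<Longrightarrow> bounded_support (f i)) \<Longrightarrow> bounded_support (\<lambda>x. \<Sum>i\<in>I. f i x)"
  by (induction I rule: infinite_finite_induct) auto

lemma integrable_bounded_support_mult:
  assumes "bounded_support F" "loc_integrable h"
  shows "integrable lborel (\<lambda>x. F x * h x)"
proof -
  note [measurable] = assms
  obtain C R where C: "C > 0" "\<And>x. \<bar>F x\<bar> \<le> C" "\<And>x. R < norm x \<Longrightarrow> F x = 0"
    using assms(1) by (rule bounded_supportE) blast
  have "integrable lborel (\<lambda>x. C * (indicator (cball 0 R) x * h x))"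
    using assms(2) unfolding loc_integrable_def by auto
  then show ?thesis
  proof (rule Bochner_Integration.integrable_bound)
    show "AE x in lborel. norm (F x * h x) \<le> norm (C * (indicator (cball 0 R) x * h x))"
      using C by (intro AE_I2) (auto simp: indicator_def abs_mult not_le intro!: mult_right_mono)
  qed measurable
qed

lemma loc_integrable_locally_bounded:
  assumes "locally_bounded F" shows "loc_integrable F"
proof -
  note [measurable] = assms
  show ?thesis
    unfolding loc_integrable_def
  proof (intro conjI allI)
    fix R
    obtain D where D: "D > 0" "\<And>x. norm x \<le> R \<Longrightarrow> \<bar>F x\<bar> \<le> D" using assms by (rule locally_boundedE[where R=R]) blast
    have "integrable lborel (\<lambda>x::'a. indicator (cball 0 R) x * D)"
      using emeasure_bounded_finite[of "cball (0::'a) R"]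
      by (intro integrable_mult_left integrable_real_indicator) auto
    then show "integrable lborel (\<lambda>x. indicator (cball 0 R) x * F x)"
      by (rule Bochner_Integration.integrable_bound) (use D in \<open>auto simp: indicator_def\<close>)
  qed measurable
qed

lemma bounded_support_integrable: "bounded_support F \<Longrightarrow> integrable lborel F"
  using integrable_bounded_support_mult[of F "\<lambda>x. 1"] loc_integrable_locally_bounded by fastforce

lemma integrable_loc_integrable:
  assumes "integrable lborel f" shows "loc_integrable f"
  unfolding loc_integrable_def
  using assms borel_measurable_integrable[OF assms] by (auto intro: integrable_real_mult_indicator simp: mult.commute)

lemma test_function_bounded_support:
  assumes "\<phi> \<in> test_functions UNIV"
  shows "bounded_support \<phi>"
proof -
  obtain R where R: "\<And>x. \<phi> x \<noteq> 0 \<Longrightarrow> norm x \<le> R" and s: "smooth \<phi>"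
    using assms unfolding test_functions_UNIV by blast
  have "compact (\<phi> ` cball 0 R)"
    by (intro compact_continuous_image smooth_continuous s) auto
  then obtain C where C: "\<And>x. norm x \<le> R \<Longrightarrow> \<bar>\<phi> x\<bar> \<le> C"
    using compact_imp_bounded[of "\<phi> ` cball 0 R"] unfolding bounded_iff
    by (metis imageI mem_cball_0 real_norm_def)
  have "\<bar>\<phi> x\<bar> \<le> max C 0" for x
    using C[of x] R[of x] by (cases "\<phi> x = 0") (simp_all add: le_max_iff_disj)
  then show ?thesis
    by (rule bounded_supportI[where R=R, rotated]) (use R smooth_borel[OF s] in force)+
qed

definition moll :: "('a::euclidean_space \<Rightarrow> real) \<Rightarrow> ('a \<Rightarrow> real) \<Rightarrow> 'a \<Rightarrow> real" where
  "moll \<phi> h x = (LINT y|lborel. \<phi> (x - y) * h y)"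

lemma bounded_support_reflect:
  assumes "bounded_support \<phi>" shows "bounded_support (\<lambda>y. \<phi> (x - y))"
proof -
  note [measurable] = bounded_support_borel[OF assms]
  obtain C R where C: "\<And>x. \<bar>\<phi> x\<bar> \<le> C" "\<And>x. R < norm x \<Longrightarrow> \<phi> x = 0"
    using assms(1) by (rule bounded_supportE) blast
  have "(\<lambda>y. \<phi> (x - y)) \<in> borel_measurable borel" by measurable
  moreover have "\<phi> (x - y) = 0" if "R + norm x < norm y" for y
    using that norm_triangle_ineq4[of x "x - y"] by (intro C(2)) simp
  ultimately show ?thesis
    by (intro bounded_supportI[where R="R + norm x" and C=C] C(1)) auto
qed

lemma moll_integrable:
  "bounded_support \<phi> \<Longrightarrow> loc_integrable h \<Longrightarrow> integrable lborel (\<lambda>y. \<phi> (x - y) * h y)"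
  by (rule integrable_bounded_support_mult[OF bounded_support_reflect])

lemma moll_borel [measurable]:
  assumes [measurable]: "\<phi> \<in> borel_measurable borel" "h \<in> borel_measurable borel"
  shows "moll \<phi> h \<in> borel_measurable borel"
  unfolding moll_def[abs_def] by measurable

lemma moll_locally_bounded:
  assumes "bounded_support \<phi>" "loc_integrable h"
  shows "locally_bounded (moll \<phi> h)"
proof -
  note [measurable] = assms
  obtain C R where C: "C > 0" "\<And>x. \<bar>\<phi> x\<bar> \<le> C" "\<And>x. R < norm x \<Longrightarrow> \<phi> x = 0"
    using assms(1) by (rule bounded_supportE) blast
  show ?thesis
    unfolding locally_bounded_def
  proof (intro conjI allI)
    fix S
    have "\<bar>moll \<phi> h x\<bar> \<le> (LINT y|lborel. C * \<bar>indicator (cball 0 (R + S)) y * h y\<bar>)" if x: "norm x \<le> S" for x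
    proof -
      have "\<bar>moll \<phi> h x\<bar> \<le> (LINT y|lborel. \<bar>\<phi> (x - y) * h y\<bar>)"
        unfolding moll_def by (rule integral_abs_bound)
      also have "\<dots> \<le> (LINT y|lborel. C * \<bar>indicator (cball 0 (R + S)) y * h y\<bar>)"
      proof (rule integral_mono)
        show "integrable lborel (\<lambda>y. \<bar>\<phi> (x - y) * h y\<bar>)"
          by (intro integrable_abs moll_integrable assms)
        show "integrable lborel (\<lambda>y. C * \<bar>indicator (cball 0 (R + S)) y * h y\<bar>)"
          using assms(2) unfolding loc_integrable_def by auto
        show "\<bar>\<phi> (x - y) * h y\<bar> \<le> C * \<bar>indicator (cball 0 (R + S)) y * h y\<bar>" for y
        proof (cases "norm y \<le> R + S")
          case True
          then show ?thesis using C(2)[of "x - y"] by (auto simp: abs_mult intro!: mult_right_mono)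
        next
          case False
          then have "R < norm (x - y)" using x norm_triangle_ineq4[of x "x - y"] by simp
          then show ?thesis using C(1) C(3)[of "x - y"] by simp
        qed
      qed
      finally show ?thesis .
    qed
    then show "\<exists>C. \<forall>x. norm x \<le> S \<longrightarrow> \<bar>moll \<phi> h x\<bar> \<le> C" by blast
  qed measurable
qed

lemma moll_support:
  assumes "\<And>x. R < norm x \<Longrightarrow> \<phi> x = 0" "\<And>x. S < norm x \<Longrightarrow> h x = 0" "R + S < norm x"
  shows "moll \<phi> h x = 0"
proof -
  have "\<phi> (x - y) * h y = 0" for y
  proof (cases "S < norm y")
    case False
    then have "R < norm (x - y)" using assms(3) norm_triangle_ineq[of "x - y" y] by simp
    then show ?thesis using assms(1) by simp
  qed (use assms(2) in simp)
  then have "(\<lambda>y. \<phi> (x - y) * h y) = (\<lambda>y. 0)" by blast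
  then show ?thesis unfolding moll_def by simp
qed

lemma smooth_Lipschitz:
  assumes "\<phi> \<in> test_functions UNIV"
  obtains L where "L \<ge> 0" "\<And>x y. \<bar>\<phi> x - \<phi> y\<bar> \<le> L * norm (x - y)"
    "\<And>x v. \<bar>\<Sum>b\<in>Basis. (v \<bullet> b) * partial_deriv b \<phi> x\<bar> \<le> L * norm v"
proof -
  have s: "smooth \<phi>" using assms unfolding test_functions_UNIV by blast
  have "\<exists>C. \<forall>x. \<bar>partial_deriv b \<phi> x\<bar> \<le> C" if "b \<in> Basis" for b
    using test_function_bounded_support[OF test_function_partial[OF assms that]]
    by (auto elim!: bounded_supportE)
  then obtain C where C: "\<And>b x. b \<in> Basis \<Longrightarrow> \<bar>partial_deriv b \<phi> x\<bar> \<le> C b" by metis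
  define L where "L = (\<Sum>b\<in>Basis. C b)"
  have C0: "0 \<le> C b" if "b \<in> Basis" for b using C[OF that, of 0] by linarith
  have L: "\<bar>\<Sum>b\<in>Basis. (v \<bullet> b) * partial_deriv b \<phi> x\<bar> \<le> L * norm v" for v x
  proof -
    have "\<bar>\<Sum>b\<in>Basis. (v \<bullet> b) * partial_deriv b \<phi> x\<bar> \<le> (\<Sum>b\<in>Basis. \<bar>v \<bullet> b\<bar> * \<bar>partial_deriv b \<phi> x\<bar>)"
      by (rule order_trans[OF sum_abs]) (simp add: abs_mult)
    also have "\<dots> \<le> (\<Sum>b\<in>Basis. norm v * C b)"
      by (intro sum_mono mult_mono C Basis_le_norm C0) auto
    finally show ?thesis by (simp add: L_def sum_distrib_left mult.commute)
  qed
  have "norm (\<phi> x - \<phi> y) \<le> L * norm (x - y)" for x y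
  proof (rule differentiable_bound[of UNIV \<phi> "\<lambda>x v. \<Sum>b\<in>Basis. (v \<bullet> b) * partial_deriv b \<phi> x"])
    show "onorm (\<lambda>v. \<Sum>b\<in>Basis. (v \<bullet> b) * partial_deriv b \<phi> x) \<le> L" for x
      by (rule onorm_le) (use L in simp)
  qed (use smooth_has_derivative[OF s] in auto)
  then show ?thesis using L C0 by (intro that[of L]) (auto simp: L_def intro: sum_nonneg)
qed

text \<open>A test function is Lipschitz, so its difference quotients are bounded by a constant on a fixed ball;
  dominated convergence then differentiates under the integral.\<close>

lemma moll_has_derivative:
  assumes \<phi>: "\<phi> \<in> test_functions UNIV" and h: "loc_integrable h"
  shows "(moll \<phi> h has_derivative (\<lambda>v. \<Sum>b\<in>Basis. (v \<bullet> b) * moll (partial_deriv b \<phi>) h x)) (at x)"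
  unfolding has_derivative_at
proof
  have s: "smooth \<phi>" using \<phi> unfolding test_functions_UNIV by blast
  note b\<phi> = test_function_bounded_support[OF \<phi>]
  note bd = test_function_bounded_support[OF test_function_partial[OF \<phi>]]
  note [measurable] = loc_integrable_borel[OF h]
  have [measurable]: "\<phi> \<in> borel_measurable borel" using s by (rule smooth_borel)
  have [measurable]: "partial_deriv b \<phi> \<in> borel_measurable borel" if "b \<in> Basis" for b
    by (rule bounded_support_borel[OF bd[OF that]])
  let ?D = "\<lambda>z v. \<Sum>b\<in>Basis. (v \<bullet> b) * partial_deriv b \<phi> z"
  let ?M = "\<lambda>v. \<Sum>b\<in>Basis. (v \<bullet> b) * moll (partial_deriv b \<phi>) h x"
  show "bounded_linear ?M"
    by (intro bounded_linear_sum bounded_linear_mult_const bounded_linear_inner_left_comp bounded_linear_ident)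
  obtain L where L: "L \<ge> 0" "\<And>x y. \<bar>\<phi> x - \<phi> y\<bar> \<le> L * norm (x - y)" "\<And>x v. \<bar>?D x v\<bar> \<le> L * norm v"
    using smooth_Lipschitz[OF \<phi>] by blast
  obtain C R where R: "\<And>x. R < norm x \<Longrightarrow> \<phi> x = 0" using b\<phi> by (rule bounded_supportE) blast
  have dR: "?D z v = 0" if "norm z > R" for z v
  proof -
    have "(\<phi> has_derivative (\<lambda>h. 0)) (at z)"
    proof (rule has_derivative_transform_within_open[of "\<lambda>x. 0" "\<lambda>h. 0" z UNIV "- cball 0 R"])
      show "\<And>y. y \<in> - cball 0 R \<Longrightarrow> 0 = \<phi> y" using R by force
    qed (use that in auto)
    from partial_deriv_eq[OF this] show ?thesis by simp
  qed
  have Mint: "integrable lborel (\<lambda>y. ?D (x - y) v * h y)" and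
    Meq: "?M v = (LINT y|lborel. ?D (x - y) v * h y)" for v
  proof -
    have i: "integrable lborel (\<lambda>y. (v \<bullet> b) * (partial_deriv b \<phi> (x - y) * h y))" if "b \<in> Basis" for b
      by (intro integrable_mult_right moll_integrable bd that h)
    show "integrable lborel (\<lambda>y. ?D (x - y) v * h y)"
      using Bochner_Integration.integrable_sum[of Basis, OF i] by (simp add: sum_distrib_right mult.assoc)
    show "?M v = (LINT y|lborel. ?D (x - y) v * h y)"
      unfolding moll_def
      by (simp add: sum_distrib_right mult.assoc Bochner_Integration.integral_sum[OF i])
  qed
  show "((\<lambda>v. norm (moll \<phi> h (x + v) - moll \<phi> h x - ?M v) / norm v) \<longlongrightarrow> 0) (at 0)"
    unfolding tendsto_at_iff_sequentially
  proof (intro allI impI)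
    fix X :: "nat \<Rightarrow> 'a" assume X0: "\<forall>i. X i \<in> UNIV - {0}" and X: "X \<longlonglongrightarrow> 0"
    obtain B where B: "\<And>i. norm (X i) \<le> B"
      using convergent_imp_Bseq[of X] X unfolding convergent_def Bseq_def by blast
    let ?s = "\<lambda>i y. (\<phi> (x + X i - y) - \<phi> (x - y) - ?D (x - y) (X i)) / norm (X i) * h y"
    have lim: "(\<lambda>i. LINT y|lborel. ?s i y) \<longlonglongrightarrow> (LINT y|lborel. 0 * h y)"
    proof (rule integral_dominated_convergence)
      show "integrable lborel (\<lambda>y. 2 * L * \<bar>indicator (cball 0 (R + norm x + B)) y * h y\<bar>)"
        using h unfolding loc_integrable_def by auto
      show "AE y in lborel. (\<lambda>i. ?s i y) \<longlonglongrightarrow> 0 * h y"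
      proof (intro AE_I2 tendsto_mult_right)
        fix y
        have "((\<lambda>v. norm (\<phi> ((x - y) + v) - \<phi> (x - y) - ?D (x - y) v) / norm v) \<longlongrightarrow> 0) (at 0)"
          using smooth_has_derivative[OF s, of "x - y"] unfolding has_derivative_at by blast
        then have "(\<lambda>i. norm (\<phi> ((x - y) + X i) - \<phi> (x - y) - ?D (x - y) (X i)) / norm (X i)) \<longlonglongrightarrow> 0"
          using X X0 unfolding tendsto_at_iff_sequentially o_def by blast
        then have "(\<lambda>i. norm ((\<phi> (x + X i - y) - \<phi> (x - y) - ?D (x - y) (X i)) / norm (X i))) \<longlonglongrightarrow> 0"
          by (simp add: add_diff_eq diff_add_eq)
        then show "(\<lambda>i. (\<phi> (x + X i - y) - \<phi> (x - y) - ?D (x - y) (X i)) / norm (X i)) \<longlonglongrightarrow> 0"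
          by (rule tendsto_norm_zero_cancel)
      qed
      show "AE y in lborel. norm (?s i y) \<le> 2 * L * \<bar>indicator (cball 0 (R + norm x + B)) y * h y\<bar>" for i
      proof (intro AE_I2)
        fix y
        have nz: "norm (X i) > 0" using X0 by auto
        let ?n = "\<phi> (x + X i - y) - \<phi> (x - y) - ?D (x - y) (X i)"
        show "norm (?s i y) \<le> 2 * L * \<bar>indicator (cball 0 (R + norm x + B)) y * h y\<bar>"
        proof (cases "norm y \<le> R + norm x + B")
          case True
          have "\<bar>?n\<bar> \<le> L * norm (X i) + L * norm (X i)"
            using L(2)[of "x + X i - y" "x - y"] L(3)[of "X i" "x - y"] by simp
          then have "\<bar>?n / norm (X i)\<bar> \<le> 2 * L" using nz by (simp add: field_simps)
          then have "\<bar>?n / norm (X i)\<bar> * \<bar>h y\<bar> \<le> 2 * L * \<bar>h y\<bar>" by (rule mult_right_mono) simp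
          then show ?thesis using True by (simp only: real_norm_def abs_mult) (simp add: indicator_def)
        next
          case False
          have "B \<ge> 0" using B[of 0] norm_ge_zero order_trans by blast
          then have "R < norm (x - y)" using False norm_triangle_ineq4[of x "x - y"] by simp
          moreover have "R < norm (x + X i - y)"
            using False norm_triangle_ineq4[of "x + X i" "x + X i - y"] norm_triangle_ineq[of x "X i"] B[of i] by simp
          ultimately have "?n = 0" using R dR by simp
          then show ?thesis using L(1) by simp
        qed
      qed
    qed measurable
    have eq: "(LINT y|lborel. ?s i y) = (moll \<phi> h (x + X i) - moll \<phi> h x - ?M (X i)) / norm (X i)" for i
    proof -
      have e: "?s i = (\<lambda>y. (\<phi> (x + X i - y) * h y - \<phi> (x - y) * h y - ?D (x - y) (X i) * h y) / norm (X i))"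
        by (rule ext) (simp only: left_diff_distrib times_divide_eq_left)
      have i: "integrable lborel (\<lambda>y. \<phi> (x + X i - y) * h y - \<phi> (x - y) * h y)"
        by (intro Bochner_Integration.integrable_diff moll_integrable[OF b\<phi> h])
      show ?thesis
        unfolding e Meq integral_divide_zero Bochner_Integration.integral_diff[OF i Mint]
          Bochner_Integration.integral_diff[OF moll_integrable[OF b\<phi> h] moll_integrable[OF b\<phi> h]]
        by (simp only: moll_def)
    qed
    have "(\<lambda>i. (moll \<phi> h (x + X i) - moll \<phi> h x - ?M (X i)) / norm (X i)) \<longlonglongrightarrow> 0"
      using lim unfolding eq by simp
    then have "(\<lambda>i. norm ((moll \<phi> h (x + X i) - moll \<phi> h x - ?M (X i)) / norm (X i))) \<longlonglongrightarrow> 0"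
      by (rule tendsto_norm_zero)
    then show "((\<lambda>v. norm (moll \<phi> h (x + v) - moll \<phi> h x - ?M v) / norm v) \<circ> X) \<longlonglongrightarrow> 0"
      by (simp add: o_def)
  qed
qed

lemma partial_deriv_moll:
  assumes "\<phi> \<in> test_functions UNIV" "loc_integrable h" "b \<in> Basis"
  shows "partial_deriv b (moll \<phi> h) = moll (partial_deriv b \<phi>) h"
proof
  fix x
  have "partial_deriv b (moll \<phi> h) x = (\<Sum>d\<in>Basis. (b \<bullet> d) * moll (partial_deriv d \<phi>) h x)"
    by (rule partial_deriv_eq[OF moll_has_derivative[OF assms(1,2)]])
  also have "\<dots> = (\<Sum>d\<in>Basis. if d = b then moll (partial_deriv d \<phi>) h x else 0)"
    by (intro sum.cong refl) (use assms(3) in \<open>auto simp: inner_Basis\<close>)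
  finally show "partial_deriv b (moll \<phi> h) x = moll (partial_deriv b \<phi>) h x"
    using assms(3) by simp
qed

lemma smooth_moll:
  assumes "\<phi> \<in> test_functions UNIV" "loc_integrable h"
  shows "smooth (moll \<phi> h)"
proof -
  have step: "\<exists>\<psi>\<in>test_functions UNIV. iter_partial_deriv bs (moll \<phi> h) = moll \<psi> h"
    if "set bs \<subseteq> Basis" for bs
    using that
  proof (induction bs)
    case (Cons b bs)
    then obtain \<psi> where "\<psi> \<in> test_functions UNIV" "iter_partial_deriv bs (moll \<phi> h) = moll \<psi> h" by auto
    then show ?case using Cons.prems assms(2)
      by (intro bexI[of _ "partial_deriv b \<psi>"]) (auto simp: partial_deriv_moll test_function_partial)
  qed (use assms in auto)
  show ?thesis
    unfolding smooth_def
  proof (intro allI impI)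
    fix bs :: "'a list" and x assume "set bs \<subseteq> Basis"
    with step obtain \<psi> where \<psi>: "\<psi> \<in> test_functions UNIV" "iter_partial_deriv bs (moll \<phi> h) = moll \<psi> h"
      by blast
    show "iter_partial_deriv bs (moll \<phi> h) differentiable at x"
      unfolding \<psi>(2) by (rule differentiableI, rule moll_has_derivative[OF \<psi>(1) assms(2)])
  qed
qed

lemma test_function_moll:
  assumes "\<phi> \<in> test_functions UNIV" "bounded_support h"
  shows "moll \<phi> h \<in> test_functions UNIV"
proof -
  have h: "loc_integrable h"
    using assms(2) loc_integrable_locally_bounded bounded_support_locally_bounded by blast
  obtain R where "\<And>x. R < norm x \<Longrightarrow> \<phi> x = 0"
    using test_function_bounded_support[OF assms(1)] by (rule bounded_supportE) blast
  moreover obtain S where "\<And>x. S < norm x \<Longrightarrow> h x = 0" using assms(2) by (rule bounded_supportE) blast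
  ultimately have "norm x \<le> R + S" if "moll \<phi> h x \<noteq> 0" for x
    using moll_support[of R \<phi> S h x] that by fastforce
  then show ?thesis
    unfolding test_functions_UNIV using smooth_moll[OF assms(1) h] by blast
qed

lemma test_function_reflect:
  fixes x :: "'a::euclidean_space"
  assumes "\<phi> \<in> test_functions UNIV"
  shows "(\<lambda>y. \<phi> (x - y)) \<in> test_functions UNIV"
    and "b \<in> Basis \<Longrightarrow> partial_deriv b (\<lambda>y. \<phi> (x - y)) = (\<lambda>y. - partial_deriv b \<phi> (x - y))"
proof -
  have s: "smooth \<phi>" using assms unfolding test_functions_UNIV by blast
  have d: "((\<lambda>y. \<psi> (x - y)) has_derivative (\<lambda>h. \<Sum>d\<in>Basis. ((- h) \<bullet> d) * partial_deriv d \<psi> (x - y))) (at y)"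
    if "smooth \<psi>" for \<psi> y
  proof -
    have "((\<lambda>y. x - y) has_derivative (\<lambda>h. - h)) (at y)" by (auto intro!: derivative_eq_intros)
    from has_derivative_compose[OF this smooth_has_derivative[OF that]] show ?thesis .
  qed
  have p: "partial_deriv b (\<lambda>y. \<psi> (x - y)) = (\<lambda>y. - partial_deriv b \<psi> (x - y))"
    if "b \<in> Basis" "smooth \<psi>" for b \<psi>
  proof
    fix y
    have "partial_deriv b (\<lambda>y. \<psi> (x - y)) y = (\<Sum>d\<in>Basis. ((- b) \<bullet> d) * partial_deriv d \<psi> (x - y))"
      by (rule partial_deriv_eq[OF d[OF that(2)]])
    also have "\<dots> = (\<Sum>d\<in>Basis. if d = b then - partial_deriv d \<psi> (x - y) else 0)"
      by (intro sum.cong refl) (use that in \<open>auto simp: inner_Basis\<close>)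
    finally show "partial_deriv b (\<lambda>y. \<psi> (x - y)) y = - partial_deriv b \<psi> (x - y)"
      using that(1) by simp
  qed
  show "b \<in> Basis \<Longrightarrow> partial_deriv b (\<lambda>y. \<phi> (x - y)) = (\<lambda>y. - partial_deriv b \<phi> (x - y))"
    using p s by blast
  define G where "G = {\<lambda>y. \<psi> (x - y) | \<psi>. smooth \<psi>}"
  have "smooth (\<lambda>y. \<phi> (x - y))"
  proof (rule smooth_generated_algebra[of G])
    show "g differentiable at y" if "g \<in> G" for g y
      using that d unfolding G_def differentiable_def by blast
    show "partial_deriv b g \<in> generated_algebra G" if "g \<in> G" "b \<in> Basis" for b g
    proof -
      from that obtain \<psi> where \<psi>: "g = (\<lambda>y. \<psi> (x - y))" "smooth \<psi>" unfolding G_def by blast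
      have "(\<lambda>y. (-1) * partial_deriv b \<psi> (x - y)) \<in> generated_algebra G"
        using smooth_partial[OF \<psi>(2) that(2)]
        by (intro generated_algebra.mult generated_algebra.const generated_algebra.generator)
          (auto simp: G_def)
      then show ?thesis using p[OF that(2) \<psi>(2)] \<psi>(1) by simp
    qed
    show "(\<lambda>y. \<phi> (x - y)) \<in> generated_algebra G"
      using s by (intro generated_algebra.generator) (auto simp: G_def)
  qed
  moreover obtain R where "\<And>y. R < norm y \<Longrightarrow> \<phi> (x - y) = 0"
    using bounded_support_reflect[OF test_function_bounded_support[OF assms], of x]
    by (rule bounded_supportE) blast
  ultimately show "(\<lambda>y. \<phi> (x - y)) \<in> test_functions UNIV"
    unfolding test_functions_UNIV by (metis not_le)
qed

definition weak_partial :: "'a::euclidean_space \<Rightarrow> ('a \<Rightarrow> real) \<Rightarrow> ('a \<Rightarrow> real) \<Rightarrow> bool" where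
  "weak_partial b u A \<longleftrightarrow> loc_integrable u \<and> loc_integrable A \<and>
     (\<forall>\<phi>\<in>test_functions UNIV. (LINT x|lborel. u x * partial_deriv b \<phi> x) = - (LINT x|lborel. A x * \<phi> x))"

text \<open>For fixed \<open>x\<close> the function \<open>\<lambda>y. \<phi> (x - y)\<close> is a test function, to which the definition of the weak
  derivative applies; the reflection supplies the sign.\<close>

lemma moll_weak_partial:
  assumes "weak_partial b u A" "\<phi> \<in> test_functions UNIV" "b \<in> Basis"
  shows "moll (partial_deriv b \<phi>) u = moll \<phi> A"
proof
  fix x
  have "(LINT y|lborel. u y * partial_deriv b (\<lambda>y. \<phi> (x - y)) y) = - (LINT y|lborel. A y * \<phi> (x - y))"
    using assms(1) test_function_reflect(1)[OF assms(2)] unfolding weak_partial_def by blast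
  then show "moll (partial_deriv b \<phi>) u x = moll \<phi> A x"
    by (simp add: test_function_reflect(2)[OF assms(2,3)] moll_def mult.commute)
qed

lemma moll_adjoint:
  assumes \<phi>: "bounded_support \<phi>" and even: "\<And>x. \<phi> (- x) = \<phi> x"
    and A: "loc_integrable A" and W: "bounded_support W"
  shows "(LINT x|lborel. A x * moll \<phi> W x) = (LINT x|lborel. moll \<phi> A x * W x)"
    and "integrable lborel (\<lambda>x. A x * moll \<phi> W x)"
proof -
  note [measurable] = bounded_support_borel[OF \<phi>] loc_integrable_borel[OF A] bounded_support_borel[OF W]
  have absA: "loc_integrable (\<lambda>x. \<bar>A x\<bar>)"
    unfolding loc_integrable_def
  proof (intro conjI allI)
    fix R
    have "integrable lborel (\<lambda>x. \<bar>indicator (cball 0 R) x * A x\<bar>)"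
      using A unfolding loc_integrable_def by (intro integrable_abs) blast
    then show "integrable lborel (\<lambda>x. indicator (cball 0 R) x * \<bar>A x\<bar>)" by (simp add: abs_mult)
  qed measurable
  have abs\<phi>: "bounded_support (\<lambda>x. \<bar>\<phi> x\<bar>)" and absW: "bounded_support (\<lambda>x. \<bar>W x\<bar>)"
    using \<phi> W unfolding bounded_support_def by auto
  have swap: "(\<lambda>x. A x * (\<phi> (x - y) * W y)) = (\<lambda>x. W y * (\<phi> (y - x) * A x))" for y
  proof
    fix x
    have "\<phi> (x - y) = \<phi> (y - x)" using even[of "x - y"] by simp
    then show "A x * (\<phi> (x - y) * W y) = W y * (\<phi> (y - x) * A x)" by simp
  qed
  have int: "integrable (lborel \<Otimes>\<^sub>M lborel) (\<lambda>(y, x). A x * (\<phi> (x - y) * W y))"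
  proof (rule lborel_pair.Fubini_integrable)
    have "integrable lborel (\<lambda>y. \<bar>W y\<bar> * moll (\<lambda>x. \<bar>\<phi> x\<bar>) (\<lambda>x. \<bar>A x\<bar>) y)"
      by (intro bounded_support_integrable bounded_support_mult absW moll_locally_bounded abs\<phi> absA)
    also have "(\<lambda>y. \<bar>W y\<bar> * moll (\<lambda>x. \<bar>\<phi> x\<bar>) (\<lambda>x. \<bar>A x\<bar>) y)
        = (\<lambda>y. LINT x|lborel. norm (case (y, x) of (y, x) \<Rightarrow> A x * (\<phi> (x - y) * W y)))"
    proof
      fix y
      have "(\<lambda>x. norm (A x * (\<phi> (x - y) * W y))) = (\<lambda>x. \<bar>W y\<bar> * (\<bar>\<phi> (y - x)\<bar> * \<bar>A x\<bar>))"
        using arg_cong[OF swap[of y], of "\<lambda>f x. norm (f x)"] by (simp add: abs_mult)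
      then show "\<bar>W y\<bar> * moll (\<lambda>x. \<bar>\<phi> x\<bar>) (\<lambda>x. \<bar>A x\<bar>) y
          = (LINT x|lborel. norm (case (y, x) of (y, x) \<Rightarrow> A x * (\<phi> (x - y) * W y)))"
        by (simp add: moll_def)
    qed
    finally show "integrable lborel (\<lambda>y. LINT x|lborel. norm (case (y, x) of (y, x) \<Rightarrow> A x * (\<phi> (x - y) * W y)))" .
    show "AE y in lborel. integrable lborel (\<lambda>x. case (y, x) of (y, x) \<Rightarrow> A x * (\<phi> (x - y) * W y))"
    proof (rule AE_I2)
      fix y
      have "(\<lambda>x. case (y, x) of (y, x) \<Rightarrow> A x * (\<phi> (x - y) * W y)) = (\<lambda>x. W y * (\<phi> (y - x) * A x))"
        using swap[of y] by simp
      then show "integrable lborel (\<lambda>x. case (y, x) of (y, x) \<Rightarrow> A x * (\<phi> (x - y) * W y))"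
        using moll_integrable[OF \<phi> A, of y] by simp
    qed
  qed measurable
  have "integrable lborel (\<lambda>x. LINT y|lborel. A x * (\<phi> (x - y) * W y))"
    by (rule lborel_pair.integrable_snd[OF int])
  then show "integrable lborel (\<lambda>x. A x * moll \<phi> W x)" by (simp add: moll_def)
  have "(LINT x|lborel. A x * moll \<phi> W x) = (LINT x|lborel. LINT y|lborel. A x * (\<phi> (x - y) * W y))"
    by (simp add: moll_def)
  also have "\<dots> = (LINT y|lborel. LINT x|lborel. A x * (\<phi> (x - y) * W y))"
    by (rule lborel_pair.Fubini_integral[OF int])
  also have "\<dots> = (LINT y|lborel. moll \<phi> A y * W y)"
    by (rule Bochner_Integration.integral_cong[OF refl], subst swap) (simp add: moll_def)
  finally show "(LINT x|lborel. A x * moll \<phi> W x) = (LINT x|lborel. moll \<phi> A x * W x)" .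
qed

section \<open>Mollification in Lebesgue spaces\<close>

definition pow_integrable :: "real \<Rightarrow> ('a::euclidean_space \<Rightarrow> real) \<Rightarrow> bool" where
  "pow_integrable s f \<longleftrightarrow> f \<in> borel_measurable borel \<and> integrable lborel (\<lambda>x. \<bar>f x\<bar> powr s)"

lemma pow_integrable_borel [measurable_dest]: "pow_integrable s f \<Longrightarrow> f \<in> borel_measurable borel"
  unfolding pow_integrable_def by blast

lemma pow_integrableD: "pow_integrable s f \<Longrightarrow> integrable lborel (\<lambda>x. \<bar>f x\<bar> powr s)"
  unfolding pow_integrable_def by blast

lemma pow_integrable_bound:
  assumes "integrable lborel G" "f \<in> borel_measurable borel" "AE x in lborel. \<bar>f x\<bar> powr s \<le> G x"
  shows "pow_integrable s f"
  unfolding pow_integrable_def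
proof
  note [measurable] = assms(2)
  show "integrable lborel (\<lambda>x. \<bar>f x\<bar> powr s)"
    by (rule Bochner_Integration.integrable_bound[OF assms(1)]) (use assms(3) in \<open>measurable, auto\<close>)
qed (fact assms(2))

lemma powr_add_le:
  fixes a b s :: real
  assumes "a \<ge> 0" "b \<ge> 0" "s \<ge> 0"
  shows "(a + b) powr s \<le> 2 powr s * (a powr s + b powr s)"
proof -
  have "(a + b) powr s \<le> (2 * max a b) powr s"
    using assms by (intro powr_mono2) auto
  also have "\<dots> = 2 powr s * (max a b) powr s" using assms by (simp add: powr_mult)
  also have "\<dots> \<le> 2 powr s * (a powr s + b powr s)"
    by (intro mult_left_mono) (auto simp: max_def)
  finally show ?thesis .
qed

lemma abs_powr_add_le:
  fixes a b s :: real
  assumes "s \<ge> 0"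
  shows "\<bar>a + b\<bar> powr s \<le> 2 powr s * (\<bar>a\<bar> powr s + \<bar>b\<bar> powr s)"
proof -
  have "\<bar>a + b\<bar> powr s \<le> (\<bar>a\<bar> + \<bar>b\<bar>) powr s" using assms by (intro powr_mono2) auto
  with powr_add_le[of "\<bar>a\<bar>" "\<bar>b\<bar>" s] assms show ?thesis by linarith
qed

lemma pow_integrable_add:
  assumes "pow_integrable s f" "pow_integrable s g" "s \<ge> 0"
  shows "pow_integrable s (\<lambda>x. f x + g x)"
proof (rule pow_integrable_bound)
  show "integrable lborel (\<lambda>x. 2 powr s * (\<bar>f x\<bar> powr s + \<bar>g x\<bar> powr s))"
    using assms by (intro integrable_mult_right Bochner_Integration.integrable_add pow_integrableD)
  show "AE x in lborel. \<bar>f x + g x\<bar> powr s \<le> 2 powr s * (\<bar>f x\<bar> powr s + \<bar>g x\<bar> powr s)"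
    using abs_powr_add_le[OF assms(3)] by auto
qed (use pow_integrable_borel[OF assms(1)] pow_integrable_borel[OF assms(2)] in measurable)

lemma pow_integrable_bounded_mult:
  assumes "pow_integrable s f" "k \<in> borel_measurable borel" "\<And>x. \<bar>k x\<bar> \<le> C" "s \<ge> 0"
  shows "pow_integrable s (\<lambda>x. k x * f x)"
proof (rule pow_integrable_bound)
  show "integrable lborel (\<lambda>x. C powr s * \<bar>f x\<bar> powr s)"
    using assms by (intro integrable_mult_right pow_integrableD)
  show "AE x in lborel. \<bar>k x * f x\<bar> powr s \<le> C powr s * \<bar>f x\<bar> powr s"
  proof (rule AE_I2)
    fix x
    have "C \<ge> 0" using assms(3)[of x] by linarith
    have "\<bar>k x * f x\<bar> powr s = \<bar>k x\<bar> powr s * \<bar>f x\<bar> powr s" by (simp add: abs_mult powr_mult)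
    also have "\<dots> \<le> C powr s * \<bar>f x\<bar> powr s"
      using assms(3)[of x] assms(4) by (intro mult_right_mono powr_mono2) auto
    finally show "\<bar>k x * f x\<bar> powr s \<le> C powr s * \<bar>f x\<bar> powr s" .
  qed
qed (use pow_integrable_borel[OF assms(1)] assms(2) in measurable)

lemma pow_integrable_diff:
  assumes "pow_integrable s f" "pow_integrable s g" "s \<ge> 0"
  shows "pow_integrable s (\<lambda>x. f x - g x)"
  using pow_integrable_add[OF assms(1) pow_integrable_bounded_mult[OF assms(2), of "\<lambda>x. -1" 1] assms(3)]
    assms(3) by simp

lemma pow_integrable_zero: "pow_integrable s (\<lambda>x. 0)"
  unfolding pow_integrable_def by simp

lemma pow_integrable_sum:
  "(\<And>i. i \<in> I \<Longrightarrow> pow_integrable s (f i)) \<Longrightarrow> s \<ge> 0 \<Longrightarrow> pow_integrable s (\<lambda>x. \<Sum>i\<in>I. f i x)"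
  by (induction I rule: infinite_finite_induct)
    (auto simp: pow_integrable_zero intro!: pow_integrable_add)

lemma abs_le_one_add_powr:
  fixes a s :: real assumes "s \<ge> 1" shows "\<bar>a\<bar> \<le> 1 + \<bar>a\<bar> powr s"
proof (cases "\<bar>a\<bar> \<le> 1")
  case True
  then show ?thesis using powr_ge_zero[of "\<bar>a\<bar>" s] by linarith
next
  case False
  then have "\<bar>a\<bar> powr 1 \<le> \<bar>a\<bar> powr s" using assms by (intro powr_mono) auto
  then show ?thesis using False by simp
qed

lemma pow_integrable_loc_integrable:
  fixes f :: "'a::euclidean_space \<Rightarrow> real"
  assumes "pow_integrable s f" "s \<ge> 1"
  shows "loc_integrable f"
  unfolding loc_integrable_def
proof (intro conjI allI)
  fix R
  have [measurable]: "f \<in> borel_measurable borel" by (rule pow_integrable_borel[OF assms(1)])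
  have m: "(\<lambda>x. indicator (cball 0 R) x * f x) \<in> borel_measurable borel"
    by (rule borel_measurable_times[OF borel_measurable_indicator]) (simp_all add: pow_integrable_borel[OF assms(1)])
  have "integrable lborel (\<lambda>x::'a. indicator (cball 0 R) x + \<bar>f x\<bar> powr s :: real)"
    using emeasure_bounded_finite[of "cball (0::'a) R"] pow_integrableD[OF assms(1)]
    by (intro Bochner_Integration.integrable_add integrable_real_indicator) auto
  then show "integrable lborel (\<lambda>x. indicator (cball 0 R) x * f x)"
  proof (rule Bochner_Integration.integrable_bound)
    show "AE x in lborel. norm (indicator (cball 0 R) x * f x) \<le> norm (indicator (cball 0 R) x + \<bar>f x\<bar> powr s)"
      using abs_le_one_add_powr[OF assms(2)] by (auto simp: indicator_def)
  qed (use m in simp)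
qed (use pow_integrable_borel[OF assms(1)] in simp)

subsection \<open>Continuity of translations\<close>

definition translation_continuous :: "('a::euclidean_space \<Rightarrow> real) \<Rightarrow> bool" where
  "translation_continuous f \<longleftrightarrow> (\<forall>X. X \<longlonglongrightarrow> 0 \<longrightarrow> (\<lambda>i. LINT x|lborel. \<bar>f (x - X i) - f x\<bar>) \<longlonglongrightarrow> 0)"

text \<open>The two indicators have the same integral, so the integral of their distance is twice that of the
  positive part of the difference, which is bounded by the indicator of \<open>U\<close> and tends to 0 pointwise
  because \<open>U\<close> is open.\<close>

lemma translation_continuous_open:
  fixes U :: "'a::euclidean_space set"
  assumes "open U" "emeasure lborel U < \<infinity>"
  shows "translation_continuous (indicator U)"
  unfolding translation_continuous_def
proof (intro allI impI)
  fix X :: "nat \<Rightarrow> 'a" assume X: "X \<longlonglongrightarrow> 0"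
  have [measurable]: "U \<in> sets borel" using assms(1) by simp
  let ?f = "indicator U :: 'a \<Rightarrow> real"
  have f: "integrable lborel ?f" using assms by (intro integrable_real_indicator) auto
  have fX: "integrable lborel (\<lambda>x. ?f (x - X i))" for i by (rule integrable_translate[OF f])
  have "(\<lambda>i. LINT x|lborel. max 0 (?f x - ?f (x - X i))) \<longlonglongrightarrow> (LINT x::'a|lborel. (0::real))"
  proof (rule integral_dominated_convergence)
    show "integrable lborel ?f" by (rule f)
    show "AE x in lborel. (\<lambda>i. max 0 (?f x - ?f (x - X i))) \<longlonglongrightarrow> 0"
    proof (rule AE_I2)
      fix x
      show "(\<lambda>i. max 0 (?f x - ?f (x - X i))) \<longlonglongrightarrow> 0"
      proof (cases "x \<in> U")
        case True
        have "(\<lambda>i. x - X i) \<longlonglongrightarrow> x" using tendsto_diff[OF tendsto_const X, of x] by simp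
        then have "eventually (\<lambda>i. x - X i \<in> U) sequentially"
          using assms(1) True by (rule topological_tendstoD)
        then have "eventually (\<lambda>i. 0 = max 0 (?f x - ?f (x - X i))) sequentially"
          by eventually_elim (use True in simp)
        then show ?thesis by (rule Lim_transform_eventually[OF tendsto_const])
      qed (simp add: indicator_def)
    qed
  qed (auto simp: indicator_def)
  moreover have "(LINT x|lborel. \<bar>?f (x - X i) - ?f x\<bar>) = 2 * (LINT x|lborel. max 0 (?f x - ?f (x - X i)))" for i
  proof -
    have m: "integrable lborel (\<lambda>x. max 0 (?f x - ?f (x - X i)))"
      by (intro integrable_max Bochner_Integration.integrable_diff f fX) simp
    have "(LINT x|lborel. \<bar>?f (x - X i) - ?f x\<bar>)
        = (LINT x|lborel. 2 * max 0 (?f x - ?f (x - X i)) + (?f (x - X i) - ?f x))"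
      by (rule Bochner_Integration.integral_cong) (auto simp: indicator_def)
    also have "\<dots> = 2 * (LINT x|lborel. max 0 (?f x - ?f (x - X i)))
        + ((LINT x|lborel. ?f (x - X i)) - (LINT x|lborel. ?f x))"
      using m f fX[of i] by simp
    also have "(LINT x|lborel. ?f (x - X i)) = (LINT x|lborel. ?f x)"
      by (rule integral_translate) measurable
    finally show ?thesis by simp
  qed
  ultimately show "(\<lambda>i. LINT x|lborel. \<bar>?f (x - X i) - ?f x\<bar>) \<longlonglongrightarrow> 0"
    by (simp add: tendsto_mult_right_zero)
qed

lemma translation_continuous_approx:
  fixes f :: "'a::euclidean_space \<Rightarrow> real"
  assumes f: "integrable lborel f"
    and approx: "\<And>\<epsilon>. \<epsilon> > 0 \<Longrightarrow> \<exists>g. integrable lborel g \<and> translation_continuous g \<and>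
      (LINT x|lborel. \<bar>f x - g x\<bar>) \<le> \<epsilon>"
  shows "translation_continuous f"
  unfolding translation_continuous_def
proof (intro allI impI LIMSEQ_I)
  fix X :: "nat \<Rightarrow> 'a" and r :: real assume X: "X \<longlonglongrightarrow> 0" and r: "r > 0"
  obtain g where g: "integrable lborel g" "translation_continuous g" "(LINT x|lborel. \<bar>f x - g x\<bar>) \<le> r / 4"
    using approx[of "r / 4"] r by auto
  have [measurable]: "f \<in> borel_measurable borel" "g \<in> borel_measurable borel"
    using borel_measurable_integrable[OF f] borel_measurable_integrable[OF g(1)] by simp_all
  have fX: "integrable lborel (\<lambda>x. f (x - z))" "integrable lborel (\<lambda>x. g (x - z))" for z
    by (intro integrable_translate f g)+
  have "(\<lambda>i. LINT x|lborel. \<bar>g (x - X i) - g x\<bar>) \<longlonglongrightarrow> 0"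
    using g(2) X unfolding translation_continuous_def by blast
  then have "\<exists>n0. \<forall>n\<ge>n0. norm ((LINT x|lborel. \<bar>g (x - X n) - g x\<bar>) - 0) < r / 2"
    by (rule LIMSEQ_D) (use r in simp)
  then obtain n0 where n0: "\<And>n. n \<ge> n0 \<Longrightarrow> (LINT x|lborel. \<bar>g (x - X n) - g x\<bar>) < r / 2"
    by auto
  have "norm ((LINT x|lborel. \<bar>f (x - X n) - f x\<bar>) - 0) < r" if "n \<ge> n0" for n
  proof -
    have "(LINT x|lborel. \<bar>f (x - X n) - f x\<bar>) \<le>
      (LINT x|lborel. \<bar>f (x - X n) - g (x - X n)\<bar> + \<bar>g (x - X n) - g x\<bar> + \<bar>f x - g x\<bar>)"
      by (intro integral_mono Bochner_Integration.integrable_add integrable_abs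
          Bochner_Integration.integrable_diff fX f g) auto
    also have "\<dots> = (LINT x|lborel. \<bar>f (x - X n) - g (x - X n)\<bar>)
        + (LINT x|lborel. \<bar>g (x - X n) - g x\<bar>) + (LINT x|lborel. \<bar>f x - g x\<bar>)"
      by (simp add: Bochner_Integration.integral_add fX f g)
    also have "(LINT x|lborel. \<bar>f (x - X n) - g (x - X n)\<bar>) = (LINT x|lborel. \<bar>f x - g x\<bar>)"
      by (rule integral_translate[of "\<lambda>x. \<bar>f x - g x\<bar>"]) measurable
    finally have "(LINT x|lborel. \<bar>f (x - X n) - f x\<bar>) < r" using g(3) n0[OF that] by linarith
    then show ?thesis by simp
  qed
  then show "\<exists>no. \<forall>n\<ge>no. norm ((LINT x|lborel. \<bar>f (x - X n) - f x\<bar>) - 0) < r" by blast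
qed

text \<open>Outer regularity reduces indicators of Borel sets to open sets; simple functions and limits follow
  by approximation in \<open>L\<^sup>1\<close>.\<close>

lemma translation_continuous_integrable:
  fixes f :: "'a::euclidean_space \<Rightarrow> real"
  assumes "integrable lborel f"
  shows "translation_continuous f"
  using assms
proof (induction f)
  case (base A c)
  have A: "A \<in> sets borel" using base by simp
  have iA: "integrable lborel (indicator A :: 'a \<Rightarrow> real)" using base by (intro integrable_real_indicator) auto
  have "translation_continuous (indicator A :: 'a \<Rightarrow> real)"
  proof (rule translation_continuous_approx[OF iA])
    fix \<epsilon> :: real assume "\<epsilon> > 0"
    from outer_regular_lborel[OF A this] obtain U
      where U: "open U" "A \<subseteq> U" "emeasure lborel (U - A) < \<epsilon>" by blast
    have [measurable]: "A \<in> sets borel" "U \<in> sets borel" using A U by auto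
    have "emeasure lborel U = emeasure lborel A + emeasure lborel (U - A)"
      using U(2) A U(1) by (subst plus_emeasure) (auto simp: Un_absorb1)
    then have fin: "emeasure lborel U < \<infinity>"
      using base(2) U(3) by (auto simp: ennreal_add_eq_top less_top[symmetric])
    have iU: "integrable lborel (indicator U :: 'a \<Rightarrow> real)" using fin by (intro integrable_real_indicator) auto
    have "(LINT x|lborel. \<bar>indicator A x - indicator U x :: real\<bar>) = (LINT x|lborel. indicator (U - A) x)"
      by (rule Bochner_Integration.integral_cong) (use U(2) in \<open>auto simp: indicator_def\<close>)
    also have "\<dots> = measure lborel (U - A)" by simp
    also have "\<dots> \<le> \<epsilon>" using U(3) \<open>\<epsilon> > 0\<close> by (simp add: measure_def enn2real_leI less_imp_le)
    finally show "\<exists>g. integrable lborel g \<and> translation_continuous g \<and>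
        (LINT x|lborel. \<bar>indicator A x - g x\<bar>) \<le> \<epsilon>"
      using iU translation_continuous_open[OF U(1) fin] by blast
  qed
  then show ?case
    unfolding translation_continuous_def
  proof (intro allI impI)
    fix X :: "nat \<Rightarrow> 'a" assume "\<forall>X. X \<longlonglongrightarrow> 0 \<longrightarrow> (\<lambda>i. LINT x|lborel. \<bar>indicator A (x - X i) - indicator A x :: real\<bar>) \<longlonglongrightarrow> 0"
      and "X \<longlonglongrightarrow> 0"
    then have "(\<lambda>i. \<bar>c\<bar> * (LINT x|lborel. \<bar>indicator A (x - X i) - indicator A x\<bar>)) \<longlonglongrightarrow> 0"
      by (intro tendsto_mult_right_zero) blast
    then show "(\<lambda>i. LINT x|lborel. \<bar>indicat_real A (x - X i) *\<^sub>R c - indicat_real A x *\<^sub>R c\<bar>) \<longlonglongrightarrow> 0"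
      by (simp add: abs_mult mult.commute[of _ "\<bar>c\<bar>"] flip: left_diff_distrib)
  qed
next
  case (add f g)
  have [measurable]: "f \<in> borel_measurable borel" "g \<in> borel_measurable borel"
    using borel_measurable_integrable[OF add(1)] borel_measurable_integrable[OF add(2)] by simp_all
  have fX: "integrable lborel (\<lambda>x. f (x - z))" "integrable lborel (\<lambda>x. g (x - z))" for z
    by (intro integrable_translate add)+
  show ?case
    unfolding translation_continuous_def
  proof (intro allI impI)
    fix X :: "nat \<Rightarrow> 'a" assume X: "X \<longlonglongrightarrow> 0"
    have l: "(\<lambda>i. (LINT x|lborel. \<bar>f (x - X i) - f x\<bar>) + (LINT x|lborel. \<bar>g (x - X i) - g x\<bar>)) \<longlonglongrightarrow> 0"
      using add X unfolding translation_continuous_def by (intro tendsto_add_zero) blast+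
    show "(\<lambda>i. LINT x|lborel. \<bar>f (x - X i) + g (x - X i) - (f x + g x)\<bar>) \<longlonglongrightarrow> 0"
    proof (rule tendsto_sandwich[OF _ _ tendsto_const l])
      show "\<forall>\<^sub>F i in sequentially. (LINT x|lborel. \<bar>f (x - X i) + g (x - X i) - (f x + g x)\<bar>)
          \<le> (LINT x|lborel. \<bar>f (x - X i) - f x\<bar>) + (LINT x|lborel. \<bar>g (x - X i) - g x\<bar>)"
      proof (intro always_eventually allI)
        fix i
        have "(LINT x|lborel. \<bar>f (x - X i) + g (x - X i) - (f x + g x)\<bar>)
            \<le> (LINT x|lborel. \<bar>f (x - X i) - f x\<bar> + \<bar>g (x - X i) - g x\<bar>)"
          by (intro integral_mono Bochner_Integration.integrable_add integrable_abs
              Bochner_Integration.integrable_diff fX add) auto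
        then show "(LINT x|lborel. \<bar>f (x - X i) + g (x - X i) - (f x + g x)\<bar>)
          \<le> (LINT x|lborel. \<bar>f (x - X i) - f x\<bar>) + (LINT x|lborel. \<bar>g (x - X i) - g x\<bar>)"
          by (simp add: Bochner_Integration.integral_add fX add)
      qed
    qed (auto intro: always_eventually)
  qed
next
  case (lim f s)
  have [measurable]: "f \<in> borel_measurable lborel" "\<And>i. s i \<in> borel_measurable lborel"
    using borel_measurable_integrable lim by blast+
  have "(\<lambda>i. LINT x|lborel. \<bar>f x - s i x\<bar>) \<longlonglongrightarrow> (LINT x::'a|lborel. (0::real))"
  proof (rule integral_dominated_convergence)
    show "integrable lborel (\<lambda>x. 3 * \<bar>f x\<bar>)" using lim by auto
    show "AE x in lborel. (\<lambda>i. \<bar>f x - s i x\<bar>) \<longlonglongrightarrow> 0"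
    proof (rule AE_I2)
      fix x
      have "(\<lambda>i. \<bar>f x - s i x\<bar>) \<longlonglongrightarrow> \<bar>f x - f x\<bar>" using lim by (intro tendsto_intros) auto
      then show "(\<lambda>i. \<bar>f x - s i x\<bar>) \<longlonglongrightarrow> 0" by simp
    qed
    show "AE x in lborel. norm \<bar>f x - s i x\<bar> \<le> 3 * \<bar>f x\<bar>" for i
    proof (rule AE_I2)
      fix x
      have "\<bar>s i x\<bar> \<le> 2 * \<bar>f x\<bar>" using lim(3)[of x i] by simp
      then show "norm \<bar>f x - s i x\<bar> \<le> 3 * \<bar>f x\<bar>" by simp
    qed
  qed measurable
  then have l: "(\<lambda>i. LINT x|lborel. \<bar>f x - s i x\<bar>) \<longlonglongrightarrow> 0" by simp
  show ?case
  proof (rule translation_continuous_approx[OF lim(4)])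
    fix \<epsilon> :: real assume "\<epsilon> > 0"
    from LIMSEQ_D[OF l this] obtain n where "norm ((LINT x|lborel. \<bar>f x - s n x\<bar>) - 0) < \<epsilon>" by blast
    then show "\<exists>g. integrable lborel g \<and> translation_continuous g \<and> (LINT x|lborel. \<bar>f x - g x\<bar>) \<le> \<epsilon>"
      using lim by (intro exI[of _ "s n"]) auto
  qed
qed

lemma pow_truncation_tendsto:
  fixes h :: "'a::euclidean_space \<Rightarrow> real"
  assumes h: "pow_integrable s h" and s: "s \<ge> 1"
  defines "T \<equiv> \<lambda>n x. if \<bar>h x\<bar> \<le> real n \<and> norm x \<le> real n then h x else 0"
  shows "(\<lambda>n. LINT x|lborel. \<bar>h x - T n x\<bar> powr s) \<longlonglongrightarrow> 0"
proof -
  note [measurable] = pow_integrable_borel[OF h]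
  have "(\<lambda>n. LINT x|lborel. \<bar>h x - T n x\<bar> powr s) \<longlonglongrightarrow> (LINT x::'a|lborel. (0::real))"
  proof (rule integral_dominated_convergence)
    show "integrable lborel (\<lambda>x. \<bar>h x\<bar> powr s)" by (rule pow_integrableD[OF h])
    show "AE x in lborel. (\<lambda>n. \<bar>h x - T n x\<bar> powr s) \<longlonglongrightarrow> 0"
    proof (rule AE_I2)
      fix x
      obtain n0 :: nat where n0: "max \<bar>h x\<bar> (norm x) \<le> real n0" using real_arch_simple by blast
      have "eventually (\<lambda>n. 0 = \<bar>h x - T n x\<bar> powr s) sequentially"
        using eventually_ge_at_top[of n0] by eventually_elim (use n0 in \<open>simp add: T_def\<close>)
      then show "(\<lambda>n. \<bar>h x - T n x\<bar> powr s) \<longlonglongrightarrow> 0"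
        by (rule Lim_transform_eventually[OF tendsto_const])
    qed
    show "AE x in lborel. norm (\<bar>h x - T n x\<bar> powr s) \<le> \<bar>h x\<bar> powr s" for n
      by (intro AE_I2) (simp add: T_def)
  qed (simp_all add: T_def)
  then show ?thesis by simp
qed

text \<open>On a truncation bounded by \<open>n\<close> the \<open>s\<close>-th power of a difference is at most \<open>(2 n)\<^bsup>s - 1\<^esup>\<close> times the
  difference, so the truncated function is covered by the case of \<open>L\<^sup>1\<close>.\<close>

lemma pow_translation_tendsto:
  fixes h :: "'a::euclidean_space \<Rightarrow> real"
  assumes h: "pow_integrable s h" and s: "s \<ge> 1" and X: "X \<longlonglongrightarrow> 0"
  shows "(\<lambda>i. LINT x|lborel. \<bar>h (x - X i) - h x\<bar> powr s) \<longlonglongrightarrow> 0"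
proof (rule LIMSEQ_I)
  fix r :: real assume r: "r > 0"
  note [measurable] = pow_integrable_borel[OF h]
  define T where "T n x = (if \<bar>h x\<bar> \<le> real n \<and> norm x \<le> real n then h x else 0)" for n x
  define K where "K = 2 powr s * 2 powr s"
  have K: "K > 0" unfolding K_def by simp
  have "(\<lambda>n. LINT x|lborel. \<bar>h x - T n x\<bar> powr s) \<longlonglongrightarrow> 0"
    unfolding T_def by (rule pow_truncation_tendsto[OF h s])
  from LIMSEQ_D[OF this, of "r / (4 * K)"] r K
  obtain n where n: "(LINT x|lborel. \<bar>h x - T n x\<bar> powr s) < r / (4 * K)" by fastforce
  have [measurable]: "T n \<in> borel_measurable borel" unfolding T_def[abs_def] by measurable
  have Tb: "\<bar>T n x\<bar> \<le> real n" "real n < norm x \<Longrightarrow> T n x = 0" for x by (auto simp: T_def)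
  have bT: "bounded_support (T n)" by (rule bounded_supportI[OF _ Tb]) measurable
  have iT: "integrable lborel (T n)" by (rule bounded_support_integrable[OF bT])
  have pT: "pow_integrable s (T n)"
    by (rule pow_integrable_bound[OF pow_integrableD[OF h]]) (auto simp: T_def)
  have tr: "pow_integrable s (\<lambda>x. f (x - z))" if f: "pow_integrable s f" for f :: "'a \<Rightarrow> real" and z
  proof -
    note [measurable] = pow_integrable_borel[OF f]
    show ?thesis using integrable_translate[OF pow_integrableD[OF f], of z] unfolding pow_integrable_def by simp
  qed
  define C where "C = (2 * real n) powr (s - 1)"
  have C: "C \<ge> 0" unfolding C_def by simp
  have "(\<lambda>i. LINT x|lborel. \<bar>T n (x - X i) - T n x\<bar>) \<longlonglongrightarrow> 0"
    using translation_continuous_integrable[OF iT] X unfolding translation_continuous_def by blast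
  then have "(\<lambda>i. 2 powr s * (C * (LINT x|lborel. \<bar>T n (x - X i) - T n x\<bar>))) \<longlonglongrightarrow> 0"
    by (intro tendsto_mult_right_zero)
  from LIMSEQ_D[OF this, of "r / 2"] r obtain i0
    where i0: "\<And>i. i \<ge> i0 \<Longrightarrow> 2 powr s * (C * (LINT x|lborel. \<bar>T n (x - X i) - T n x\<bar>)) < r / 2" by fastforce
  have "norm ((LINT x|lborel. \<bar>h (x - X i) - h x\<bar> powr s) - 0) < r" if "i \<ge> i0" for i
  proof -
    let ?z = "X i"
    have pw: "\<bar>h (x - ?z) - h x\<bar> powr s \<le> K * \<bar>h (x - ?z) - T n (x - ?z)\<bar> powr s
      + K * \<bar>h x - T n x\<bar> powr s + 2 powr s * (C * \<bar>T n (x - ?z) - T n x\<bar>)" for x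
    proof -
      let ?a = "h (x - ?z) - T n (x - ?z)" and ?b = "T n x - h x" and ?c = "T n (x - ?z) - T n x"
      have "\<bar>h (x - ?z) - h x\<bar> powr s = \<bar>(?a + ?b) + ?c\<bar> powr s" by simp
      also have "\<dots> \<le> 2 powr s * (\<bar>?a + ?b\<bar> powr s + \<bar>?c\<bar> powr s)"
        by (rule abs_powr_add_le) (use s in simp)
      also have "\<dots> \<le> 2 powr s * (2 powr s * (\<bar>?a\<bar> powr s + \<bar>?b\<bar> powr s) + \<bar>?c\<bar> powr s)"
        by (intro mult_left_mono add_right_mono abs_powr_add_le) (use s in auto)
      also have "\<bar>?c\<bar> powr s \<le> C * \<bar>?c\<bar>"
      proof -
        have "\<bar>?c\<bar> powr s = \<bar>?c\<bar> powr (s - 1) * \<bar>?c\<bar>"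
          by (cases "?c = 0") (simp_all add: powr_diff)
        also have "\<dots> \<le> C * \<bar>?c\<bar>"
          unfolding C_def using Tb(1)[of x] Tb(1)[of "x - ?z"] s
          by (intro mult_right_mono powr_mono2) auto
        finally show ?thesis .
      qed
      finally show ?thesis by (simp add: K_def algebra_simps abs_minus_commute[of "T n x" "h x"])
    qed
    have i1: "integrable lborel (\<lambda>x. \<bar>h x - T n x\<bar> powr s)"
      using pow_integrable_diff[OF h pT] s by (intro pow_integrableD) simp
    note i2 = integrable_translate[OF i1, of ?z]
    have i3: "integrable lborel (\<lambda>x. \<bar>T n (x - ?z) - T n x\<bar>)"
      by (intro integrable_abs Bochner_Integration.integrable_diff integrable_translate iT)
    have "(LINT x|lborel. \<bar>h (x - ?z) - h x\<bar> powr s) \<le> (LINT x|lborel. K * \<bar>h (x - ?z) - T n (x - ?z)\<bar> powr s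
      + K * \<bar>h x - T n x\<bar> powr s + 2 powr s * (C * \<bar>T n (x - ?z) - T n x\<bar>))"
      by (intro integral_mono Bochner_Integration.integrable_add integrable_mult_right i1 i2 i3
          pow_integrableD[OF pow_integrable_diff[OF tr[OF h] h]] pw) (use s in auto)
    also have "\<dots> = K * (LINT x|lborel. \<bar>h (x - ?z) - T n (x - ?z)\<bar> powr s)
      + K * (LINT x|lborel. \<bar>h x - T n x\<bar> powr s) + 2 powr s * (C * (LINT x|lborel. \<bar>T n (x - ?z) - T n x\<bar>))"
      using i1 i2 i3 by simp
    also have "(LINT x|lborel. \<bar>h (x - ?z) - T n (x - ?z)\<bar> powr s) = (LINT x|lborel. \<bar>h x - T n x\<bar> powr s)"
      by (rule integral_translate[of "\<lambda>x. \<bar>h x - T n x\<bar> powr s"]) measurable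
    finally have "(LINT x|lborel. \<bar>h (x - ?z) - h x\<bar> powr s) < r"
      using mult_strict_left_mono[OF n K] i0[OF that] K by simp
    then show ?thesis by simp
  qed
  then show "\<exists>no. \<forall>i\<ge>no. norm ((LINT x|lborel. \<bar>h (x - X i) - h x\<bar> powr s) - 0) < r" by blast
qed

subsection \<open>Convergence of mollifications\<close>

text \<open>Young's inequality for the product \<open>t * m powr (s - 1)\<close>, rearranged.\<close>

lemma powr_above_tangent:
  fixes t m s :: real
  assumes "t \<ge> 0" "m \<ge> 0" "s \<ge> 1"
  shows "m powr s + s * m powr (s - 1) * (t - m) \<le> t powr s"
proof (cases "s = 1")
  case True
  then show ?thesis using assms by (cases "m = 0") auto
next
  case False
  then have s: "s > 1" using assms by simp
  define q where "q = s / (s - 1)"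
  have q: "q > 1" "1 / s + 1 / q = 1" using s unfolding q_def by (auto simp: field_simps)
  have "t * m powr (s - 1) \<le> t powr s / s + (m powr (s - 1)) powr q / q"
    using Youngs_inequality[of s q t "m powr (s - 1)"] s q assms by simp
  also have "(m powr (s - 1)) powr q = m powr s" using s by (simp add: powr_powr q_def)
  finally have "s * (t * m powr (s - 1)) \<le> t powr s + s * (m powr s / q)"
    using s by (simp add: field_simps)
  also have "s * (m powr s / q) = (s - 1) * m powr s" using s by (simp add: q_def field_simps)
  finally have *: "s * (t * m powr (s - 1)) \<le> t powr s + (s - 1) * m powr s" .
  have "m powr (s - 1) * m = m powr s"
    using assms by (cases "m = 0") (auto simp: powr_diff)
  then show ?thesis using * by (simp add: algebra_simps)
qed

text \<open>Integrate the tangent inequality of \<open>\<lambda>t. t powr s\<close> at the mean of \<open>\<bar>k\<bar>\<close>: the linear term vanishes.\<close>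

lemma jensen_powr:
  fixes w k :: "'a::euclidean_space \<Rightarrow> real"
  assumes w: "\<And>x. w x \<ge> 0" "integrable lborel w" "(LINT x|lborel. w x) = 1"
    and k: "k \<in> borel_measurable borel" "integrable lborel (\<lambda>x. w x * k x)" and s: "s \<ge> 1"
  shows "ennreal (\<bar>LINT x|lborel. w x * k x\<bar> powr s) \<le> (\<integral>\<^sup>+x. ennreal (w x * \<bar>k x\<bar> powr s) \<partial>lborel)"
proof (cases "(\<integral>\<^sup>+x. ennreal (w x * \<bar>k x\<bar> powr s) \<partial>lborel) = \<infinity>")
  case False
  have [measurable]: "w \<in> borel_measurable borel" "k \<in> borel_measurable borel"
    using borel_measurable_integrable[OF w(2)] k(1) by auto
  have i: "integrable lborel (\<lambda>x. w x * \<bar>k x\<bar> powr s)"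
    using False w(1) by (intro integrableI_nonneg) (auto simp: less_top)
  have j: "integrable lborel (\<lambda>x. w x * \<bar>k x\<bar>)"
    using integrable_abs[OF k(2)] w(1) by (simp add: abs_mult)
  define m where "m = (LINT x|lborel. w x * \<bar>k x\<bar>)"
  have m: "\<bar>LINT x|lborel. w x * k x\<bar> \<le> m"
    using integral_abs_bound[of lborel "\<lambda>x. w x * k x"] w(1) by (simp add: m_def abs_mult)
  then have m0: "m \<ge> 0" by linarith
  have "m powr s = (LINT x|lborel. m powr s * w x + s * m powr (s - 1) * (w x * \<bar>k x\<bar> - m * w x))"
    using j w by (simp add: m_def[symmetric])
  also have "\<dots> \<le> (LINT x|lborel. w x * \<bar>k x\<bar> powr s)"
  proof (rule integral_mono)
    show "integrable lborel (\<lambda>x. m powr s * w x + s * m powr (s - 1) * (w x * \<bar>k x\<bar> - m * w x))"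
      using j w by auto
    show "m powr s * w x + s * m powr (s - 1) * (w x * \<bar>k x\<bar> - m * w x) \<le> w x * \<bar>k x\<bar> powr s" for x
      using mult_left_mono[OF powr_above_tangent[OF abs_ge_zero[of "k x"] m0 s] w(1)[of x]]
      by (simp add: algebra_simps)
  qed (fact i)
  finally have "m powr s \<le> (LINT x|lborel. w x * \<bar>k x\<bar> powr s)" .
  moreover have "\<bar>LINT x|lborel. w x * k x\<bar> powr s \<le> m powr s" using m s by (intro powr_mono2) auto
  ultimately show ?thesis
    by (subst nn_integral_eq_integral[OF i]) (use w(1) in \<open>auto intro: ennreal_leI\<close>)
qed simp

lemma moll_reflect:
  assumes [measurable]: "\<phi> \<in> borel_measurable borel" "h \<in> borel_measurable borel"
  shows "moll \<phi> h x = (LINT z|lborel. \<phi> z * h (x - z))"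
  unfolding moll_def using integral_reflect[of "\<lambda>y. \<phi> (x - y) * h y" x] by simp

text \<open>The parameter \<open>c\<close> serves two purposes: \<open>c = 0\<close> gives the contraction property of mollification, and
  \<open>c = 1\<close> its convergence.\<close>

lemma nn_integral_moll_powr:
  fixes h :: "'a::euclidean_space \<Rightarrow> real"
  assumes \<rho>: "\<And>x. \<rho> x \<ge> 0" "bounded_support \<rho>" "(LINT x|lborel. \<rho> x) = 1"
    and h: "loc_integrable h" "s \<ge> 1"
  shows "(\<integral>\<^sup>+x. ennreal (\<bar>moll \<rho> h x - c * h x\<bar> powr s) \<partial>lborel)
    \<le> (\<integral>\<^sup>+z. ennreal (\<rho> z) * (\<integral>\<^sup>+x. ennreal (\<bar>h (x - z) - c * h x\<bar> powr s) \<partial>lborel) \<partial>lborel)"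
proof -
  note [measurable] = bounded_support_borel[OF \<rho>(2)] loc_integrable_borel[OF h(1)]
  have i\<rho>: "integrable lborel \<rho>" by (rule bounded_support_integrable[OF \<rho>(2)])
  have i: "integrable lborel (\<lambda>z. \<rho> z * h (x - z))" for x
  proof -
    have "integrable (distr lborel borel (\<lambda>z. x - z)) (\<lambda>y. \<rho> (x - y) * h y)"
      using moll_integrable[OF \<rho>(2) h(1), of x] by (simp add: lborel_distr_reflect)
    then show ?thesis by (subst (asm) integrable_distr_eq) auto
  qed
  have j: "integrable lborel (\<lambda>z. \<rho> z * (h (x - z) - c * h x))" for x
    using i[of x] i\<rho> by (simp add: right_diff_distrib)
  have "ennreal (\<bar>moll \<rho> h x - c * h x\<bar> powr s)
      \<le> (\<integral>\<^sup>+z. ennreal (\<rho> z * \<bar>h (x - z) - c * h x\<bar> powr s) \<partial>lborel)" for x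
  proof -
    have "moll \<rho> h x - c * h x = (LINT z|lborel. \<rho> z * (h (x - z) - c * h x))"
      using i[of x] i\<rho> \<rho>(3) by (simp add: right_diff_distrib moll_reflect)
    then show ?thesis using jensen_powr[OF \<rho>(1) i\<rho> \<rho>(3) _ j h(2), of x] by simp
  qed
  then have "(\<integral>\<^sup>+x. ennreal (\<bar>moll \<rho> h x - c * h x\<bar> powr s) \<partial>lborel)
    \<le> (\<integral>\<^sup>+x. \<integral>\<^sup>+z. ennreal (\<rho> z * \<bar>h (x - z) - c * h x\<bar> powr s) \<partial>lborel \<partial>lborel)"
    by (intro nn_integral_mono)
  also have "\<dots> = (\<integral>\<^sup>+z. \<integral>\<^sup>+x. ennreal (\<rho> z * \<bar>h (x - z) - c * h x\<bar> powr s) \<partial>lborel \<partial>lborel)"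
    by (rule lborel_pair.Fubini') measurable
  also have "\<dots> = (\<integral>\<^sup>+z. ennreal (\<rho> z) * (\<integral>\<^sup>+x. ennreal (\<bar>h (x - z) - c * h x\<bar> powr s) \<partial>lborel) \<partial>lborel)"
    by (intro nn_integral_cong) (simp add: ennreal_mult' \<rho>(1) nn_integral_cmult)
  finally show ?thesis .
qed

definition converges_pow :: "real \<Rightarrow> (nat \<Rightarrow> 'a::euclidean_space \<Rightarrow> real) \<Rightarrow> ('a \<Rightarrow> real) \<Rightarrow> bool" where
  "converges_pow s F f \<longleftrightarrow> (\<forall>n. pow_integrable s (F n)) \<and> pow_integrable s f \<and>
     (\<lambda>n. LINT x|lborel. \<bar>F n x - f x\<bar> powr s) \<longlonglongrightarrow> 0"

lemma mollifierD:
  assumes "mollifier \<rho>"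
  shows "\<rho> n \<in> test_functions UNIV" "\<rho> n x \<ge> 0" "\<rho> n (- x) = \<rho> n x" "(LINT x|lborel. \<rho> n x) = 1"
    "bounded_support (\<rho> n)" "\<rho> n x \<noteq> 0 \<Longrightarrow> norm x \<le> 1 / real (Suc n)"
  using assms test_function_bounded_support unfolding mollifier_def by blast+

lemma pow_integrable_moll:
  assumes \<rho>: "mollifier \<rho>" and h: "pow_integrable s h" and s: "s \<ge> 1"
  shows "pow_integrable s (moll (\<rho> n) h)"
    and "(LINT x|lborel. \<bar>moll (\<rho> n) h x\<bar> powr s) \<le> (LINT x|lborel. \<bar>h x\<bar> powr s)"
proof -
  note [measurable] = pow_integrable_borel[OF h] bounded_support_borel[OF mollifierD(5)[OF \<rho>, of n]]
  have i\<rho>: "(\<integral>\<^sup>+z. ennreal (\<rho> n z) \<partial>lborel) = 1"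
    using mollifierD(2,4)[OF \<rho>] bounded_support_integrable[OF mollifierD(5)[OF \<rho>]]
    by (subst nn_integral_eq_integral) auto
  have "(\<integral>\<^sup>+x. ennreal (\<bar>moll (\<rho> n) h x\<bar> powr s) \<partial>lborel)
    \<le> (\<integral>\<^sup>+z. ennreal (\<rho> n z) * (\<integral>\<^sup>+x. ennreal (\<bar>h (x - z)\<bar> powr s) \<partial>lborel) \<partial>lborel)"
    using nn_integral_moll_powr[OF mollifierD(2,5,4)[OF \<rho>, of n] pow_integrable_loc_integrable[OF h s] s, where c=0]
    by simp
  also have "\<dots> = (\<integral>\<^sup>+z. ennreal (\<rho> n z) * (\<integral>\<^sup>+x. ennreal (\<bar>h x\<bar> powr s) \<partial>lborel) \<partial>lborel)"
    by (intro nn_integral_cong, subst nn_integral_translate[of "\<lambda>x. ennreal (\<bar>h x\<bar> powr s)"]) auto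
  also have "\<dots> = ennreal (LINT x|lborel. \<bar>h x\<bar> powr s)"
    by (simp add: nn_integral_multc i\<rho> nn_integral_eq_integral[OF pow_integrableD[OF h]])
  finally have le: "(\<integral>\<^sup>+x. ennreal (\<bar>moll (\<rho> n) h x\<bar> powr s) \<partial>lborel) \<le> ennreal (LINT x|lborel. \<bar>h x\<bar> powr s)" .
  have "integrable lborel (\<lambda>x. \<bar>moll (\<rho> n) h x\<bar> powr s)"
    using le by (intro integrableI_nonneg) (auto simp: less_top[symmetric] top_unique)
  then show "pow_integrable s (moll (\<rho> n) h)" unfolding pow_integrable_def by simp
  show "(LINT x|lborel. \<bar>moll (\<rho> n) h x\<bar> powr s) \<le> (LINT x|lborel. \<bar>h x\<bar> powr s)"
    using le by (simp add: nn_integral_eq_integral[OF \<open>integrable lborel (\<lambda>x. \<bar>moll (\<rho> n) h x\<bar> powr s)\<close>])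
qed

lemma pow_translation_small:
  fixes h :: "'a::euclidean_space \<Rightarrow> real"
  assumes h: "pow_integrable s h" and s: "s \<ge> 1" and r: "r > 0"
  shows "\<exists>n0. \<forall>z. norm z \<le> 1 / real (Suc n0) \<longrightarrow> (LINT x|lborel. \<bar>h (x - z) - h x\<bar> powr s) < r"
proof (rule ccontr)
  assume "\<not> ?thesis"
  then have "\<forall>n. \<exists>z. norm z \<le> 1 / real (Suc n) \<and> r \<le> (LINT x|lborel. \<bar>h (x - z) - h x\<bar> powr s)"
    by (simp add: not_less)
  then obtain X where X: "\<And>n. norm (X n) \<le> 1 / real (Suc n)"
    "\<And>n. r \<le> (LINT x|lborel. \<bar>h (x - X n) - h x\<bar> powr s)" by metis
  have "(\<lambda>n. 1 / real (Suc n)) \<longlonglongrightarrow> 0"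
    using LIMSEQ_inverse_real_of_nat by (simp only: inverse_eq_divide)
  note l = this
  have "X \<longlonglongrightarrow> 0"
    by (rule Lim_null_comparison[OF always_eventually l]) (rule allI, rule X(1))
  from LIMSEQ_D[OF pow_translation_tendsto[OF h s this] r]
  obtain n where "norm ((LINT x|lborel. \<bar>h (x - X n) - h x\<bar> powr s) - 0) < r" by blast
  then have "(LINT x|lborel. \<bar>h (x - X n) - h x\<bar> powr s) < r" by simp
  with X(2)[of n] show False by simp
qed

lemma moll_converges_pow:
  fixes h :: "'a::euclidean_space \<Rightarrow> real"
  assumes \<rho>: "mollifier \<rho>" and h: "pow_integrable s h" and s: "s \<ge> 1"
  shows "converges_pow s (\<lambda>n. moll (\<rho> n) h) h"
  unfolding converges_pow_def
proof (intro conjI allI LIMSEQ_I)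
  fix r :: real assume r: "r > 0"
  note [measurable] = pow_integrable_borel[OF h]
  obtain n0 where n0: "\<And>z. norm z \<le> 1 / real (Suc n0) \<Longrightarrow> (LINT x|lborel. \<bar>h (x - z) - h x\<bar> powr s) < r / 2"
    using pow_translation_small[OF h s, of "r / 2"] r by auto
  have "norm ((LINT x|lborel. \<bar>moll (\<rho> n) h x - h x\<bar> powr s) - 0) < r" if n: "n \<ge> n0" for n
  proof -
    have [measurable]: "\<rho> n \<in> borel_measurable borel" by (rule bounded_support_borel[OF mollifierD(5)[OF \<rho>]])
    have i\<rho>: "(\<integral>\<^sup>+z. ennreal (\<rho> n z) \<partial>lborel) = 1"
      using mollifierD(2,4)[OF \<rho>] bounded_support_integrable[OF mollifierD(5)[OF \<rho>]]
      by (subst nn_integral_eq_integral) auto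
    have "(\<integral>\<^sup>+x. ennreal (\<bar>moll (\<rho> n) h x - h x\<bar> powr s) \<partial>lborel)
      \<le> (\<integral>\<^sup>+z. ennreal (\<rho> n z) * (\<integral>\<^sup>+x. ennreal (\<bar>h (x - z) - h x\<bar> powr s) \<partial>lborel) \<partial>lborel)"
      using nn_integral_moll_powr[OF mollifierD(2,5,4)[OF \<rho>, of n] pow_integrable_loc_integrable[OF h s] s, where c=1]
      by simp
    also have "\<dots> \<le> (\<integral>\<^sup>+z. ennreal (\<rho> n z) * ennreal (r / 2) \<partial>lborel)"
    proof (rule nn_integral_mono)
      fix z :: 'a
      show "ennreal (\<rho> n z) * (\<integral>\<^sup>+x. ennreal (\<bar>h (x - z) - h x\<bar> powr s) \<partial>lborel) \<le> ennreal (\<rho> n z) * ennreal (r / 2)"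
      proof (cases "\<rho> n z = 0")
        case False
        have "1 / real (Suc n) \<le> 1 / real (Suc n0)" using n by (simp add: field_simps)
        then have "norm z \<le> 1 / real (Suc n0)"
          using mollifierD(6)[OF \<rho> False] by linarith
        note lt = n0[OF this]
        have p: "pow_integrable s (\<lambda>x. h (x - z))"
          using integrable_translate[OF pow_integrableD[OF h], of z] unfolding pow_integrable_def by simp
        have "(\<integral>\<^sup>+x. ennreal (\<bar>h (x - z) - h x\<bar> powr s) \<partial>lborel) = ennreal (LINT x|lborel. \<bar>h (x - z) - h x\<bar> powr s)"
          by (intro nn_integral_eq_integral pow_integrableD pow_integrable_diff p h) (use s in auto)
        then show ?thesis using lt by (intro mult_left_mono) (auto intro!: ennreal_leI)
      qed simp
    qed
    also have "\<dots> = ennreal (r / 2)" by (simp add: nn_integral_multc i\<rho>)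
    finally have le: "(\<integral>\<^sup>+x. ennreal (\<bar>moll (\<rho> n) h x - h x\<bar> powr s) \<partial>lborel) \<le> ennreal (r / 2)" .
    have "pow_integrable s (\<lambda>x. moll (\<rho> n) h x - h x)"
      by (intro pow_integrable_diff pow_integrable_moll[OF \<rho> h s] h) (use s in simp)
    from le[unfolded nn_integral_eq_integral[OF pow_integrableD[OF this] AE_I2[OF powr_ge_zero]]]
    have "(LINT x|lborel. \<bar>moll (\<rho> n) h x - h x\<bar> powr s) \<le> r / 2" using r by simp
    then show ?thesis using r by simp
  qed
  then show "\<exists>no. \<forall>n\<ge>no. norm ((LINT x|lborel. \<bar>moll (\<rho> n) h x - h x\<bar> powr s) - 0) < r" by blast
qed (use pow_integrable_moll[OF \<rho> h s] h in auto)

subsection \<open>Dominated subsequences and limits of products\<close>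

lemma converges_pow_bounded_mult:
  assumes F: "converges_pow s F f" and k: "k \<in> borel_measurable borel" "\<And>x. \<bar>k x\<bar> \<le> C" and s: "s \<ge> 0"
  shows "converges_pow s (\<lambda>n x. k x * F n x) (\<lambda>x. k x * f x)"
  unfolding converges_pow_def
proof (intro conjI allI)
  have Fn: "pow_integrable s (F n)" and f: "pow_integrable s f" for n
    using F unfolding converges_pow_def by auto
  show "pow_integrable s (\<lambda>x. k x * F n x)" "pow_integrable s (\<lambda>x. k x * f x)" for n
    using pow_integrable_bounded_mult[OF _ k s] Fn f by blast+
  note d = pow_integrable_diff[OF Fn f s]
  have "(\<lambda>n. C powr s * (LINT x|lborel. \<bar>F n x - f x\<bar> powr s)) \<longlonglongrightarrow> 0"
    using F unfolding converges_pow_def by (intro tendsto_mult_right_zero) blast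
  then show "(\<lambda>n. LINT x|lborel. \<bar>k x * F n x - k x * f x\<bar> powr s) \<longlonglongrightarrow> 0"
  proof (rule tendsto_sandwich[OF _ _ tendsto_const, rotated -1])
    show "\<forall>\<^sub>F n in sequentially. (LINT x|lborel. \<bar>k x * F n x - k x * f x\<bar> powr s)
        \<le> C powr s * (LINT x|lborel. \<bar>F n x - f x\<bar> powr s)"
    proof (intro always_eventually allI)
      fix n
      have "(LINT x|lborel. \<bar>k x * F n x - k x * f x\<bar> powr s) \<le> (LINT x|lborel. C powr s * \<bar>F n x - f x\<bar> powr s)"
      proof (rule integral_mono)
        show "integrable lborel (\<lambda>x. \<bar>k x * F n x - k x * f x\<bar> powr s)"
          using pow_integrableD[OF pow_integrable_bounded_mult[OF d k s]] by (simp add: right_diff_distrib)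
        show "integrable lborel (\<lambda>x. C powr s * \<bar>F n x - f x\<bar> powr s)"
          by (intro integrable_mult_right pow_integrableD d)
        fix x
        have "\<bar>k x * F n x - k x * f x\<bar> powr s = \<bar>k x\<bar> powr s * \<bar>F n x - f x\<bar> powr s"
          by (simp add: abs_mult powr_mult flip: right_diff_distrib)
        also have "\<dots> \<le> C powr s * \<bar>F n x - f x\<bar> powr s"
          using k(2)[of x] s by (intro mult_right_mono powr_mono2) auto
        finally show "\<bar>k x * F n x - k x * f x\<bar> powr s \<le> C powr s * \<bar>F n x - f x\<bar> powr s" .
      qed
      then show "(LINT x|lborel. \<bar>k x * F n x - k x * f x\<bar> powr s) \<le> C powr s * (LINT x|lborel. \<bar>F n x - f x\<bar> powr s)"
        by simp
    qed
  qed (auto intro!: always_eventually)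
qed

lemma converges_pow_add:
  assumes F: "converges_pow s F f" and G: "converges_pow s G g" and s: "s \<ge> 0"
  shows "converges_pow s (\<lambda>n x. F n x + G n x) (\<lambda>x. f x + g x)"
  unfolding converges_pow_def
proof (intro conjI allI)
  have Fn: "pow_integrable s (F n)" "pow_integrable s f" "pow_integrable s (G n)" "pow_integrable s g" for n
    using F G unfolding converges_pow_def by auto
  show "pow_integrable s (\<lambda>x. F n x + G n x)" "pow_integrable s (\<lambda>x. f x + g x)" for n
    by (intro pow_integrable_add Fn s)+
  have "(\<lambda>n. 2 powr s * ((LINT x|lborel. \<bar>F n x - f x\<bar> powr s) + (LINT x|lborel. \<bar>G n x - g x\<bar> powr s))) \<longlonglongrightarrow> 0"
    using F G unfolding converges_pow_def by (intro tendsto_mult_right_zero tendsto_add_zero) blast+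
  then show "(\<lambda>n. LINT x|lborel. \<bar>F n x + G n x - (f x + g x)\<bar> powr s) \<longlonglongrightarrow> 0"
  proof (rule tendsto_sandwich[OF _ _ tendsto_const, rotated -1])
    show "\<forall>\<^sub>F n in sequentially. (LINT x|lborel. \<bar>F n x + G n x - (f x + g x)\<bar> powr s)
        \<le> 2 powr s * ((LINT x|lborel. \<bar>F n x - f x\<bar> powr s) + (LINT x|lborel. \<bar>G n x - g x\<bar> powr s))"
    proof (intro always_eventually allI)
      fix n
      have i: "integrable lborel (\<lambda>x. \<bar>F n x - f x\<bar> powr s)" "integrable lborel (\<lambda>x. \<bar>G n x - g x\<bar> powr s)"
        by (intro pow_integrableD pow_integrable_diff Fn s)+
      have "(LINT x|lborel. \<bar>F n x + G n x - (f x + g x)\<bar> powr s)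
          \<le> (LINT x|lborel. 2 powr s * (\<bar>F n x - f x\<bar> powr s + \<bar>G n x - g x\<bar> powr s))"
      proof (rule integral_mono)
        show "integrable lborel (\<lambda>x. \<bar>F n x + G n x - (f x + g x)\<bar> powr s)"
          by (intro pow_integrableD pow_integrable_diff pow_integrable_add Fn s)
        show "integrable lborel (\<lambda>x. 2 powr s * (\<bar>F n x - f x\<bar> powr s + \<bar>G n x - g x\<bar> powr s))"
          by (intro integrable_mult_right Bochner_Integration.integrable_add i)
        fix x
        show "\<bar>F n x + G n x - (f x + g x)\<bar> powr s \<le> 2 powr s * (\<bar>F n x - f x\<bar> powr s + \<bar>G n x - g x\<bar> powr s)"
          using abs_powr_add_le[OF s, of "F n x - f x" "G n x - g x"] by (simp add: algebra_simps)
      qed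
      then show "(LINT x|lborel. \<bar>F n x + G n x - (f x + g x)\<bar> powr s)
        \<le> 2 powr s * ((LINT x|lborel. \<bar>F n x - f x\<bar> powr s) + (LINT x|lborel. \<bar>G n x - g x\<bar> powr s))"
        using i by simp
    qed
  qed (auto intro!: always_eventually)
qed

lemma converges_pow_sum:
  assumes "finite I" "\<And>i. i \<in> I \<Longrightarrow> converges_pow s (F i) (f i)" "s \<ge> 0"
  shows "converges_pow s (\<lambda>n x. \<Sum>i\<in>I. F i n x) (\<lambda>x. \<Sum>i\<in>I. f i x)"
  using assms
proof (induction I)
  case empty
  then show ?case by (simp add: converges_pow_def pow_integrable_zero)
next
  case (insert i I)
  then show ?case using converges_pow_add[of s "F i" "f i" "\<lambda>n x. \<Sum>i\<in>I. F i n x"] by simp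
qed

lemma moll_diff:
  assumes "bounded_support \<phi>" "loc_integrable f" "loc_integrable g"
  shows "moll \<phi> (\<lambda>x. f x - g x) x = moll \<phi> f x - moll \<phi> g x"
  unfolding moll_def using moll_integrable[OF assms(1,2)] moll_integrable[OF assms(1,3)]
  by (simp add: right_diff_distrib)

text \<open>Mollification is a contraction, so a convergent sequence may be mollified along with the mollifier.\<close>

lemma moll_diagonal_converges_pow:
  assumes \<rho>: "mollifier \<rho>" and W: "converges_pow s W w" and s: "s \<ge> 1"
  shows "converges_pow s (\<lambda>n. moll (\<rho> n) (W n)) w"
proof -
  have Wn: "pow_integrable s (W n)" and w: "pow_integrable s w" for n
    using W unfolding converges_pow_def by auto
  have s0: "s \<ge> 0" using s by simp
  note d = pow_integrable_diff[OF Wn w s0]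
  have 1: "converges_pow s (\<lambda>n. moll (\<rho> n) (\<lambda>x. W n x - w x)) (\<lambda>x. 0)"
    unfolding converges_pow_def
  proof (intro conjI allI)
    show "pow_integrable s (moll (\<rho> n) (\<lambda>x. W n x - w x))" for n by (rule pow_integrable_moll[OF \<rho> d s])
    have "(\<lambda>n. LINT x|lborel. \<bar>W n x - w x\<bar> powr s) \<longlonglongrightarrow> 0" using W unfolding converges_pow_def by blast
    then show "(\<lambda>n. LINT x|lborel. \<bar>moll (\<rho> n) (\<lambda>x. W n x - w x) x - 0\<bar> powr s) \<longlonglongrightarrow> 0"
      by (rule tendsto_sandwich[OF _ _ tendsto_const, rotated -1])
        (use pow_integrable_moll(2)[OF \<rho> d s] in \<open>simp_all add: always_eventually\<close>)
  qed (rule pow_integrable_zero)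
  have e: "moll (\<rho> n) (\<lambda>x. W n x - w x) x + moll (\<rho> n) w x = moll (\<rho> n) (W n) x" for n x
    by (simp add: moll_diff[OF mollifierD(5)[OF \<rho>] pow_integrable_loc_integrable[OF Wn s] pow_integrable_loc_integrable[OF w s]])
  show ?thesis
    using converges_pow_add[OF 1 moll_converges_pow[OF \<rho> w s] s0] by (simp add: e)
qed

text \<open>The form in which convergence in \<open>L\<^sup>s\<close> enters the dominated convergence theorem. The bound is put on
  the \<open>s\<close>-th powers, which avoids roots.\<close>

definition dominated_pow :: "real \<Rightarrow> (nat \<Rightarrow> 'a::euclidean_space \<Rightarrow> real) \<Rightarrow> ('a \<Rightarrow> real) \<Rightarrow> bool" where
  "dominated_pow s F f \<longleftrightarrow> (\<forall>n. F n \<in> borel_measurable borel) \<and> f \<in> borel_measurable borel \<and>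
     (\<exists>G. integrable lborel G \<and> (\<forall>n. AE x in lborel. \<bar>F n x\<bar> powr s \<le> G x)) \<and>
     (AE x in lborel. (\<lambda>n. F n x) \<longlonglongrightarrow> f x)"

text \<open>If the errors are summable, the sum of the \<open>s\<close>-th powers of all differences is integrable; it provides
  the majorant, and it is finite almost everywhere, which forces pointwise convergence.\<close>

lemma dominated_powI_fast:
  assumes F: "\<And>n. pow_integrable s (F n)" "pow_integrable s f" and s: "s \<ge> 1"
    and fast: "\<And>n. (LINT x|lborel. \<bar>F n x - f x\<bar> powr s) \<le> (1 / 2) ^ n"
  shows "dominated_pow s F f"
proof -
  note [measurable] = pow_integrable_borel[OF F(1)] pow_integrable_borel[OF F(2)]
  define S where "S x = (\<Sum>n. ennreal (\<bar>F n x - f x\<bar> powr s))" for x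
  have [measurable]: "S \<in> borel_measurable borel" unfolding S_def[abs_def] by measurable
  have "(\<integral>\<^sup>+x. S x \<partial>lborel) = (\<Sum>n. \<integral>\<^sup>+x. ennreal (\<bar>F n x - f x\<bar> powr s) \<partial>lborel)"
    unfolding S_def by (rule nn_integral_suminf) measurable
  also have "\<dots> \<le> (\<Sum>n. ennreal ((1 / 2) ^ n))"
  proof (rule suminf_le)
    fix n
    have "pow_integrable s (\<lambda>x. F n x - f x)" using F s by (intro pow_integrable_diff) auto
    have "(\<integral>\<^sup>+x. ennreal (\<bar>F n x - f x\<bar> powr s) \<partial>lborel) = ennreal (LINT x|lborel. \<bar>F n x - f x\<bar> powr s)"
      by (rule nn_integral_eq_integral[OF pow_integrableD[OF \<open>pow_integrable s (\<lambda>x. F n x - f x)\<close>] AE_I2[OF powr_ge_zero]])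
    also have "\<dots> \<le> ennreal ((1 / 2) ^ n)" by (rule ennreal_leI[OF fast])
    finally show "(\<integral>\<^sup>+x. ennreal (\<bar>F n x - f x\<bar> powr s) \<partial>lborel) \<le> ennreal ((1 / 2) ^ n)" .
  qed auto
  also have "\<dots> = ennreal (\<Sum>n. (1 / 2) ^ n)"
    by (rule suminf_ennreal2) (auto intro: summable_geometric)
  finally have fin: "(\<integral>\<^sup>+x. S x \<partial>lborel) < \<infinity>" by (rule le_less_trans) simp
  have ae: "AE x in lborel. S x \<noteq> \<infinity>"
    by (rule nn_integral_PInf_AE) (use fin in auto)
  have iS: "integrable lborel (\<lambda>x. enn2real (S x))"
  proof (rule integrableI_nonneg)
    have "(\<integral>\<^sup>+x. ennreal (enn2real (S x)) \<partial>lborel) = (\<integral>\<^sup>+x. S x \<partial>lborel)"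
    proof (rule nn_integral_cong_AE)
      show "AE x in lborel. ennreal (enn2real (S x)) = S x"
        using ae by eventually_elim (simp add: less_top)
    qed
    then show "(\<integral>\<^sup>+x. ennreal (enn2real (S x)) \<partial>lborel) < \<infinity>" using fin by simp
  qed auto
  define G where "G x = 2 powr s * (\<bar>f x\<bar> powr s + enn2real (S x))" for x
  have G: "integrable lborel G" unfolding G_def[abs_def]
    by (intro integrable_mult_right Bochner_Integration.integrable_add iS pow_integrableD F(2))
  have "AE x in lborel. \<bar>F n x\<bar> powr s \<le> G x" for n
    using ae
  proof eventually_elim
    fix x assume x: "S x \<noteq> \<infinity>"
    have "ennreal (\<bar>F n x - f x\<bar> powr s) \<le> S x"
    proof -
      have "(\<Sum>n\<in>{n}. ennreal (\<bar>F n x - f x\<bar> powr s)) \<le> S x"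
        unfolding S_def by (rule sum_le_suminf) auto
      then show ?thesis by simp
    qed
    also have "S x = ennreal (enn2real (S x))" using x by (simp add: less_top)
    finally have le: "\<bar>F n x - f x\<bar> powr s \<le> enn2real (S x)"
      by (rule ennreal_le_iff[THEN iffD1, rotated]) simp
    have "\<bar>F n x\<bar> powr s = \<bar>f x + (F n x - f x)\<bar> powr s" by simp
    also have "\<dots> \<le> 2 powr s * (\<bar>f x\<bar> powr s + \<bar>F n x - f x\<bar> powr s)"
      by (rule abs_powr_add_le) (use s in simp)
    also have "\<dots> \<le> G x" unfolding G_def by (intro mult_left_mono add_left_mono le) simp
    finally show "\<bar>F n x\<bar> powr s \<le> G x" .
  qed
  moreover have "AE x in lborel. (\<lambda>n. F n x) \<longlonglongrightarrow> f x"
    using ae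
  proof eventually_elim
    fix x assume x: "S x \<noteq> \<infinity>"
    then have "summable (\<lambda>n. \<bar>F n x - f x\<bar> powr s)"
      unfolding S_def by (intro summable_suminf_not_top) auto
    then have "(\<lambda>n. \<bar>F n x - f x\<bar> powr s) \<longlonglongrightarrow> 0" by (rule summable_LIMSEQ_zero)
    then have "(\<lambda>n. (\<bar>F n x - f x\<bar> powr s) powr (1 / s)) \<longlonglongrightarrow> 0 powr (1 / s)"
      by (rule tendsto_powr'[OF _ tendsto_const]) (use s in auto)
    then have "(\<lambda>n. \<bar>F n x - f x\<bar>) \<longlonglongrightarrow> 0" using s by (simp add: powr_powr)
    then have "(\<lambda>n. F n x - f x) \<longlonglongrightarrow> 0" by (rule tendsto_rabs_zero_cancel)
    then show "(\<lambda>n. F n x) \<longlonglongrightarrow> f x" by (simp add: LIM_zero_iff)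
  qed
  ultimately show ?thesis unfolding dominated_pow_def using G by auto
qed

text \<open>A common subsequence for finitely many sequences with different exponents, given as triples of
  exponent, sequence and limit: the indices are chosen so that all the errors are at most \<open>2\<^bsup>-n\<^esup>\<close>.\<close>

lemma dominated_subsequence:
  assumes "finite T" and T: "\<And>s F f. (s, F, f) \<in> T \<Longrightarrow> s \<ge> 1 \<and> converges_pow s F f"
  shows "\<exists>\<sigma>. \<forall>(s, F, f)\<in>T. dominated_pow s (\<lambda>n. F (\<sigma> n)) f"
proof -
  have "\<exists>k. \<forall>(s, F, f)\<in>T. (LINT x|lborel. \<bar>F k x - f x\<bar> powr s) \<le> (1 / 2) ^ n" for n :: nat
  proof -
    have "eventually (\<lambda>k. \<forall>t\<in>T. (LINT x|lborel. \<bar>(fst (snd t)) k x - (snd (snd t)) x\<bar> powr (fst t)) \<le> (1 / 2) ^ n) sequentially"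
    proof (rule eventually_ball_finite[OF assms(1)], rule ballI)
      fix t assume "t \<in> T"
      then have "(\<lambda>k. LINT x|lborel. \<bar>(fst (snd t)) k x - (snd (snd t)) x\<bar> powr (fst t)) \<longlonglongrightarrow> 0"
        using T[of "fst t" "fst (snd t)" "snd (snd t)"] unfolding converges_pow_def by simp
      from order_tendstoD(2)[OF this, of "(1 / 2) ^ n"]
      show "eventually (\<lambda>k. (LINT x|lborel. \<bar>(fst (snd t)) k x - (snd (snd t)) x\<bar> powr (fst t)) \<le> (1 / 2) ^ n) sequentially"
        by (auto elim: eventually_mono)
    qed
    then obtain k where "\<forall>t\<in>T. (LINT x|lborel. \<bar>(fst (snd t)) k x - (snd (snd t)) x\<bar> powr (fst t)) \<le> (1 / 2) ^ n"
      using eventually_happens'[OF sequentially_bot] by blast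
    then show ?thesis by (intro exI[of _ k]) (simp add: case_prod_beta)
  qed
  then have "\<forall>n. \<exists>k. \<forall>(s, F, f)\<in>T. (LINT x|lborel. \<bar>F k x - f x\<bar> powr s) \<le> (1 / 2) ^ n" by blast
  from choice[OF this] obtain \<sigma> where \<sigma>: "\<And>n. \<forall>(s, F, f)\<in>T. (LINT x|lborel. \<bar>F (\<sigma> n) x - f x\<bar> powr s) \<le> (1 / 2) ^ n"
    by blast
  have "dominated_pow s (\<lambda>n. F (\<sigma> n)) f" if t: "(s, F, f) \<in> T" for s F f
  proof (rule dominated_powI_fast)
    show "(LINT x|lborel. \<bar>F (\<sigma> n) x - f x\<bar> powr s) \<le> (1 / 2) ^ n" for n
      using \<sigma>[of n] t by blast
  qed (use T[OF t] in \<open>auto simp: converges_pow_def\<close>)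
  then show ?thesis by (intro exI[of _ \<sigma>]) auto
qed

lemma dominated_pow_bilinear:
  assumes F: "dominated_pow 2 F f" and G: "dominated_pow 2 G g"
    and k: "k \<in> borel_measurable borel" "\<And>x. \<bar>k x\<bar> \<le> C"
  shows "(\<lambda>n. LINT x|lborel. k x * (F n x * G n x)) \<longlonglongrightarrow> (LINT x|lborel. k x * (f x * g x))"
proof -
  obtain M where M: "integrable lborel M" "\<And>n. AE x in lborel. \<bar>F n x\<bar> powr 2 \<le> M x"
    using F unfolding dominated_pow_def by blast
  obtain L where L: "integrable lborel L" "\<And>n. AE x in lborel. \<bar>G n x\<bar> powr 2 \<le> L x"
    using G unfolding dominated_pow_def by blast
  have [measurable]: "F n \<in> borel_measurable borel" "G n \<in> borel_measurable borel"
      "f \<in> borel_measurable borel" "g \<in> borel_measurable borel" "k \<in> borel_measurable borel" for n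
    using F G k unfolding dominated_pow_def by blast+
  show ?thesis
  proof (rule integral_dominated_convergence)
    show "integrable lborel (\<lambda>x. C * (M x + L x))" using M L by auto
    show "AE x in lborel. (\<lambda>n. k x * (F n x * G n x)) \<longlonglongrightarrow> k x * (f x * g x)"
    proof -
      have "AE x in lborel. (\<lambda>n. F n x) \<longlonglongrightarrow> f x" "AE x in lborel. (\<lambda>n. G n x) \<longlonglongrightarrow> g x"
        using F G unfolding dominated_pow_def by blast+
      then show ?thesis by eventually_elim (intro tendsto_mult tendsto_const)
    qed
    show "AE x in lborel. norm (k x * (F n x * G n x)) \<le> C * (M x + L x)" for n
      using M(2)[of n] L(2)[of n]
    proof eventually_elim
      fix x assume 1: "\<bar>F n x\<bar> powr 2 \<le> M x" "\<bar>G n x\<bar> powr 2 \<le> L x"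
      have "2 * (\<bar>F n x\<bar> * \<bar>G n x\<bar>) \<le> \<bar>F n x\<bar>\<^sup>2 + \<bar>G n x\<bar>\<^sup>2"
        using sum_squares_bound[of "\<bar>F n x\<bar>" "\<bar>G n x\<bar>"] by simp
      also have "\<dots> \<le> M x + L x" using 1 by simp
      finally have "2 * (\<bar>F n x\<bar> * \<bar>G n x\<bar>) \<le> M x + L x" .
      moreover have "0 \<le> \<bar>F n x\<bar> * \<bar>G n x\<bar>" by simp
      ultimately have "\<bar>F n x\<bar> * \<bar>G n x\<bar> \<le> M x + L x" by linarith
      then show "norm (k x * (F n x * G n x)) \<le> C * (M x + L x)"
        using k(2)[of x] by (simp add: abs_mult) (intro mult_mono, auto)
    qed
  qed measurable
qed

text \<open>The pairing with \<open>F\<close> is only known to be finite on \<open>L\<^sup>r\<close>. This is enough: the \<open>r\<close>-th root of the majorant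
  lies in \<open>L\<^sup>r\<close>, hence its product with \<open>F\<close> is an integrable majorant.\<close>

lemma dominated_pow_functional:
  assumes \<psi>: "dominated_pow r \<psi> w" and r: "r \<ge> 1"
    and F: "F \<in> borel_measurable borel" "\<And>h. pow_integrable r h \<Longrightarrow> integrable lborel (\<lambda>x. F x * h x)"
  shows "(\<lambda>n. LINT x|lborel. F x * \<psi> n x) \<longlonglongrightarrow> (LINT x|lborel. F x * w x)"
proof -
  obtain G where G: "integrable lborel G" "\<And>n. AE x in lborel. \<bar>\<psi> n x\<bar> powr r \<le> G x"
    using \<psi> unfolding dominated_pow_def by blast
  have [measurable]: "\<psi> n \<in> borel_measurable borel" "w \<in> borel_measurable borel"
      "F \<in> borel_measurable borel" "G \<in> borel_measurable borel" for n
    using \<psi> F(1) borel_measurable_integrable[OF G(1)] unfolding dominated_pow_def by auto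
  \<comment> \<open>The absolute value matters only on a null set, as \<open>G\<close> bounds a nonnegative function.\<close>
  define h where "h x = \<bar>G x\<bar> powr (1 / r)" for x
  have [measurable]: "h \<in> borel_measurable borel" unfolding h_def[abs_def] by measurable
  have "pow_integrable r h"
    by (rule pow_integrable_bound[of "\<lambda>x. \<bar>G x\<bar>"]) (use G r in \<open>auto simp: h_def powr_powr\<close>)
  then have iFh: "integrable lborel (\<lambda>x. \<bar>F x * h x\<bar>)" by (intro integrable_abs F(2))
  show ?thesis
  proof (rule integral_dominated_convergence)
    show "integrable lborel (\<lambda>x. \<bar>F x * h x\<bar>)" by (rule iFh)
    have "AE x in lborel. (\<lambda>n. \<psi> n x) \<longlonglongrightarrow> w x" using \<psi> unfolding dominated_pow_def by blast
    then show "AE x in lborel. (\<lambda>n. F x * \<psi> n x) \<longlonglongrightarrow> F x * w x"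
      by eventually_elim (intro tendsto_mult tendsto_const)
    show "AE x in lborel. norm (F x * \<psi> n x) \<le> \<bar>F x * h x\<bar>" for n
      using G(2)[of n]
    proof eventually_elim
      fix x assume "\<bar>\<psi> n x\<bar> powr r \<le> G x"
      then have "(\<bar>\<psi> n x\<bar> powr r) powr (1 / r) \<le> \<bar>G x\<bar> powr (1 / r)"
        using r by (intro powr_mono2) auto
      then have "\<bar>\<psi> n x\<bar> \<le> h x" using r by (simp add: powr_powr h_def)
      then show "norm (F x * \<psi> n x) \<le> \<bar>F x * h x\<bar>"
        by (simp add: abs_mult) (intro mult_left_mono, auto)
    qed
  qed measurable
qed

subsection \<open>Uniqueness of weak derivatives\<close>

text \<open>All mollifications of \<open>h\<close> vanish, and inside a ball they agree with those of \<open>h\<close> cut off outside a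
  larger ball, which converge in \<open>L\<^sup>1\<close>.\<close>

lemma fundamental_lemma:
  fixes h :: "'a::euclidean_space \<Rightarrow> real"
  assumes h: "loc_integrable h" and 0: "\<And>\<phi>. \<phi> \<in> test_functions UNIV \<Longrightarrow> (LINT x|lborel. h x * \<phi> x) = 0"
  shows "AE x in lborel. h x = 0"
proof -
  obtain \<rho> :: "nat \<Rightarrow> 'a \<Rightarrow> real" where \<rho>: "mollifier \<rho>" using mollifier_exists by blast
  note [measurable] = loc_integrable_borel[OF h]
  have m0: "moll (\<rho> n) h x = 0" for n x
    using 0[OF test_function_reflect(1)[OF mollifierD(1)[OF \<rho>, of n], of x]] by (simp add: moll_def mult.commute)
  have "AE x in lborel. norm x \<le> real R \<longrightarrow> h x = 0" for R :: nat
  proof -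
    define k where "k x = indicator (cball 0 (real R + 1)) x * h x" for x
    have ik: "integrable lborel k" using h unfolding loc_integrable_def k_def by blast
    have k: "pow_integrable 1 k"
      using ik borel_measurable_integrable[OF ik] unfolding pow_integrable_def by simp
    have [measurable]: "k \<in> borel_measurable borel" by (rule pow_integrable_borel[OF k])
    let ?J = "LINT x|lborel. indicator (cball 0 (real R)) x * \<bar>k x\<bar>"
    have le: "?J \<le> (LINT x|lborel. \<bar>moll (\<rho> n) k x - k x\<bar> powr 1)" for n
    proof (rule integral_mono)
      have "integrable lborel (\<lambda>x. \<bar>k x\<bar>)" using ik by (rule integrable_abs)
      then show "integrable lborel (\<lambda>x. indicator (cball 0 (real R)) x * \<bar>k x\<bar>)"
        by (rule integrable_loc_integrable[unfolded loc_integrable_def, THEN conjunct2, THEN spec])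
      show "integrable lborel (\<lambda>x. \<bar>moll (\<rho> n) k x - k x\<bar> powr 1)"
        by (intro pow_integrableD pow_integrable_diff pow_integrable_moll[OF \<rho> k] k) auto
      fix x
      show "indicator (cball 0 (real R)) x * \<bar>k x\<bar> \<le> \<bar>moll (\<rho> n) k x - k x\<bar> powr 1"
      proof (cases "norm x \<le> real R")
        case True
        have "\<rho> n (x - y) * k y = \<rho> n (x - y) * h y" for y
        proof (cases "\<rho> n (x - y) = 0")
          case False
          from mollifierD(6)[OF \<rho> this] have "norm (x - y) \<le> 1 / real (Suc n)" .
          also have "\<dots> \<le> 1" by simp
          finally have "norm y \<le> real R + 1" using True norm_triangle_ineq4[of x "x - y"] by simp
          then show ?thesis by (simp add: k_def)
        qed simp
        then have "(\<lambda>y. \<rho> n (x - y) * k y) = (\<lambda>y. \<rho> n (x - y) * h y)" by (rule ext)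
        then have "moll (\<rho> n) k x = 0" using m0[of n x] unfolding moll_def by (simp only:)
        then show ?thesis by (simp add: indicator_def)
      qed simp
    qed
    have "(\<lambda>n. LINT x|lborel. \<bar>moll (\<rho> n) k x - k x\<bar> powr 1) \<longlonglongrightarrow> 0"
      using moll_converges_pow[OF \<rho> k] unfolding converges_pow_def by simp
    then have "?J \<le> 0" by (rule LIMSEQ_le_const) (use le in blast)
    moreover have "?J \<ge> 0" by simp
    ultimately have J: "?J = 0" by linarith
    have iJ: "integrable lborel (\<lambda>x. indicator (cball 0 (real R)) x * \<bar>k x\<bar>)"
      by (rule integrable_loc_integrable[OF integrable_abs[OF ik], unfolded loc_integrable_def, THEN conjunct2, THEN spec])
    from J have "AE x in lborel. indicator (cball 0 (real R)) x * \<bar>k x\<bar> = 0"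
      by (subst (asm) integral_nonneg_eq_0_iff_AE[OF iJ]) auto
    then show ?thesis by eventually_elim (auto simp: k_def indicator_def split: if_splits)
  qed
  then have "AE x in lborel. \<forall>R::nat. norm x \<le> real R \<longrightarrow> h x = 0"
    by (intro AE_all_countable[THEN iffD2] allI)
  then show ?thesis by eventually_elim (meson real_arch_simple)
qed

lemma weak_partial_unique:
  assumes A: "weak_partial b u A" and B: "weak_partial b u B" and b: "b \<in> Basis"
  shows "AE x in lborel. A x = B x"
proof -
  have l: "loc_integrable A" "loc_integrable B" using A B unfolding weak_partial_def by auto
  have "loc_integrable (\<lambda>x. A x - B x)"
    using l unfolding loc_integrable_def by (auto simp: right_diff_distrib)
  then have "AE x in lborel. A x - B x = 0"
  proof (rule fundamental_lemma)
    fix \<phi> :: "'a \<Rightarrow> real" assume \<phi>: "\<phi> \<in> test_functions UNIV"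
    have i: "integrable lborel (\<lambda>x. A x * \<phi> x)" "integrable lborel (\<lambda>x. B x * \<phi> x)"
      using integrable_bounded_support_mult[OF test_function_bounded_support[OF \<phi>]] l
      by (simp_all add: mult.commute)
    have "(LINT x|lborel. A x * \<phi> x) = (LINT x|lborel. B x * \<phi> x)"
      using A B \<phi> unfolding weak_partial_def by (metis neg_equal_iff_equal)
    then show "(LINT x|lborel. (A x - B x) * \<phi> x) = 0" using i by (simp add: left_diff_distrib)
  qed
  then show ?thesis by simp
qed

section \<open>Integration by parts along lines\<close>

text \<open>Differentiability along one direction is all that the integrations by parts use, and for it the product
  and chain rules are those of one real variable.\<close>

definition line_deriv :: "'a::euclidean_space \<Rightarrow> ('a \<Rightarrow> real) \<Rightarrow> ('a \<Rightarrow> real) \<Rightarrow> bool" where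
  "line_deriv b F G \<longleftrightarrow> (\<forall>x. ((\<lambda>t. F (x + t *\<^sub>R b)) has_real_derivative G x) (at 0))"

lemma line_derivD:
  assumes "line_deriv b F G"
  shows "((\<lambda>t. F (x + t *\<^sub>R b)) has_real_derivative G (x + t *\<^sub>R b)) (at t)"
proof -
  have "((\<lambda>s. F ((x + t *\<^sub>R b) + s *\<^sub>R b)) has_real_derivative G (x + t *\<^sub>R b)) (at 0)"
    using assms unfolding line_deriv_def by blast
  then have "((\<lambda>s. F (x + (s + t) *\<^sub>R b)) has_real_derivative G (x + t *\<^sub>R b)) (at 0)"
    by (simp add: scaleR_add_left add_ac)
  then show ?thesis
    using DERIV_shift[of "\<lambda>t. F (x + t *\<^sub>R b)" "G (x + t *\<^sub>R b)" 0 t] by simp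
qed

lemma line_deriv_unique: "line_deriv b F G \<Longrightarrow> line_deriv b F H \<Longrightarrow> G = H"
  unfolding line_deriv_def using DERIV_unique by blast

lemma line_deriv_sum:
  "(\<And>i. i \<in> I \<Longrightarrow> line_deriv b (F i) (F' i)) \<Longrightarrow> line_deriv b (\<lambda>x. \<Sum>i\<in>I. F i x) (\<lambda>x. \<Sum>i\<in>I. F' i x)"
  by (induction I rule: infinite_finite_induct) (auto simp: line_deriv_def intro!: derivative_eq_intros)

lemma line_deriv_mult:
  assumes "line_deriv b F F'" "line_deriv b G G'"
  shows "line_deriv b (\<lambda>x. F x * G x) (\<lambda>x. F' x * G x + F x * G' x)"
  unfolding line_deriv_def
proof
  fix x
  have "((\<lambda>t. F (x + t *\<^sub>R b)) has_real_derivative F' x) (at 0)"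
    "((\<lambda>t. G (x + t *\<^sub>R b)) has_real_derivative G' x) (at 0)"
    using assms unfolding line_deriv_def by auto
  from DERIV_mult[OF this]
  show "((\<lambda>t. F (x + t *\<^sub>R b) * G (x + t *\<^sub>R b)) has_real_derivative F' x * G x + F x * G' x) (at 0)"
    by (simp add: mult.commute add.commute)
qed

lemma smooth_line_deriv:
  assumes "smooth f" "b \<in> Basis"
  shows "line_deriv b f (partial_deriv b f)"
  unfolding line_deriv_def
proof
  fix x
  have "((\<lambda>t. x + t *\<^sub>R b) has_derivative (\<lambda>t. t *\<^sub>R b)) (at 0)" by (auto intro!: derivative_eq_intros)
  moreover have "(f has_derivative (\<lambda>h. \<Sum>d\<in>Basis. (h \<bullet> d) * partial_deriv d f x)) (at (x + 0 *\<^sub>R b))"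
    using smooth_has_derivative[OF assms(1), of x] by simp
  ultimately have "((\<lambda>t. f (x + t *\<^sub>R b)) has_derivative
      (\<lambda>t. \<Sum>d\<in>Basis. ((t *\<^sub>R b) \<bullet> d) * partial_deriv d f x)) (at 0)"
    by (rule has_derivative_compose)
  moreover have "(\<Sum>d\<in>Basis. ((t *\<^sub>R b) \<bullet> d) * partial_deriv d f x) = partial_deriv b f x * t" for t
  proof -
    have "(\<Sum>d\<in>Basis. ((t *\<^sub>R b) \<bullet> d) * partial_deriv d f x)
        = (\<Sum>d\<in>Basis. if d = b then partial_deriv d f x * t else 0)"
      by (intro sum.cong refl) (use assms(2) in \<open>auto simp: inner_Basis\<close>)
    then show ?thesis using assms(2) by simp
  qed
  ultimately show "((\<lambda>t. f (x + t *\<^sub>R b)) has_real_derivative partial_deriv b f x) (at 0)"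
    unfolding has_field_derivative_def by simp
qed

text \<open>The integral of a difference quotient vanishes by translation invariance. The mean value theorem
  bounds the quotients by the bound of \<open>G\<close>, on a fixed ball.\<close>

lemma integral_line_deriv_zero:
  fixes F :: "'a::euclidean_space \<Rightarrow> real"
  assumes F: "bounded_support F" and G: "bounded_support G" and d: "line_deriv b F G"
  shows "(LINT x|lborel. G x) = 0"
proof -
  note [measurable] = bounded_support_borel[OF F] bounded_support_borel[OF G]
  obtain R where R: "R > 0" "\<And>x. R < norm x \<Longrightarrow> F x = 0"
    using F by (rule bounded_supportE) blast
  obtain C where C: "C > 0" "\<And>x. \<bar>G x\<bar> \<le> C"
    using G by (rule bounded_supportE) blast
  define t where "t n = 1 / real (Suc n)" for n
  have t: "t n > 0" "t n \<le> 1" for n by (auto simp: t_def)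
  have t0: "t \<longlonglongrightarrow> 0"
    unfolding t_def using LIMSEQ_inverse_real_of_nat by (simp only: inverse_eq_divide)
  define q where "q n x = (F (x + t n *\<^sub>R b) - F x) / t n" for n x
  have [measurable]: "q n \<in> borel_measurable borel" for n unfolding q_def[abs_def] by measurable
  have iF: "integrable lborel F" by (rule bounded_support_integrable[OF F])
  have shift: "integrable lborel (\<lambda>x. F (x + v))" "(LINT x|lborel. F (x + v)) = (LINT x|lborel. F x)" for v
    using integrable_translate[OF iF, of "- v"] integral_translate[of F "- v"] by simp_all
  have q0: "(LINT x|lborel. q n x) = 0" for n
    unfolding q_def using shift[of "t n *\<^sub>R b"] iF by simp
  have "(\<lambda>n. LINT x|lborel. q n x) \<longlonglongrightarrow> (LINT x|lborel. G x)"
  proof (rule integral_dominated_convergence)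
    show "integrable lborel (\<lambda>x::'a. C * indicator (cball 0 (R + norm b)) x)"
      using emeasure_bounded_finite[of "cball (0::'a) (R + norm b)"]
      by (intro integrable_mult_right integrable_real_indicator) auto
    show "AE x in lborel. (\<lambda>n. q n x) \<longlonglongrightarrow> G x"
    proof (rule AE_I2)
      fix x
      have "((\<lambda>h. (F (x + (0 + h) *\<^sub>R b) - F (x + 0 *\<^sub>R b)) / h) \<longlongrightarrow> G x) (at 0)"
        using d unfolding line_deriv_def DERIV_def by blast
      moreover have "filterlim t (at 0) sequentially"
        unfolding filterlim_at using t0 t(1) by (auto simp: less_imp_neq[symmetric])
      ultimately have "(\<lambda>n. (F (x + (0 + t n) *\<^sub>R b) - F (x + 0 *\<^sub>R b)) / t n) \<longlonglongrightarrow> G x"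
        by (rule filterlim_compose)
      then show "(\<lambda>n. q n x) \<longlonglongrightarrow> G x" by (simp add: q_def)
    qed
    show "AE x in lborel. norm (q n x) \<le> C * indicator (cball 0 (R + norm b)) x" for n
    proof (rule AE_I2)
      fix x
      show "norm (q n x) \<le> C * indicator (cball 0 (R + norm b)) x"
      proof (cases "norm x \<le> R + norm b")
        case True
        have "\<exists>z. 0 < z \<and> z < t n \<and> F (x + t n *\<^sub>R b) - F (x + 0 *\<^sub>R b) = (t n - 0) * G (x + z *\<^sub>R b)"
          by (rule MVT2) (use t(1) line_derivD[OF d] in auto)
        then obtain z where "F (x + t n *\<^sub>R b) - F x = t n * G (x + z *\<^sub>R b)" by auto
        then have "q n x = G (x + z *\<^sub>R b)" using t(1)[of n] by (simp add: q_def)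
        then show ?thesis using True C(2) by simp
      next
        case False
        have "norm x \<le> norm (x + t n *\<^sub>R b) + norm (t n *\<^sub>R b)"
          using norm_triangle_ineq4[of "x + t n *\<^sub>R b" "t n *\<^sub>R b"] by simp
        moreover have "norm (t n *\<^sub>R b) \<le> norm b" using t[of n] by (simp add: mult_left_le_one_le)
        ultimately have "R < norm (x + t n *\<^sub>R b)" using False by linarith
        moreover have "R < norm x" using False norm_ge_zero[of b] by linarith
        ultimately have "q n x = 0" by (simp add: q_def R(2))
        then show ?thesis using False by simp
      qed
    qed
  qed measurable
  then have "(\<lambda>n. 0::real) \<longlonglongrightarrow> (LINT x|lborel. G x)" by (simp add: q0)
  then show ?thesis using LIMSEQ_unique tendsto_const by blast
qed

lemma bounded_support_loc_integrable: "bounded_support F \<Longrightarrow> loc_integrable F"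
  by (intro loc_integrable_locally_bounded bounded_support_locally_bounded)

lemma weak_partial_line_deriv:
  assumes W: "bounded_support W" and W': "bounded_support W'" and d: "line_deriv b W W'" and b: "b \<in> Basis"
  shows "weak_partial b W W'"
  unfolding weak_partial_def
proof (intro conjI ballI)
  fix \<phi> :: "'a \<Rightarrow> real" assume \<phi>: "\<phi> \<in> test_functions UNIV"
  then have s: "smooth \<phi>" unfolding test_functions_UNIV by blast
  note l\<phi> = bounded_support_locally_bounded[OF test_function_bounded_support[OF \<phi>]]
  note ld = bounded_support_locally_bounded[OF test_function_bounded_support[OF test_function_partial[OF \<phi> b]]]
  have bs: "bounded_support (\<lambda>x. W' x * \<phi> x)" "bounded_support (\<lambda>x. W x * partial_deriv b \<phi> x)"
    "bounded_support (\<lambda>x. W x * \<phi> x)"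
    by (intro bounded_support_mult W W' l\<phi> ld)+
  have "(LINT x|lborel. W' x * \<phi> x + W x * partial_deriv b \<phi> x) = 0"
    by (rule integral_line_deriv_zero[OF bs(3) bounded_support_add[OF bs(1,2)]
          line_deriv_mult[OF d smooth_line_deriv[OF s b]]])
  then show "(LINT x|lborel. W x * partial_deriv b \<phi> x) = - (LINT x|lborel. W' x * \<phi> x)"
    using bounded_support_integrable[OF bs(1)] bounded_support_integrable[OF bs(2)] by simp
qed (intro bounded_support_loc_integrable W W')+

lemma moll_line_deriv:
  assumes "\<phi> \<in> test_functions UNIV" "loc_integrable h" "b \<in> Basis"
  shows "line_deriv b (moll \<phi> h) (moll (partial_deriv b \<phi>) h)"
  using smooth_line_deriv[OF smooth_moll[OF assms(1,2)] assms(3)] partial_deriv_moll[OF assms] by simp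

lemma moll_line_deriv_weak:
  assumes "weak_partial b u A" "\<phi> \<in> test_functions UNIV" "b \<in> Basis"
  shows "line_deriv b (moll \<phi> u) (moll \<phi> A)"
proof -
  have "loc_integrable u" using assms(1) unfolding weak_partial_def by blast
  from moll_line_deriv[OF assms(2) this assms(3)] show ?thesis by (simp add: moll_weak_partial[OF assms])
qed

text \<open>Both sides are the derivative of \<open>\<phi> * B\<close> in the direction \<open>b\<close>, since \<open>\<phi> * B\<close> is also the convolution of
  \<open>u\<close> with the derivative of \<open>\<phi>\<close> in the direction \<open>c\<close>. So the second derivatives of a mollified function commute.\<close>

lemma moll_weak_partial_symmetric:
  assumes A: "weak_partial b u A" and B: "weak_partial c u B" and \<phi>: "\<phi> \<in> test_functions UNIV"
    and b: "b \<in> Basis" and c: "c \<in> Basis"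
  shows "moll (partial_deriv c \<phi>) A = moll (partial_deriv b \<phi>) B"
proof -
  have l: "loc_integrable B" using B unfolding weak_partial_def by blast
  have "line_deriv b (moll (partial_deriv c \<phi>) u) (moll (partial_deriv c \<phi>) A)"
    by (rule moll_line_deriv_weak[OF A test_function_partial[OF \<phi> c] b])
  then have "line_deriv b (moll \<phi> B) (moll (partial_deriv c \<phi>) A)"
    by (simp add: moll_weak_partial[OF B \<phi> c])
  from line_deriv_unique[OF this moll_line_deriv[OF \<phi> l b]] show ?thesis .
qed

section \<open>The equation tested with mollified functions\<close>

text \<open>The test function is the mollification of \<open>W\<close>; symmetry of the mollification moves it onto \<open>u\<close> and its
  derivatives on the left. On the right it stays where it is, because nothing is known about
  mollifications of \<open>F\<close>.\<close>

lemma mollified_equation: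
  assumes \<rho>: "mollifier \<rho>"
    and u: "\<And>b. b \<in> Basis \<Longrightarrow> weak_partial b u (A b)" "loc_integrable u"
    and eq: "\<And>\<phi>. \<phi> \<in> test_functions UNIV \<Longrightarrow>
      (LINT x|lborel. (\<Sum>b\<in>Basis. A b x * partial_deriv b \<phi> x) + u x * \<phi> x) = (LINT x|lborel. F x * \<phi> x)"
    and W: "bounded_support W" "\<And>b. b \<in> Basis \<Longrightarrow> bounded_support (W' b)"
      "\<And>b. b \<in> Basis \<Longrightarrow> line_deriv b W (W' b)"
  shows "(\<Sum>b\<in>Basis. LINT x|lborel. moll (\<rho> n) (A b) x * W' b x) + (LINT x|lborel. moll (\<rho> n) u x * W x)
    = (LINT x|lborel. F x * moll (\<rho> n) W x)"
proof -
  note t = mollifierD(1)[OF \<rho>, of n] and bs = mollifierD(5)[OF \<rho>, of n] and ev = mollifierD(3)[OF \<rho>, of n]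
  have A: "loc_integrable (A b)" if "b \<in> Basis" for b using u(1)[OF that] unfolding weak_partial_def by blast
  have p: "partial_deriv b (moll (\<rho> n) W) = moll (\<rho> n) (W' b)" if "b \<in> Basis" for b
    using partial_deriv_moll[OF t bounded_support_loc_integrable[OF W(1)] that]
      moll_weak_partial[OF weak_partial_line_deriv[OF W(1) W(2)[OF that] W(3)[OF that] that] t that] by simp
  have "(LINT x|lborel. F x * moll (\<rho> n) W x)
      = (LINT x|lborel. (\<Sum>b\<in>Basis. A b x * moll (\<rho> n) (W' b) x) + u x * moll (\<rho> n) W x)"
    using eq[OF test_function_moll[OF t W(1)]] by (simp add: p)
  also have "\<dots> = (\<Sum>b\<in>Basis. LINT x|lborel. A b x * moll (\<rho> n) (W' b) x) + (LINT x|lborel. u x * moll (\<rho> n) W x)"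
    using moll_adjoint(2)[OF bs ev A W(2)] moll_adjoint(2)[OF bs ev u(2) W(1)]
    by (subst Bochner_Integration.integral_add) (auto intro!: Bochner_Integration.integral_sum)
  also have "\<dots> = (\<Sum>b\<in>Basis. LINT x|lborel. moll (\<rho> n) (A b) x * W' b x) + (LINT x|lborel. moll (\<rho> n) u x * W x)"
    using moll_adjoint(1)[OF bs ev A W(2)] moll_adjoint(1)[OF bs ev u(2) W(1)] by simp
  finally show ?thesis by simp
qed

text \<open>With \<open>U = \<rho> * u\<close>, \<open>P = \<nabla>U\<close> and \<open>W = X \<bullet> P\<close>, the derivatives of \<open>P\<close> occur only in the combination
  \<open>P\<^sub>b X\<^sub>c \<partial>\<^sub>b P\<^sub>c = X\<^sub>c \<partial>\<^sub>c (P\<^sub>b\<^sup>2) / 2\<close>, by symmetry of the second derivatives; another integration by parts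
  removes them.\<close>

lemma mollified_pohozaev:
  fixes u :: "'a::euclidean_space \<Rightarrow> real" and n :: nat
  assumes \<rho>: "mollifier \<rho>"
    and u: "\<And>b. b \<in> Basis \<Longrightarrow> weak_partial b u (A b)" "loc_integrable u"
    and eq: "\<And>\<phi>. \<phi> \<in> test_functions UNIV \<Longrightarrow>
      (LINT x|lborel. (\<Sum>b\<in>Basis. A b x * partial_deriv b \<phi> x) + u x * \<phi> x) = (LINT x|lborel. F x * \<phi> x)"
    and X: "\<And>c. c \<in> Basis \<Longrightarrow> bounded_support (X c)"
      "\<And>b c. b \<in> Basis \<Longrightarrow> c \<in> Basis \<Longrightarrow> bounded_support (X' b c)"
      "\<And>b c. b \<in> Basis \<Longrightarrow> c \<in> Basis \<Longrightarrow> line_deriv b (X c) (X' b c)"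
  defines "P \<equiv> \<lambda>b. moll (\<rho> n) (A b)" and "U \<equiv> moll (\<rho> n) u"
  shows "(LINT x|lborel. F x * moll (\<rho> n) (\<lambda>x. \<Sum>c\<in>Basis. X c x * P c x) x)
    = (\<Sum>b\<in>Basis. \<Sum>c\<in>Basis. (LINT x|lborel. X' b c x * (P b x * P c x))
        - (LINT x|lborel. X' c c x * (P b x * P b x)) / 2)
      - (\<Sum>c\<in>Basis. (LINT x|lborel. X' c c x * (U x * U x)) / 2)"
proof -
  note t = mollifierD(1)[OF \<rho>, of n] and bs = mollifierD(5)[OF \<rho>, of n]
  have A: "loc_integrable (A b)" if "b \<in> Basis" for b using u(1)[OF that] unfolding weak_partial_def by blast
  define Q where "Q b c = moll (partial_deriv c (\<rho> n)) (A b)" for b c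
  have lU: "locally_bounded U" unfolding U_def by (rule moll_locally_bounded[OF bs u(2)])
  have lP: "locally_bounded (P b)" if "b \<in> Basis" for b
    unfolding P_def by (rule moll_locally_bounded[OF bs A[OF that]])
  have lQ: "locally_bounded (Q b c)" if "b \<in> Basis" "c \<in> Basis" for b c
    unfolding Q_def
    by (rule moll_locally_bounded[OF test_function_bounded_support[OF test_function_partial[OF t that(2)]] A[OF that(1)]])
  have dU: "line_deriv b U (P b)" if "b \<in> Basis" for b
    unfolding U_def P_def by (rule moll_line_deriv_weak[OF u(1)[OF that] t that])
  have dP: "line_deriv c (P b) (Q b c)" if "b \<in> Basis" "c \<in> Basis" for b c
    unfolding P_def Q_def by (rule moll_line_deriv[OF t A[OF that(1)] that(2)])
  have sym: "Q b c = Q c b" if "b \<in> Basis" "c \<in> Basis" for b c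
    unfolding Q_def by (rule moll_weak_partial_symmetric[OF u(1)[OF that(1)] u(1)[OF that(2)] t that])
  define W where "W x = (\<Sum>c\<in>Basis. X c x * P c x)" for x
  define W' where "W' b x = (\<Sum>c\<in>Basis. X' b c x * P c x + X c x * Q c b x)" for b x
  have W: "bounded_support W" unfolding W_def[abs_def] by (intro bounded_support_sum bounded_support_mult X lP)
  have W': "bounded_support (W' b)" if "b \<in> Basis" for b
    unfolding W'_def[abs_def]
    by (intro bounded_support_sum bounded_support_add bounded_support_mult X lP lQ that)
  have dW: "line_deriv b W (W' b)" if "b \<in> Basis" for b
    unfolding W_def[abs_def] W'_def[abs_def] by (intro line_deriv_sum line_deriv_mult X dP that)
  \<comment> \<open>The derivative \<open>W' b\<close> is written with \<open>Q c b = \<partial>\<^sub>b P\<^sub>c\<close>; by symmetry this is \<open>\<partial>\<^sub>c P\<^sub>b\<close>.\<close>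
  have key: "(\<Sum>b\<in>Basis. LINT x|lborel. P b x * W' b x) + (LINT x|lborel. U x * W x)
      = (LINT x|lborel. F x * moll (\<rho> n) W x)"
    unfolding P_def U_def by (rule mollified_equation[OF \<rho> u eq W W' dW])
  have parts: "(LINT x|lborel. X c x * (V x * V' x)) = - (LINT x|lborel. X' c c x * (V x * V x)) / 2"
    if c: "c \<in> Basis" and V: "locally_bounded V" "locally_bounded V'" "line_deriv c V V'" for c V V'
  proof -
    have b1: "bounded_support (\<lambda>x. X' c c x * (V x * V x))" "bounded_support (\<lambda>x. X c x * (V' x * V x + V x * V' x))"
      "bounded_support (\<lambda>x. X c x * (V x * V x))"
      by (intro bounded_support_mult locally_bounded_mult locally_bounded_add X V c)+
    have "(LINT x|lborel. X' c c x * (V x * V x) + X c x * (V' x * V x + V x * V' x)) = 0"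
      by (rule integral_line_deriv_zero[OF b1(3) bounded_support_add[OF b1(1,2)]
            line_deriv_mult[OF X(3)[OF c c] line_deriv_mult[OF V(3) V(3)]]])
    moreover have "(LINT x|lborel. X' c c x * (V x * V x) + X c x * (V' x * V x + V x * V' x))
        = (LINT x|lborel. X' c c x * (V x * V x)) + (LINT x|lborel. X c x * (V' x * V x + V x * V' x))"
      using bounded_support_integrable[OF b1(1)] bounded_support_integrable[OF b1(2)] by simp
    moreover have "(LINT x|lborel. X c x * (V' x * V x + V x * V' x)) = 2 * (LINT x|lborel. X c x * (V x * V' x))"
      by (subst integral_mult_right_zero[symmetric]) (simp add: algebra_simps)
    ultimately show ?thesis by simp
  qed
  have 1: "(LINT x|lborel. P b x * W' b x)
      = (\<Sum>c\<in>Basis. (LINT x|lborel. X' b c x * (P b x * P c x)) - (LINT x|lborel. X' c c x * (P b x * P b x)) / 2)"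
    if b: "b \<in> Basis" for b
  proof -
    have i1: "integrable lborel (\<lambda>x. X' b c x * (P b x * P c x))" if "c \<in> Basis" for c
      by (intro bounded_support_integrable bounded_support_mult locally_bounded_mult X lP b that)
    have i2: "integrable lborel (\<lambda>x. X c x * (P b x * Q b c x))" if "c \<in> Basis" for c
      by (intro bounded_support_integrable bounded_support_mult locally_bounded_mult X lP lQ b that)
    have "(LINT x|lborel. P b x * W' b x)
        = (LINT x|lborel. (\<Sum>c\<in>Basis. X' b c x * (P b x * P c x) + X c x * (P b x * Q b c x)))"
    proof (rule Bochner_Integration.integral_cong[OF refl])
      fix x
      show "P b x * W' b x = (\<Sum>c\<in>Basis. X' b c x * (P b x * P c x) + X c x * (P b x * Q b c x))"
        unfolding W'_def sum_distrib_left
        by (intro sum.cong refl) (simp add: sym[OF b] algebra_simps)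
    qed
    also have "\<dots> = (\<Sum>c\<in>Basis. LINT x|lborel. X' b c x * (P b x * P c x) + X c x * (P b x * Q b c x))"
      by (intro Bochner_Integration.integral_sum Bochner_Integration.integrable_add i1 i2)
    also have "\<dots> = (\<Sum>c\<in>Basis. (LINT x|lborel. X' b c x * (P b x * P c x)) - (LINT x|lborel. X' c c x * (P b x * P b x)) / 2)"
    proof (intro sum.cong refl)
      fix c :: 'a assume c: "c \<in> Basis"
      show "(LINT x|lborel. X' b c x * (P b x * P c x) + X c x * (P b x * Q b c x))
        = (LINT x|lborel. X' b c x * (P b x * P c x)) - (LINT x|lborel. X' c c x * (P b x * P b x)) / 2"
        using parts[OF c lP[OF b] lQ[OF b c] dP[OF b c]]
        by (simp add: Bochner_Integration.integral_add[OF i1[OF c] i2[OF c]])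
    qed
    finally show ?thesis .
  qed
  have 2: "(LINT x|lborel. U x * W x) = - (\<Sum>c\<in>Basis. (LINT x|lborel. X' c c x * (U x * U x)) / 2)"
  proof -
    have i: "integrable lborel (\<lambda>x. X c x * (U x * P c x))" if "c \<in> Basis" for c
      by (intro bounded_support_integrable bounded_support_mult locally_bounded_mult X lP lU that)
    have "(LINT x|lborel. U x * W x) = (LINT x|lborel. (\<Sum>c\<in>Basis. X c x * (U x * P c x)))"
      unfolding W_def sum_distrib_left
      by (intro Bochner_Integration.integral_cong refl sum.cong) (simp add: algebra_simps)
    also have "\<dots> = (\<Sum>c\<in>Basis. LINT x|lborel. X c x * (U x * P c x))"
      by (intro Bochner_Integration.integral_sum i)
    also have "\<dots> = (\<Sum>c\<in>Basis. - ((LINT x|lborel. X' c c x * (U x * U x)) / 2))"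
      by (intro sum.cong refl) (simp add: parts[OF _ lU lP dU])
    finally show ?thesis by (simp add: sum_negf)
  qed
  show ?thesis
    using key 1 2 by (simp add: W_def[abs_def])
qed

text \<open>The mollification is removed: on the left of \<open>mollified_pohozaev\<close> by convergence in \<open>L\<^sup>r\<close>, on the right by
  convergence in \<open>L\<^sup>2\<close>.\<close>

lemma pohozaev_half:
  fixes u :: "'a::euclidean_space \<Rightarrow> real"
  assumes r: "r \<ge> 1"
    and u: "\<And>b. b \<in> Basis \<Longrightarrow> weak_partial b u (A b)"
    and u2: "pow_integrable 2 u" and A2: "\<And>b. b \<in> Basis \<Longrightarrow> pow_integrable 2 (A b)"
    and Ar: "\<And>b. b \<in> Basis \<Longrightarrow> pow_integrable r (A b)"
    and eq: "\<And>\<phi>. \<phi> \<in> test_functions UNIV \<Longrightarrow>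
      (LINT x|lborel. (\<Sum>b\<in>Basis. A b x * partial_deriv b \<phi> x) + u x * \<phi> x) = (LINT x|lborel. F x * \<phi> x)"
    and F: "F \<in> borel_measurable borel" "\<And>h. pow_integrable r h \<Longrightarrow> integrable lborel (\<lambda>x. F x * h x)"
    and X: "\<And>c. c \<in> Basis \<Longrightarrow> bounded_support (X c)"
      "\<And>b c. b \<in> Basis \<Longrightarrow> c \<in> Basis \<Longrightarrow> bounded_support (X' b c)"
      "\<And>b c. b \<in> Basis \<Longrightarrow> c \<in> Basis \<Longrightarrow> line_deriv b (X c) (X' b c)"
  shows "(LINT x|lborel. F x * (\<Sum>c\<in>Basis. X c x * A c x))
    = (\<Sum>b\<in>Basis. \<Sum>c\<in>Basis. (LINT x|lborel. X' b c x * (A b x * A c x))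
        - (LINT x|lborel. X' c c x * (A b x * A b x)) / 2)
      - (\<Sum>c\<in>Basis. (LINT x|lborel. X' c c x * (u x * u x)) / 2)"
proof -
  obtain \<rho> :: "nat \<Rightarrow> 'a \<Rightarrow> real" where \<rho>: "mollifier \<rho>" using mollifier_exists by blast
  have lu: "loc_integrable u" using pow_integrable_loc_integrable[OF u2] by simp
  define P where "P n b = moll (\<rho> n) (A b)" for n b
  define U where "U n = moll (\<rho> n) u" for n
  define \<psi> where "\<psi> n = moll (\<rho> n) (\<lambda>x. \<Sum>c\<in>Basis. X c x * P n c x)" for n
  define w where "w x = (\<Sum>c\<in>Basis. X c x * A c x)" for x
  have Xb: "\<exists>C. \<forall>x. \<bar>X c x\<bar> \<le> C" if "c \<in> Basis" for c
    using X(1)[OF that] unfolding bounded_support_def by blast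
  have step: "(LINT x|lborel. F x * \<psi> n x)
    = (\<Sum>b\<in>Basis. \<Sum>c\<in>Basis. (LINT x|lborel. X' b c x * (P n b x * P n c x))
        - (LINT x|lborel. X' c c x * (P n b x * P n b x)) / 2)
      - (\<Sum>c\<in>Basis. (LINT x|lborel. X' c c x * (U n x * U n x)) / 2)" for n
    unfolding \<psi>_def P_def U_def by (rule mollified_pohozaev[OF \<rho> u lu eq X])
  have cP: "converges_pow s (\<lambda>n. P n b) (A b)" if "b \<in> Basis" "pow_integrable s (A b)" "s \<ge> 1" for s b
    unfolding P_def by (rule moll_converges_pow[OF \<rho> that(2,3)])
  have cU: "converges_pow 2 U u" unfolding U_def by (rule moll_converges_pow[OF \<rho> u2]) simp
  have c\<psi>: "converges_pow r \<psi> w"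
    unfolding \<psi>_def w_def[abs_def]
  proof (rule moll_diagonal_converges_pow[OF \<rho> _ r], rule converges_pow_sum)
    fix c :: 'a assume c: "c \<in> Basis"
    obtain C where "\<And>x. \<bar>X c x\<bar> \<le> C" using Xb[OF c] by blast
    then show "converges_pow r (\<lambda>n x. X c x * P n c x) (\<lambda>x. X c x * A c x)"
      using r by (intro converges_pow_bounded_mult[OF cP] c Ar bounded_support_borel[OF X(1)]) auto
  qed (use r in auto)
  define T where "T = insert (r, \<psi>, w) (insert (2, U, u) ((\<lambda>b. (2, \<lambda>n. P n b, A b)) ` Basis))"
  have "\<exists>\<sigma>. \<forall>(s, F, f)\<in>T. dominated_pow s (\<lambda>n. F (\<sigma> n)) f"
  proof (rule dominated_subsequence)
    show "finite T" by (simp add: T_def)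
    show "s \<ge> 1 \<and> converges_pow s F f" if "(s, F, f) \<in> T" for s F f
      using that r c\<psi> cU cP[OF _ A2] unfolding T_def by auto
  qed
  then obtain \<sigma> where \<sigma>: "\<forall>(s, F, f)\<in>T. dominated_pow s (\<lambda>n. F (\<sigma> n)) f" by blast
  have d\<psi>: "dominated_pow r (\<lambda>n. \<psi> (\<sigma> n)) w" and dU: "dominated_pow 2 (\<lambda>n. U (\<sigma> n)) u"
    and dP: "\<And>b. b \<in> Basis \<Longrightarrow> dominated_pow 2 (\<lambda>n. P (\<sigma> n) b) (A b)"
    using \<sigma> unfolding T_def by auto
  have lim1: "(\<lambda>n. LINT x|lborel. F x * \<psi> (\<sigma> n) x) \<longlonglongrightarrow> (LINT x|lborel. F x * w x)"
    by (rule dominated_pow_functional[OF d\<psi> r F])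
  have bil: "(\<lambda>n. LINT x|lborel. X' b c x * (G n x * H n x)) \<longlonglongrightarrow> (LINT x|lborel. X' b c x * (g x * h x))"
    if t: "dominated_pow 2 G g" "dominated_pow 2 H h" "b \<in> Basis" "c \<in> Basis" for b c G g H h
  proof -
    obtain C where "\<And>x. \<bar>X' b c x\<bar> \<le> C" using X(2)[OF t(3,4)] unfolding bounded_support_def by blast
    then show ?thesis by (rule dominated_pow_bilinear[OF t(1,2) bounded_support_borel[OF X(2)[OF t(3,4)]]])
  qed
  have "(\<lambda>n. LINT x|lborel. F x * \<psi> (\<sigma> n) x) \<longlonglongrightarrow>
    (\<Sum>b\<in>Basis. \<Sum>c\<in>Basis. (LINT x|lborel. X' b c x * (A b x * A c x))
        - (LINT x|lborel. X' c c x * (A b x * A b x)) / 2)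
      - (\<Sum>c\<in>Basis. (LINT x|lborel. X' c c x * (u x * u x)) / 2)"
    unfolding step
    by (intro tendsto_diff tendsto_sum tendsto_divide tendsto_const bil dP dU) auto
  from LIMSEQ_unique[OF lim1 this] show ?thesis unfolding w_def .
qed

text \<open>The same passage to the limit for the test function \<open>\<eta> u\<close>.\<close>

lemma energy_half:
  fixes u :: "'a::euclidean_space \<Rightarrow> real"
  assumes r: "r \<ge> 1"
    and u: "\<And>b. b \<in> Basis \<Longrightarrow> weak_partial b u (A b)"
    and u2: "pow_integrable 2 u" and A2: "\<And>b. b \<in> Basis \<Longrightarrow> pow_integrable 2 (A b)"
    and ur: "pow_integrable r u"
    and eq: "\<And>\<phi>. \<phi> \<in> test_functions UNIV \<Longrightarrow>
      (LINT x|lborel. (\<Sum>b\<in>Basis. A b x * partial_deriv b \<phi> x) + u x * \<phi> x) = (LINT x|lborel. F x * \<phi> x)"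
    and F: "F \<in> borel_measurable borel" "\<And>h. pow_integrable r h \<Longrightarrow> integrable lborel (\<lambda>x. F x * h x)"
    and \<eta>: "bounded_support \<eta>" "\<And>b. b \<in> Basis \<Longrightarrow> bounded_support (\<eta>' b)"
      "\<And>b. b \<in> Basis \<Longrightarrow> line_deriv b \<eta> (\<eta>' b)"
  shows "(LINT x|lborel. F x * (\<eta> x * u x))
    = (\<Sum>b\<in>Basis. (LINT x|lborel. \<eta>' b x * (A b x * u x)) + (LINT x|lborel. \<eta> x * (A b x * A b x)))
      + (LINT x|lborel. \<eta> x * (u x * u x))"
proof -
  obtain \<rho> :: "nat \<Rightarrow> 'a \<Rightarrow> real" where \<rho>: "mollifier \<rho>" using mollifier_exists by blast
  have lu: "loc_integrable u" using pow_integrable_loc_integrable[OF u2] by simp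
  have A: "loc_integrable (A b)" if "b \<in> Basis" for b using u(1)[OF that] unfolding weak_partial_def by blast
  define P where "P n b = moll (\<rho> n) (A b)" for n b
  define U where "U n = moll (\<rho> n) u" for n
  define W where "W n x = \<eta> x * U n x" for n x
  define \<psi> where "\<psi> n = moll (\<rho> n) (W n)" for n
  obtain C where C: "\<And>x. \<bar>\<eta> x\<bar> \<le> C" using \<eta>(1) unfolding bounded_support_def by blast
  have lU: "locally_bounded (U n)" for n
    unfolding U_def by (rule moll_locally_bounded[OF mollifierD(5)[OF \<rho>] lu])
  have lP: "locally_bounded (P n b)" if "b \<in> Basis" for n b
    unfolding P_def by (rule moll_locally_bounded[OF mollifierD(5)[OF \<rho>] A[OF that]])
  have dU: "line_deriv b (U n) (P n b)" if "b \<in> Basis" for n b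
    unfolding U_def P_def by (rule moll_line_deriv_weak[OF u(1)[OF that] mollifierD(1)[OF \<rho>] that])
  have step: "(LINT x|lborel. F x * \<psi> n x)
    = (\<Sum>b\<in>Basis. (LINT x|lborel. \<eta>' b x * (P n b x * U n x)) + (LINT x|lborel. \<eta> x * (P n b x * P n b x)))
      + (LINT x|lborel. \<eta> x * (U n x * U n x))" for n
  proof -
    have "(\<Sum>b\<in>Basis. LINT x|lborel. P n b x * (\<eta>' b x * U n x + \<eta> x * P n b x)) + (LINT x|lborel. U n x * W n x)
      = (LINT x|lborel. F x * moll (\<rho> n) (W n) x)"
      unfolding P_def U_def
    proof (rule mollified_equation[OF \<rho> u lu eq])
      show "bounded_support (W n)" unfolding W_def by (intro bounded_support_mult \<eta> lU)
      show "bounded_support (\<lambda>x. \<eta>' b x * moll (\<rho> n) u x + \<eta> x * moll (\<rho> n) (A b) x)" if "b \<in> Basis" for b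
        unfolding U_def[symmetric] P_def[symmetric]
        by (intro bounded_support_add bounded_support_mult \<eta> lU lP that)
      show "line_deriv b (W n) (\<lambda>x. \<eta>' b x * moll (\<rho> n) u x + \<eta> x * moll (\<rho> n) (A b) x)" if "b \<in> Basis" for b
        unfolding U_def[symmetric] P_def[symmetric] W_def
        by (intro line_deriv_mult \<eta> dU that)
    qed
    moreover have "(LINT x|lborel. P n b x * (\<eta>' b x * U n x + \<eta> x * P n b x))
        = (LINT x|lborel. \<eta>' b x * (P n b x * U n x)) + (LINT x|lborel. \<eta> x * (P n b x * P n b x))"
      if b: "b \<in> Basis" for b
    proof -
      have i: "integrable lborel (\<lambda>x. \<eta>' b x * (P n b x * U n x))" "integrable lborel (\<lambda>x. \<eta> x * (P n b x * P n b x))"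
        by (intro bounded_support_integrable bounded_support_mult locally_bounded_mult \<eta> lP lU b)+
      show ?thesis
        by (subst Bochner_Integration.integral_add[OF i, symmetric]) (simp add: algebra_simps)
    qed
    moreover have "(LINT x|lborel. U n x * W n x) = (LINT x|lborel. \<eta> x * (U n x * U n x))"
      by (simp add: W_def ac_simps)
    ultimately show ?thesis by (simp add: \<psi>_def)
  qed
  have cP: "converges_pow 2 (\<lambda>n. P n b) (A b)" if "b \<in> Basis" for b
    unfolding P_def by (rule moll_converges_pow[OF \<rho> A2[OF that]]) simp
  have cU: "converges_pow s U u" if "pow_integrable s u" "s \<ge> 1" for s
    unfolding U_def by (rule moll_converges_pow[OF \<rho> that])
  have c\<psi>: "converges_pow r \<psi> (\<lambda>x. \<eta> x * u x)"
    unfolding \<psi>_def W_def[abs_def]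
    by (rule moll_diagonal_converges_pow[OF \<rho> converges_pow_bounded_mult[OF cU[OF ur r] bounded_support_borel[OF \<eta>(1)] C] r])
      (use r in simp)
  define T where "T = insert (r, \<psi>, \<lambda>x. \<eta> x * u x) (insert (2, U, u) ((\<lambda>b. (2, \<lambda>n. P n b, A b)) ` Basis))"
  have "\<exists>\<sigma>. \<forall>(s, F, f)\<in>T. dominated_pow s (\<lambda>n. F (\<sigma> n)) f"
  proof (rule dominated_subsequence)
    show "finite T" by (simp add: T_def)
    show "s \<ge> 1 \<and> converges_pow s F f" if "(s, F, f) \<in> T" for s F f
      using that r c\<psi> cU[OF u2] cP unfolding T_def by auto
  qed
  then obtain \<sigma> where \<sigma>: "\<forall>(s, F, f)\<in>T. dominated_pow s (\<lambda>n. F (\<sigma> n)) f" by blast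
  have d\<psi>: "dominated_pow r (\<lambda>n. \<psi> (\<sigma> n)) (\<lambda>x. \<eta> x * u x)" and dU: "dominated_pow 2 (\<lambda>n. U (\<sigma> n)) u"
    and dP: "\<And>b. b \<in> Basis \<Longrightarrow> dominated_pow 2 (\<lambda>n. P (\<sigma> n) b) (A b)"
    using \<sigma> unfolding T_def by auto
  have bil: "(\<lambda>n. LINT x|lborel. k x * (G n x * H n x)) \<longlonglongrightarrow> (LINT x|lborel. k x * (g x * h x))"
    if t: "dominated_pow 2 G g" "dominated_pow 2 H h" "bounded_support k" for k G g H h
  proof -
    obtain C where "\<And>x. \<bar>k x\<bar> \<le> C" using t(3) unfolding bounded_support_def by blast
    then show ?thesis by (rule dominated_pow_bilinear[OF t(1,2) bounded_support_borel[OF t(3)]])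
  qed
  have lim1: "(\<lambda>n. LINT x|lborel. F x * \<psi> (\<sigma> n) x) \<longlonglongrightarrow> (LINT x|lborel. F x * (\<eta> x * u x))"
    by (rule dominated_pow_functional[OF d\<psi> r F])
  have "(\<lambda>n. LINT x|lborel. F x * \<psi> (\<sigma> n) x) \<longlonglongrightarrow>
      (\<Sum>b\<in>Basis. (LINT x|lborel. \<eta>' b x * (A b x * u x)) + (LINT x|lborel. \<eta> x * (A b x * A b x)))
      + (LINT x|lborel. \<eta> x * (u x * u x))"
    unfolding step by (intro tendsto_add tendsto_sum bil dP dU \<eta>)
  from LIMSEQ_unique[OF lim1 this] show ?thesis .
qed

section \<open>The Hardy--Littlewood--Sobolev inequality\<close>

lemma dyadic_scale_below:
  fixes t :: real
  assumes "0 < t" "t \<le> 1"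
  shows "\<exists>k::nat. (1/2) ^ Suc k < t \<and> t \<le> (1/2) ^ k"
proof -
  obtain n :: nat where n: "(1/2) ^ n < t" using real_arch_pow_inv[OF assms(1), of "1/2"] by auto
  define m where "m = (LEAST n. (1/2) ^ n < t)"
  have m: "(1/2) ^ m < t" unfolding m_def by (rule LeastI[of "\<lambda>n. (1/2) ^ n < t", OF n])
  then obtain k where k: "m = Suc k" using assms by (cases m) auto
  have "\<not> (1/2) ^ k < t" using not_less_Least[of k "\<lambda>n. (1/2) ^ n < t"] k unfolding m_def by simp
  then show ?thesis using m k by (intro exI[of _ k]) auto
qed

lemma dyadic_scale_above:
  fixes t :: real
  assumes "1 \<le> t"
  shows "\<exists>k::nat. 2 ^ k \<le> t \<and> t < 2 ^ Suc k"
proof -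
  obtain n :: nat where n: "t < 2 ^ n" using real_arch_pow[of 2 t] by auto
  define m where "m = (LEAST n. t < 2 ^ n)"
  have m: "t < 2 ^ m" unfolding m_def by (rule LeastI[of "\<lambda>n. t < 2 ^ n", OF n])
  then obtain k where k: "m = Suc k" using assms by (cases m) auto
  have "\<not> t < 2 ^ k" using not_less_Least[of k "\<lambda>n. t < 2 ^ n"] k unfolding m_def by simp
  then show ?thesis using m k by (intro exI[of _ k]) auto
qed

text \<open>A layer-cake bound without integration in polar coordinates: every dyadic shell is replaced by the ball
  that contains it. In the applications the sums are geometric, so only a constant factor is lost.\<close>

lemma nn_integral_dyadic_balls_finite:
  fixes f :: "'a::euclidean_space \<Rightarrow> real" and c r :: "nat \<Rightarrow> real"
  assumes c: "\<And>k. c k \<ge> 0" and r: "\<And>k. r k \<ge> 0"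
    and cover: "\<And>x. f x \<noteq> 0 \<Longrightarrow> \<exists>k. norm x \<le> r k \<and> f x \<le> c k"
    and sm: "summable (\<lambda>k. c k * r k ^ DIM('a))"
  shows "(\<integral>\<^sup>+x. ennreal (f x) \<partial>lborel) < \<infinity>"
proof -
  let ?v = "unit_ball_vol (real DIM('a))"
  have [measurable]: "cball (0::'a) R \<in> sets borel" for R by simp
  have "(\<integral>\<^sup>+x. ennreal (f x) \<partial>lborel) \<le> (\<integral>\<^sup>+x. (\<Sum>k. ennreal (c k) * indicator (cball (0::'a) (r k)) x) \<partial>lborel)"
  proof (rule nn_integral_mono)
    fix x
    show "ennreal (f x) \<le> (\<Sum>k. ennreal (c k) * indicator (cball 0 (r k)) x)"
    proof (cases "f x = 0")
      case False
      then obtain k where k: "norm x \<le> r k" "f x \<le> c k" using cover by blast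
      have "ennreal (f x) \<le> (\<Sum>i\<in>{k}. ennreal (c i) * indicator (cball 0 (r i)) x)"
        using k by (simp add: ennreal_leI)
      also have "\<dots> \<le> (\<Sum>k. ennreal (c k) * indicator (cball 0 (r k)) x)"
        by (rule sum_le_suminf) auto
      finally show ?thesis .
    qed simp
  qed
  also have "\<dots> = (\<Sum>k. \<integral>\<^sup>+x. ennreal (c k) * indicator (cball (0::'a) (r k)) x \<partial>lborel)"
    by (rule nn_integral_suminf) measurable
  also have "\<dots> = (\<Sum>k. ennreal (?v * (c k * r k ^ DIM('a))))"
  proof (rule arg_cong[where f=suminf], rule ext)
    fix k
    have "(\<integral>\<^sup>+x. ennreal (c k) * indicator (cball (0::'a) (r k)) x \<partial>lborel) = ennreal (c k) * emeasure lborel (cball (0::'a) (r k))"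
      by (rule nn_integral_cmult_indicator) simp
    then show "(\<integral>\<^sup>+x. ennreal (c k) * indicator (cball (0::'a) (r k)) x \<partial>lborel) = ennreal (?v * (c k * r k ^ DIM('a)))"
      using c[of k] r[of k] by (simp add: emeasure_cball ennreal_mult[symmetric] mult_ac)
  qed
  also have "\<dots> = ennreal (\<Sum>k. ?v * (c k * r k ^ DIM('a)))"
    using c r sm by (intro suminf_ennreal2 summable_mult mult_nonneg_nonneg zero_le_power unit_ball_vol_nonneg) auto
  finally show ?thesis by (rule le_less_trans) simp
qed

lemma nn_integral_norm_powr_near:
  assumes "0 \<le> \<gamma>" "\<gamma> < real DIM('a)"
  shows "(\<integral>\<^sup>+x. ennreal (indicator (cball 0 1) x * norm (x::'a::euclidean_space) powr (- \<gamma>)) \<partial>lborel) < \<infinity>"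
proof (rule nn_integral_dyadic_balls_finite)
  let ?c = "\<lambda>k::nat. ((1/2) ^ Suc k) powr (- \<gamma>)" and ?r = "\<lambda>k::nat. (1/2::real) ^ k"
  show "\<exists>k. norm x \<le> ?r k \<and> indicator (cball 0 1) x * norm x powr (- \<gamma>) \<le> ?c k"
    if "indicator (cball 0 1) x * norm x powr (- \<gamma>) \<noteq> 0" for x :: 'a
  proof -
    have "0 < norm x" "norm x \<le> 1" using that by (auto simp: indicator_def split: if_splits)
    from dyadic_scale_below[OF this] obtain k where k: "(1/2) ^ Suc k < norm x" "norm x \<le> (1/2) ^ k" by blast
    have "norm x powr (- \<gamma>) \<le> ?c k" using k(1) assms by (intro powr_mono2') auto
    then show ?thesis using k(2) \<open>norm x \<le> 1\<close> by (intro exI[of _ k]) auto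
  qed
  have "?c k * ?r k ^ DIM('a) = 2 powr \<gamma> * (2 powr (\<gamma> - real DIM('a))) ^ k" for k
  proof -
    have "(1/2::real) ^ Suc k = 2 powr (- real (Suc k))"
      by (simp only: powr_minus powr_realpow zero_less_numeral) (simp add: power_one_over inverse_eq_divide)
    then have "?c k = 2 powr (\<gamma> * real (Suc k))" by (simp only: powr_powr) (simp add: algebra_simps)
    moreover have "?r k ^ DIM('a) = 2 powr (- (real k * real DIM('a)))"
    proof -
      have "?r k ^ DIM('a) = inverse (2 ^ (k * DIM('a)))"
        by (simp only: power_mult[symmetric]) (simp add: power_one_over inverse_eq_divide)
      also have "\<dots> = inverse (2 powr real (k * DIM('a)))" by (simp only: powr_realpow zero_less_numeral)
      finally show ?thesis by (simp only: of_nat_mult powr_minus)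
    qed
    moreover have "(2 powr (\<gamma> - real DIM('a))) ^ k = 2 powr ((\<gamma> - real DIM('a)) * real k)"
      by (simp add: powr_realpow[symmetric] powr_powr)
    ultimately show ?thesis by (simp add: algebra_simps flip: powr_add)
  qed
  moreover have "summable (\<lambda>k. 2 powr \<gamma> * (2 powr (\<gamma> - real DIM('a))) ^ k)"
    using assms powr_less_mono[of "\<gamma> - real DIM('a)" 0 2] by (intro summable_mult summable_geometric) simp
  ultimately show "summable (\<lambda>k. ?c k * ?r k ^ DIM('a))" by simp
qed auto

lemma nn_integral_norm_powr_far:
  assumes "real DIM('a) < \<gamma>"
  shows "(\<integral>\<^sup>+x. ennreal (indicator (- ball 0 1) x * norm (x::'a::euclidean_space) powr (- \<gamma>)) \<partial>lborel) < \<infinity>"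
proof (rule nn_integral_dyadic_balls_finite)
  let ?c = "\<lambda>k::nat. (2 ^ k) powr (- \<gamma>)" and ?r = "\<lambda>k::nat. (2::real) ^ Suc k"
  show "\<exists>k. norm x \<le> ?r k \<and> indicator (- ball 0 1) x * norm x powr (- \<gamma>) \<le> ?c k"
    if "indicator (- ball 0 1) x * norm x powr (- \<gamma>) \<noteq> 0" for x :: 'a
  proof -
    have "1 \<le> norm x" using that by (auto simp: indicator_def not_less split: if_splits)
    from dyadic_scale_above[OF this] obtain k where k: "2 ^ k \<le> norm x" "norm x < 2 ^ Suc k" by blast
    have "norm x powr (- \<gamma>) \<le> ?c k" using k(1) assms by (intro powr_mono2') auto
    then show ?thesis using k(2) \<open>1 \<le> norm x\<close> by (intro exI[of _ k]) auto
  qed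
  have "?c k * ?r k ^ DIM('a) = 2 powr (real DIM('a)) * (2 powr (real DIM('a) - \<gamma>)) ^ k" for k
  proof -
    have "?c k = 2 powr (- (\<gamma> * real k))"
      by (simp add: powr_realpow[symmetric] powr_powr mult.commute)
    moreover have "?r k ^ DIM('a) = 2 powr (real (Suc k) * real DIM('a))"
    proof -
      have "?r k ^ DIM('a) = 2 ^ (Suc k * DIM('a))" by (simp only: power_mult)
      also have "\<dots> = 2 powr real (Suc k * DIM('a))" by (rule powr_realpow[symmetric]) simp
      finally show ?thesis by (simp only: of_nat_mult)
    qed
    moreover have "(2 powr (real DIM('a) - \<gamma>)) ^ k = 2 powr ((real DIM('a) - \<gamma>) * real k)"
      by (simp add: powr_realpow[symmetric] powr_powr)
    ultimately show ?thesis by (simp add: algebra_simps flip: powr_add)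
  qed
  moreover have "summable (\<lambda>k. 2 powr (real DIM('a)) * (2 powr (real DIM('a) - \<gamma>)) ^ k)"
    using assms powr_less_mono[of "real DIM('a) - \<gamma>" 0 2] by (intro summable_mult summable_geometric) simp
  ultimately show "summable (\<lambda>k. ?c k * ?r k ^ DIM('a))" by simp
qed auto

lemma nn_integral_scale:
  fixes f :: "'a::euclidean_space \<Rightarrow> ennreal"
  assumes [measurable]: "f \<in> borel_measurable borel" and "R > 0"
  shows "(\<integral>\<^sup>+x. f x \<partial>lborel) = ennreal (R ^ DIM('a)) * (\<integral>\<^sup>+x. f (R *\<^sub>R x) \<partial>lborel)"
  using assms by (subst lborel_affine[of R 0]) (simp_all add: nn_integral_density nn_integral_distr nn_integral_cmult)

text \<open>Where \<open>a\<close> is small compared with a power of \<open>z / R\<close>, the factor \<open>min\<close> can be inserted at no cost. Elsewhere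
  \<open>a\<^bsup>1 - t\<^esup>\<close> is bounded by the corresponding power of \<open>z / R\<close>, and the exponent \<open>\<nu> / (t - 1)\<close> is the one for which
  this power cancels the kernel.\<close>

lemma riesz_kernel_pointwise:
  fixes a A z R t \<nu> :: real
  assumes "0 \<le> a" "a \<le> A" "0 < A" "0 < R" "0 < z" "t > 1" "\<nu> > 0"
  shows "a * z powr (- \<nu>) \<le> A powr (1 - t) * R powr (- \<nu>) * a powr t
    + A * (z powr (- \<nu>) * min 1 ((z / R) powr (- (\<nu> / (t - 1)))))"
proof -
  define \<beta> where "\<beta> = \<nu> / (t - 1)"
  have \<beta>: "\<beta> > 0" "\<beta> * (t - 1) = \<nu>" using assms by (auto simp: \<beta>_def)
  have n1: "0 \<le> A powr (1 - t) * R powr (- \<nu>) * a powr t" by simp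
  consider "a \<le> A * min 1 ((z / R) powr (- \<beta>))" | "a > A * min 1 ((z / R) powr (- \<beta>))" by linarith
  then show ?thesis
  proof cases
    case 1
    then have "a * z powr (- \<nu>) \<le> A * min 1 ((z / R) powr (- \<beta>)) * z powr (- \<nu>)"
      by (rule mult_right_mono) simp
    also have "\<dots> = A * (z powr (- \<nu>) * min 1 ((z / R) powr (- \<beta>)))" by simp
    finally show ?thesis using n1 unfolding \<beta>_def[symmetric] by linarith
  next
    case 2
    then have lt: "a > A * (z / R) powr (- \<beta>)" using assms(2) by (auto simp: min_def split: if_splits)
    have pos: "A * (z / R) powr (- \<beta>) > 0" using assms by simp
    then have a0: "a > 0" using lt by linarith
    have "a powr (1 - t) \<le> (A * (z / R) powr (- \<beta>)) powr (1 - t)"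
      using lt pos assms(6) by (intro powr_mono2') auto
    also have "\<dots> = A powr (1 - t) * (z / R) powr \<nu>"
      using assms \<beta> by (simp add: powr_mult powr_powr algebra_simps)
    also have "(z / R) powr \<nu> = z powr \<nu> * R powr (- \<nu>)"
      using assms by (simp add: powr_divide powr_minus field_simps)
    finally have "a powr t * a powr (1 - t) \<le> a powr t * (A powr (1 - t) * (z powr \<nu> * R powr (- \<nu>)))"
      by (rule mult_left_mono) simp
    moreover have "a powr t * a powr (1 - t) = a" using a0 by (simp flip: powr_add)
    ultimately have "a * z powr (- \<nu>) \<le> a powr t * (A powr (1 - t) * (z powr \<nu> * R powr (- \<nu>))) * z powr (- \<nu>)"
      by (intro mult_right_mono) auto
    also have "\<dots> = A powr (1 - t) * R powr (- \<nu>) * a powr t * (z powr \<nu> * z powr (- \<nu>))" by (simp add: mult_ac)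
    also have "z powr \<nu> * z powr (- \<nu>) = 1" using assms(5) by (simp flip: powr_add)
    finally have "a * z powr (- \<nu>) \<le> A powr (1 - t) * R powr (- \<nu>) * a powr t" by simp
    moreover have "0 \<le> A * (z powr (- \<nu>) * min 1 ((z / R) powr (- (\<nu> / (t - 1)))))"
      using assms(3) by simp
    ultimately show ?thesis by linarith
  qed
qed

text \<open>The potential of the part of \<open>g\<close> below the level \<open>A\<close>. The two terms of \<open>riesz_kernel_pointwise\<close> integrate
  to \<open>A\<^bsup>1 - t\<^esup> R\<^bsup>-(N - \<alpha>)\<^esup>\<close> and \<open>A R\<^bsup>\<alpha>\<^esup>\<close> up to constants, and \<open>R\<close> is chosen to make them equal. The condition
  \<open>t * \<alpha> < N\<close> says that the modified kernel decays fast enough to be integrable at infinity.\<close>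

lemma riesz_truncated_bound:
  fixes g :: "'a::euclidean_space \<Rightarrow> real" and \<alpha> t :: real
  assumes \<alpha>: "0 < \<alpha>" "\<alpha> < real DIM('a)" and t: "t > 1" "t * \<alpha> < real DIM('a)"
    and g: "pow_integrable t g"
  shows "\<exists>C \<ge> 0. \<forall>x. \<forall>A > 0. (\<integral>\<^sup>+y. ennreal (if \<bar>g y\<bar> \<le> A then \<bar>g y\<bar> * norm (x - y) powr (- (real DIM('a) - \<alpha>)) else 0) \<partial>lborel)
      \<le> ennreal (C * A powr (1 - t * \<alpha> / real DIM('a)))"
proof -
  note [measurable] = pow_integrable_borel[OF g]
  let ?N = "real DIM('a)"
  define \<nu> where "\<nu> = ?N - \<alpha>"
  define \<beta> where "\<beta> = \<nu> / (t - 1)"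
  have \<nu>: "\<nu> > 0" using \<alpha> by (simp add: \<nu>_def)
  have \<beta>: "\<beta> > \<alpha>" using t \<alpha> by (simp add: \<beta>_def \<nu>_def field_simps)
  define k where "k w = norm w powr (- \<nu>) * min 1 (norm w powr (- \<beta>))" for w :: 'a
  have [measurable]: "k \<in> borel_measurable borel" unfolding k_def[abs_def] by measurable
  have [measurable]: "cball (0::'a) 1 \<in> sets borel" "- ball (0::'a) 1 \<in> sets borel" by auto
  define \<kappa> where "\<kappa> = enn2real (\<integral>\<^sup>+w. ennreal (k w) \<partial>lborel)"
  have fin: "(\<integral>\<^sup>+w. ennreal (k w) \<partial>lborel) < \<infinity>"
  proof -
    have "k w \<le> indicator (cball 0 1) w * norm w powr (- \<nu>) + indicator (- ball 0 1) w * norm w powr (- (\<nu> + \<beta>))" for w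
    proof (cases "norm w < 1")
      case True
      then show ?thesis by (simp add: k_def mult_left_le)
    next
      case False
      have "k w \<le> norm w powr (- \<nu>) * norm w powr (- \<beta>)" unfolding k_def by (intro mult_left_mono) auto
      also have "\<dots> = norm w powr (- (\<nu> + \<beta>))" by (simp add: algebra_simps flip: powr_add)
      also have "\<dots> \<le> indicator (cball 0 1) w * norm w powr (- \<nu>) + indicator (- ball 0 1) w * norm w powr (- (\<nu> + \<beta>))"
        using False by simp
      finally show ?thesis .
    qed
    then have "(\<integral>\<^sup>+w. ennreal (k w) \<partial>lborel) \<le> (\<integral>\<^sup>+w. ennreal (indicator (cball 0 1) w * norm (w::'a) powr (- \<nu>))
        + ennreal (indicator (- ball 0 1) w * norm w powr (- (\<nu> + \<beta>))) \<partial>lborel)"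
      by (intro nn_integral_mono) (simp add: ennreal_leI flip: ennreal_plus)
    also have "\<dots> = (\<integral>\<^sup>+w. ennreal (indicator (cball 0 1) w * norm (w::'a) powr (- \<nu>)) \<partial>lborel)
        + (\<integral>\<^sup>+w. ennreal (indicator (- ball 0 1) w * norm (w::'a) powr (- (\<nu> + \<beta>))) \<partial>lborel)"
      by (rule nn_integral_add) measurable
    also have "\<dots> < \<infinity>"
      using nn_integral_norm_powr_near[where 'a='a, of \<nu>] nn_integral_norm_powr_far[where 'a='a, of "\<nu> + \<beta>"]
        \<nu> \<beta> \<alpha> by (simp add: \<nu>_def)
    finally show ?thesis .
  qed
  have \<kappa>: "\<kappa> \<ge> 0" "(\<integral>\<^sup>+w. ennreal (k w) \<partial>lborel) = ennreal \<kappa>"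
    using fin by (simp_all add: \<kappa>_def)
  define G where "G = (LINT y|lborel. \<bar>g y\<bar> powr t)"
  have G: "G \<ge> 0" "(\<integral>\<^sup>+y. ennreal (\<bar>g y\<bar> powr t) \<partial>lborel) = ennreal G"
    using nn_integral_eq_integral[OF pow_integrableD[OF g]] by (simp_all add: G_def)
  have "(\<integral>\<^sup>+y. ennreal (if \<bar>g y\<bar> \<le> A then \<bar>g y\<bar> * norm (x - y) powr (- \<nu>) else 0) \<partial>lborel)
      \<le> ennreal ((G + \<kappa>) * A powr (1 - t * \<alpha> / ?N))" if A: "A > 0" for x A
  proof -
    \<comment> \<open>The radius at which the two contributions are of the same size.\<close>
    define R where "R = A powr (- t / ?N)"
    have R: "R > 0" using A by (simp add: R_def)
    have "(\<integral>\<^sup>+y. ennreal (if \<bar>g y\<bar> \<le> A then \<bar>g y\<bar> * norm (x - y) powr (- \<nu>) else 0) \<partial>lborel)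
      \<le> (\<integral>\<^sup>+y. ennreal (A powr (1 - t) * R powr (- \<nu>)) * ennreal (\<bar>g y\<bar> powr t)
          + ennreal (A * R powr (- \<nu>)) * ennreal (k ((x - y) /\<^sub>R R)) \<partial>lborel)"
    proof (rule nn_integral_mono)
      fix y
      have "(if \<bar>g y\<bar> \<le> A then \<bar>g y\<bar> * norm (x - y) powr (- \<nu>) else 0)
          \<le> A powr (1 - t) * R powr (- \<nu>) * \<bar>g y\<bar> powr t + A * R powr (- \<nu>) * k ((x - y) /\<^sub>R R)"
      proof (cases "x = y \<or> \<bar>g y\<bar> > A")
        case True
        then show ?thesis using A by (auto simp: k_def)
      next
        case False
        then have "\<bar>g y\<bar> * norm (x - y) powr (- \<nu>) \<le> A powr (1 - t) * R powr (- \<nu>) * \<bar>g y\<bar> powr t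
            + A * (norm (x - y) powr (- \<nu>) * min 1 ((norm (x - y) / R) powr (- (\<nu> / (t - 1)))))"
          using A R t \<nu> by (intro riesz_kernel_pointwise) auto
        moreover have "R powr (- \<nu>) * k ((x - y) /\<^sub>R R)
            = norm (x - y) powr (- \<nu>) * min 1 ((norm (x - y) / R) powr (- (\<nu> / (t - 1))))"
        proof -
          have "norm ((x - y) /\<^sub>R R) = norm (x - y) / R" using R by (simp add: divide_inverse mult.commute)
          moreover have "R powr (- \<nu>) * (norm (x - y) / R) powr (- \<nu>) = norm (x - y) powr (- \<nu>)"
            using R by (simp add: powr_divide)
          ultimately show ?thesis unfolding k_def \<beta>_def by (simp only: mult.assoc[symmetric])
        qed
        ultimately show ?thesis using False by (simp add: mult.assoc)
      qed
      then show "ennreal (if \<bar>g y\<bar> \<le> A then \<bar>g y\<bar> * norm (x - y) powr (- \<nu>) else 0)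
          \<le> ennreal (A powr (1 - t) * R powr (- \<nu>)) * ennreal (\<bar>g y\<bar> powr t)
          + ennreal (A * R powr (- \<nu>)) * ennreal (k ((x - y) /\<^sub>R R))"
        using A by (simp add: ennreal_leI k_def flip: ennreal_plus ennreal_mult)
    qed
    also have "\<dots> = ennreal (A powr (1 - t) * R powr (- \<nu>)) * ennreal G
        + ennreal (A * R powr (- \<nu>)) * (\<integral>\<^sup>+y. ennreal (k ((x - y) /\<^sub>R R)) \<partial>lborel)"
      by (simp add: nn_integral_add nn_integral_cmult G)
    also have "(\<integral>\<^sup>+y. ennreal (k ((x - y) /\<^sub>R R)) \<partial>lborel) = (\<integral>\<^sup>+y. ennreal (k (y /\<^sub>R R)) \<partial>lborel)"
      by (rule nn_integral_reflect[of "\<lambda>y. ennreal (k (y /\<^sub>R R))"]) measurable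
    also have "\<dots> = ennreal (R ^ DIM('a)) * ennreal \<kappa>"
      using R by (subst nn_integral_scale[OF _ R]) (simp_all add: \<kappa>(2))
    also have "ennreal (A powr (1 - t) * R powr (- \<nu>)) * ennreal G + ennreal (A * R powr (- \<nu>)) * (ennreal (R ^ DIM('a)) * ennreal \<kappa>)
        = ennreal (A powr (1 - t) * R powr (- \<nu>) * G + A * R powr (- \<nu>) * (R ^ DIM('a) * \<kappa>))"
      using A R G(1) \<kappa>(1) by (simp add: ennreal_mult ennreal_plus)
    also have "A powr (1 - t) * R powr (- \<nu>) = A powr (1 - t * \<alpha> / ?N)"
      by (simp add: R_def powr_powr \<nu>_def field_simps flip: powr_add)
    also have "A * R powr (- \<nu>) * (R ^ DIM('a) * \<kappa>) = A powr (1 - t * \<alpha> / ?N) * \<kappa>"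
    proof -
      have "R ^ DIM('a) = A powr (- t)"
        using A by (simp add: R_def powr_realpow[symmetric] powr_powr)
      moreover have "A = A powr 1" using A by simp
      ultimately have "A * R powr (- \<nu>) * R ^ DIM('a) = A powr (1 + (t / ?N) * \<nu> + (- t))"
        by (simp only: powr_add R_def powr_powr) simp
      also have "1 + (t / ?N) * \<nu> + (- t) = 1 - t * \<alpha> / ?N" by (simp add: \<nu>_def field_simps)
      finally show ?thesis by simp
    qed
    finally show ?thesis by (simp add: algebra_simps)
  qed
  then show ?thesis using G \<kappa> unfolding \<nu>_def by (intro exI[of _ "G + \<kappa>"]) auto
qed

text \<open>The level \<open>A = \<bar>f x\<bar>\<^bsup>s / t\<^esup>\<close> is the one at which \<open>f x\<close> times the bound of \<open>riesz_truncated_bound\<close> is a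
  multiple of \<open>\<bar>f x\<bar>\<^bsup>s\<^esup>\<close>.\<close>

lemma hls_one_sided:
  fixes f g :: "'a::euclidean_space \<Rightarrow> real" and \<alpha> s t :: real
  assumes \<alpha>: "0 < \<alpha>" "\<alpha> < real DIM('a)" and st: "s > 1" "t > 1" "1 / s + 1 / t = (real DIM('a) + \<alpha>) / real DIM('a)"
    and f: "pow_integrable s f" and g: "pow_integrable t g"
  shows "(\<integral>\<^sup>+x. \<integral>\<^sup>+y. ennreal (if \<bar>g y\<bar> \<le> \<bar>f x\<bar> powr (s / t)
      then \<bar>f x\<bar> * (\<bar>g y\<bar> * norm (x - y) powr (- (real DIM('a) - \<alpha>))) else 0) \<partial>lborel \<partial>lborel) < \<infinity>"
proof -
  note [measurable] = pow_integrable_borel[OF f] pow_integrable_borel[OF g]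
  let ?N = "real DIM('a)" and ?K = "\<lambda>x y::'a. norm (x - y) powr (- (real DIM('a) - \<alpha>))"
  have e: "1 / s + 1 / t = 1 + \<alpha> / ?N" using st(3) by (simp add: add_divide_distrib)
  have "1 / s < 1" using st(1) by simp
  then have "\<alpha> / ?N < 1 / t" using e by linarith
  then have t\<alpha>: "t * \<alpha> < ?N" using st(2) by (simp add: field_simps)
  obtain C where C: "C \<ge> 0" "\<And>x A. A > 0 \<Longrightarrow>
      (\<integral>\<^sup>+y. ennreal (if \<bar>g y\<bar> \<le> A then \<bar>g y\<bar> * ?K x y else 0) \<partial>lborel) \<le> ennreal (C * A powr (1 - t * \<alpha> / ?N))"
    using riesz_truncated_bound[OF \<alpha> st(2) t\<alpha> g] by blast
  have "(\<integral>\<^sup>+y. ennreal (if \<bar>g y\<bar> \<le> \<bar>f x\<bar> powr (s / t) then \<bar>f x\<bar> * (\<bar>g y\<bar> * ?K x y) else 0) \<partial>lborel)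
      \<le> ennreal (C * \<bar>f x\<bar> powr s)" for x
  proof (cases "f x = 0")
    case True
    then have "(\<lambda>y. ennreal (if \<bar>g y\<bar> \<le> \<bar>f x\<bar> powr (s / t) then \<bar>f x\<bar> * (\<bar>g y\<bar> * ?K x y) else 0)) = (\<lambda>y. 0)"
      by (intro ext) auto
    then show ?thesis by simp
  next
    case False
    then have A: "\<bar>f x\<bar> powr (s / t) > 0" by simp
    have "(\<integral>\<^sup>+y. ennreal (if \<bar>g y\<bar> \<le> \<bar>f x\<bar> powr (s / t) then \<bar>f x\<bar> * (\<bar>g y\<bar> * ?K x y) else 0) \<partial>lborel)
      = (\<integral>\<^sup>+y. ennreal \<bar>f x\<bar> * ennreal (if \<bar>g y\<bar> \<le> \<bar>f x\<bar> powr (s / t) then \<bar>g y\<bar> * ?K x y else 0) \<partial>lborel)"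
      by (intro nn_integral_cong) (simp add: ennreal_mult)
    also have "\<dots> = ennreal \<bar>f x\<bar> * (\<integral>\<^sup>+y. ennreal (if \<bar>g y\<bar> \<le> \<bar>f x\<bar> powr (s / t) then \<bar>g y\<bar> * ?K x y else 0) \<partial>lborel)"
      by (rule nn_integral_cmult) measurable
    also have "\<dots> \<le> ennreal \<bar>f x\<bar> * ennreal (C * (\<bar>f x\<bar> powr (s / t)) powr (1 - t * \<alpha> / ?N))"
      by (intro mult_left_mono C(2) A) simp
    also have "\<dots> = ennreal (\<bar>f x\<bar> * (C * (\<bar>f x\<bar> powr (s / t)) powr (1 - t * \<alpha> / ?N)))"
      using C(1) by (simp add: ennreal_mult)
    also have "\<bar>f x\<bar> * (C * (\<bar>f x\<bar> powr (s / t)) powr (1 - t * \<alpha> / ?N)) = C * \<bar>f x\<bar> powr s"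
    proof -
      have "s / t * (1 - t * \<alpha> / ?N) = s * (1 / t - \<alpha> / ?N)" using st(2) by (simp add: field_simps)
      also have "1 / t - \<alpha> / ?N = 1 - 1 / s" using e by linarith
      also have "s * (1 - 1 / s) = s - 1" using st(1) by (simp add: field_simps)
      \<comment> \<open>The relation between the exponents \<open>s\<close>, \<open>t\<close> and \<open>\<alpha>\<close> is used here.\<close>
      finally have ex: "s / t * (1 - t * \<alpha> / ?N) = s - 1" .
      have "\<bar>f x\<bar> * (\<bar>f x\<bar> powr (s / t)) powr (1 - t * \<alpha> / ?N) = \<bar>f x\<bar> powr 1 * \<bar>f x\<bar> powr (s - 1)"
        by (simp only: powr_powr ex) (use False in simp)
      also have "\<dots> = \<bar>f x\<bar> powr s" by (subst powr_add[symmetric]) simp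
      finally show ?thesis by simp
    qed
    finally show ?thesis .
  qed
  then have "(\<integral>\<^sup>+x. \<integral>\<^sup>+y. ennreal (if \<bar>g y\<bar> \<le> \<bar>f x\<bar> powr (s / t) then \<bar>f x\<bar> * (\<bar>g y\<bar> * ?K x y) else 0) \<partial>lborel \<partial>lborel)
     \<le> (\<integral>\<^sup>+x. ennreal (C * \<bar>f x\<bar> powr s) \<partial>lborel)" by (rule nn_integral_mono)
  also have "\<dots> = ennreal (LINT x|lborel. C * \<bar>f x\<bar> powr s)"
    using C(1) by (intro nn_integral_eq_integral integrable_mult_right pow_integrableD f) auto
  finally show ?thesis by (rule le_less_trans) simp
qed

text \<open>Finiteness in the Hardy--Littlewood--Sobolev inequality. The product space is split according to
  which of \<open>\<bar>f x\<bar>\<^bsup>s\<^esup>\<close> and \<open>\<bar>g y\<bar>\<^bsup>t\<^esup>\<close> is larger; either part is bounded by \<open>hls_one_sided\<close>.\<close>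

lemma hls_integrable:
  fixes f g :: "'a::euclidean_space \<Rightarrow> real" and \<alpha> s t :: real
  assumes \<alpha>: "0 < \<alpha>" "\<alpha> < real DIM('a)" and st: "s > 1" "t > 1" "1 / s + 1 / t = (real DIM('a) + \<alpha>) / real DIM('a)"
    and f: "pow_integrable s f" and g: "pow_integrable t g"
  shows "integrable (lborel \<Otimes>\<^sub>M lborel) (\<lambda>(x, y). norm (x - y) powr (- (real DIM('a) - \<alpha>)) * (f x * g y))"
proof (rule integrableI_bounded)
  note [measurable] = pow_integrable_borel[OF f] pow_integrable_borel[OF g]
  let ?K = "\<lambda>x y::'a. norm (x - y) powr (- (real DIM('a) - \<alpha>))"
  let ?F = "\<lambda>x y. if \<bar>g y\<bar> \<le> \<bar>f x\<bar> powr (s / t) then \<bar>f x\<bar> * (\<bar>g y\<bar> * ?K x y) else 0"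
  let ?G = "\<lambda>y x. if \<bar>f x\<bar> \<le> \<bar>g y\<bar> powr (t / s) then \<bar>g y\<bar> * (\<bar>f x\<bar> * ?K y x) else 0"
  show "(\<lambda>(x, y). ?K x y * (f x * g y)) \<in> borel_measurable (lborel \<Otimes>\<^sub>M lborel)" by measurable
  have "(\<integral>\<^sup>+z. ennreal (norm (case z of (x, y) \<Rightarrow> ?K x y * (f x * g y))) \<partial>(lborel \<Otimes>\<^sub>M lborel))
    = (\<integral>\<^sup>+x. \<integral>\<^sup>+y. ennreal \<bar>?K x y * (f x * g y)\<bar> \<partial>lborel \<partial>lborel)"
    by (subst lborel.nn_integral_fst[symmetric]) (auto simp: case_prod_beta)
  also have "\<dots> \<le> (\<integral>\<^sup>+x. \<integral>\<^sup>+y. ennreal (?F x y) + ennreal (?G y x) \<partial>lborel \<partial>lborel)"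
  proof (intro nn_integral_mono)
    fix x y :: 'a
    have K: "?K y x = ?K x y" by (simp add: norm_minus_commute)
    have le: "\<bar>?K x y * (f x * g y)\<bar> \<le> ?F x y + ?G y x"
    proof (cases "\<bar>g y\<bar> \<le> \<bar>f x\<bar> powr (s / t)")
      case True
      then show ?thesis by (simp add: abs_mult mult_ac)
    next
      case False
      then have "(\<bar>f x\<bar> powr (s / t)) powr (t / s) \<le> \<bar>g y\<bar> powr (t / s)"
        using st by (intro powr_mono2) auto
      then have "\<bar>f x\<bar> \<le> \<bar>g y\<bar> powr (t / s)" using st by (simp add: powr_powr)
      then show ?thesis using K by (simp add: abs_mult mult_ac)
    qed
    show "ennreal \<bar>?K x y * (f x * g y)\<bar> \<le> ennreal (?F x y) + ennreal (?G y x)"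
    proof -
      have "ennreal \<bar>?K x y * (f x * g y)\<bar> \<le> ennreal (?F x y + ?G y x)" using le by (rule ennreal_leI)
      also have "\<dots> = ennreal (?F x y) + ennreal (?G y x)" by (rule ennreal_plus) auto
      finally show ?thesis .
    qed
  qed
  also have "\<dots> = (\<integral>\<^sup>+x. (\<integral>\<^sup>+y. ennreal (?F x y) \<partial>lborel) + (\<integral>\<^sup>+y. ennreal (?G y x) \<partial>lborel) \<partial>lborel)"
    by (intro nn_integral_cong nn_integral_add) measurable
  also have "\<dots> = (\<integral>\<^sup>+x. \<integral>\<^sup>+y. ennreal (?F x y) \<partial>lborel \<partial>lborel) + (\<integral>\<^sup>+x. \<integral>\<^sup>+y. ennreal (?G y x) \<partial>lborel \<partial>lborel)"
    by (intro nn_integral_add) measurable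
  also have "(\<integral>\<^sup>+x. \<integral>\<^sup>+y. ennreal (?G y x) \<partial>lborel \<partial>lborel) = (\<integral>\<^sup>+y. \<integral>\<^sup>+x. ennreal (?G y x) \<partial>lborel \<partial>lborel)"
    by (rule lborel_pair.Fubini') measurable
  also have "(\<integral>\<^sup>+x. \<integral>\<^sup>+y. ennreal (?F x y) \<partial>lborel \<partial>lborel) + \<dots> < \<infinity>"
    using hls_one_sided[OF \<alpha> st f g] hls_one_sided[OF \<alpha> st(2,1) _ g f] st(3) by (simp add: add.commute)
  finally show "(\<integral>\<^sup>+z. ennreal (norm (case z of (x, y) \<Rightarrow> ?K x y * (f x * g y))) \<partial>(lborel \<Otimes>\<^sub>M lborel)) < \<infinity>" .
qed

section \<open>The chain rule for powers\<close>

lemma abs_signed_powr: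
  fixes t p :: real
  shows "\<bar>\<bar>t\<bar> powr (p - 2) * t\<bar> = \<bar>t\<bar> powr (p - 1)"
proof (cases "t = 0")
  case False
  then have "\<bar>t\<bar> powr (p - 2) * \<bar>t\<bar> = \<bar>t\<bar> powr (p - 2) * \<bar>t\<bar> powr 1" by simp
  also have "\<dots> = \<bar>t\<bar> powr (p - 1)" by (simp only: powr_add[symmetric]) simp
  finally show ?thesis by (simp add: abs_mult)
qed simp

lemma isCont_signed_powr:
  fixes p x :: real
  assumes p: "p > 1"
  shows "isCont (\<lambda>t. \<bar>t\<bar> powr (p - 2) * t) x"
proof (cases "x = 0")
  case False
  then show ?thesis by (intro continuous_intros) auto
next
  case True
  have "((\<lambda>t::real. \<bar>t\<bar>) \<longlongrightarrow> \<bar>0\<bar>) (at 0)" by (intro tendsto_intros)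
  then have "((\<lambda>t::real. \<bar>t\<bar> powr (p - 1)) \<longlongrightarrow> \<bar>0\<bar> powr (p - 1)) (at 0)"
    by (rule tendsto_powr'[OF _ tendsto_const]) (use p in auto)
  then have "((\<lambda>t::real. \<bar>\<bar>t\<bar> powr (p - 2) * t\<bar>) \<longlongrightarrow> 0) (at 0)"
    by (simp add: abs_signed_powr)
  then show ?thesis unfolding True isCont_def by (simp add: tendsto_rabs_zero_iff)
qed

lemma DERIV_abs_powr:
  fixes p t :: real
  assumes p: "p > 1"
  shows "((\<lambda>t. \<bar>t\<bar> powr p) has_real_derivative p * (\<bar>t\<bar> powr (p - 2) * t)) (at t)"
proof -
  consider "t > 0" | "t < 0" | "t = 0" by linarith
  then show ?thesis
  proof cases
    case 1
    have "((\<lambda>t. t powr p) has_real_derivative p * t powr (p - 1)) (at t)"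
      by (rule has_real_derivative_powr[OF 1])
    moreover have "t powr (p - 1) = \<bar>t\<bar> powr (p - 2) * t"
      using abs_signed_powr[of t p] 1 by (simp add: abs_mult)
    ultimately have "((\<lambda>t. t powr p) has_real_derivative p * (\<bar>t\<bar> powr (p - 2) * t)) (at t)" by simp
    then show ?thesis
      by (rule has_field_derivative_transform_within_open[of _ _ _ "{0<..}"]) (use 1 in auto)
  next
    case 2
    have "((\<lambda>t. (- t) powr p) has_real_derivative (p * (- t) powr (p - 1)) * (- 1)) (at t)"
      by (rule DERIV_chain2[OF has_real_derivative_powr]) (use 2 in \<open>auto intro!: derivative_eq_intros\<close>)
    moreover have "\<bar>t\<bar> powr (p - 2) * \<bar>t\<bar> = \<bar>t\<bar> powr (p - 1)"
      using abs_signed_powr[of t p] by (simp add: abs_mult)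
    then have "(- t) powr (p - 1) * (-1) = \<bar>t\<bar> powr (p - 2) * t" using 2 by simp
    ultimately have "((\<lambda>t. (- t) powr p) has_real_derivative p * (\<bar>t\<bar> powr (p - 2) * t)) (at t)"
      by (simp only: mult.assoc)
    then show ?thesis
      by (rule has_field_derivative_transform_within_open[of _ _ _ "{..<0}"]) (use 2 in auto)
  next
    case 3
    have "((\<lambda>h. \<bar>h\<bar> powr (p - 2) * h) \<longlongrightarrow> 0) (at 0)"
      using isCont_signed_powr[OF p, of 0] by (simp add: isCont_def)
    then have "((\<lambda>h. (\<bar>0 + h\<bar> powr p - \<bar>0\<bar> powr p) / h) \<longlongrightarrow> 0) (at 0)"
    proof (rule Lim_transform_eventually)
      show "\<forall>\<^sub>F h in at 0. \<bar>h\<bar> powr (p - 2) * h = (\<bar>0 + h\<bar> powr p - \<bar>0\<bar> powr p) / h"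
        unfolding eventually_at_filter
      proof (intro always_eventually allI impI)
        fix h :: real assume h: "h \<noteq> 0"
        have "\<bar>h\<bar> powr (p - 2) * (h * h) = \<bar>h\<bar> powr (p - 2) * \<bar>h\<bar> powr 2" by (simp add: power2_eq_square)
        also have "\<dots> = \<bar>h\<bar> powr p" by (simp only: powr_add[symmetric]) simp
        finally show "\<bar>h\<bar> powr (p - 2) * h = (\<bar>0 + h\<bar> powr p - \<bar>0\<bar> powr p) / h"
          using h by (simp add: field_simps)
      qed
    qed
    then show ?thesis using 3 by (simp add: DERIV_def)
  qed
qed

lemma powr_mult_le_add_powr:
  fixes a b p :: real
  assumes "a \<ge> 0" "b \<ge> 0" "p > 1"
  shows "a powr (p - 1) * b \<le> a powr p + b powr p"
proof -
  let ?m = "max a b"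
  have "a powr (p - 1) * b \<le> ?m powr (p - 1) * ?m"
    using assms by (intro mult_mono powr_mono2) auto
  also have "\<dots> = ?m powr p"
  proof (cases "?m = 0")
    case False
    then have "?m powr (p - 1) * ?m = ?m powr (p - 1) * ?m powr 1" using assms by simp
    then show ?thesis by (simp only: powr_add[symmetric]) simp
  qed (use assms in simp)
  also have "\<dots> \<le> a powr p + b powr p" by (simp add: max_def)
  finally show ?thesis .
qed

lemma abs_powr_le_one_add_powr:
  fixes t p r :: real assumes "0 \<le> p" "p \<le> r" shows "\<bar>t\<bar> powr p \<le> 1 + \<bar>t\<bar> powr r"
proof (cases "\<bar>t\<bar> \<le> 1")
  case True
  then have "\<bar>t\<bar> powr p \<le> 1 powr p" using assms by (intro powr_mono2) auto
  then show ?thesis by (simp add: add_increasing2)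
next
  case False
  then have "\<bar>t\<bar> powr p \<le> \<bar>t\<bar> powr r" using assms by (intro powr_mono) auto
  then show ?thesis by simp
qed

lemma locally_bounded_abs_powr:
  assumes "locally_bounded F" "a \<ge> 0"
  shows "locally_bounded (\<lambda>x. \<bar>F x\<bar> powr a)"
proof -
  note [measurable] = locally_bounded_borel[OF assms(1)]
  show ?thesis
    unfolding locally_bounded_def
  proof (intro conjI allI)
    fix R
    obtain C where C: "C > 0" "\<And>x. norm x \<le> R \<Longrightarrow> \<bar>F x\<bar> \<le> C"
      using assms(1) by (rule locally_boundedE[where R=R]) blast
    then show "\<exists>C. \<forall>x. norm x \<le> R \<longrightarrow> \<bar>\<bar>F x\<bar> powr a\<bar> \<le> C"
      using assms(2) by (intro exI[of _ "C powr a"]) (auto intro!: powr_mono2)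
  qed measurable
qed

lemma locally_bounded_signed_powr:
  assumes "locally_bounded F" "p > 1"
  shows "locally_bounded (\<lambda>x. \<bar>F x\<bar> powr (p - 2) * F x)"
proof -
  note [measurable] = locally_bounded_borel[OF assms(1)]
  have m: "(\<lambda>x. \<bar>F x\<bar> powr (p - 2) * F x) \<in> borel_measurable borel" by measurable
  have "locally_bounded (\<lambda>x. \<bar>F x\<bar> powr (p - 1))"
    by (rule locally_bounded_abs_powr) (use assms in auto)
  then show ?thesis using m unfolding locally_bounded_def abs_signed_powr by simp
qed

lemma pow_integrable_abs_powr:
  assumes "pow_integrable (\<theta> * p) u"
  shows "pow_integrable \<theta> (\<lambda>x. \<bar>u x\<bar> powr p)"
proof -
  note [measurable] = pow_integrable_borel[OF assms]
  show ?thesis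
    using pow_integrableD[OF assms] unfolding pow_integrable_def by (simp add: powr_powr mult.commute)
qed

lemma pow_integrable_signed_powr_mult:
  assumes u: "pow_integrable (\<theta> * p) u" and h: "pow_integrable (\<theta> * p) h" and p: "p > 1" and \<theta>: "\<theta> > 1"
  shows "pow_integrable \<theta> (\<lambda>x. (\<bar>u x\<bar> powr (p - 2) * u x) * h x)"
proof -
  note [measurable] = pow_integrable_borel[OF u] pow_integrable_borel[OF h]
  have i: "pow_integrable \<theta> (\<lambda>x. \<bar>u x\<bar> powr p + \<bar>h x\<bar> powr p)"
    using \<theta> by (intro pow_integrable_add pow_integrable_abs_powr u h) auto
  show ?thesis
  proof (rule pow_integrable_bound[OF pow_integrableD[OF i]])
    show "AE x in lborel. \<bar>\<bar>u x\<bar> powr (p - 2) * u x * h x\<bar> powr \<theta> \<le> \<bar>\<bar>u x\<bar> powr p + \<bar>h x\<bar> powr p\<bar> powr \<theta>"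
    proof (intro AE_I2 powr_mono2)
      fix x
      have "\<bar>\<bar>u x\<bar> powr (p - 2) * u x * h x\<bar> = \<bar>u x\<bar> powr (p - 1) * \<bar>h x\<bar>"
        by (simp only: abs_mult[of _ "h x"] abs_signed_powr)
      also have "\<dots> \<le> \<bar>u x\<bar> powr p + \<bar>h x\<bar> powr p" using p by (intro powr_mult_le_add_powr) auto
      finally show "\<bar>\<bar>u x\<bar> powr (p - 2) * u x * h x\<bar> \<le> \<bar>\<bar>u x\<bar> powr p + \<bar>h x\<bar> powr p\<bar>" by simp
    qed (use \<theta> in auto)
    show "(\<lambda>x. \<bar>u x\<bar> powr (p - 2) * u x * h x) \<in> borel_measurable borel" by measurable
  qed
qed

text \<open>Classical for mollified functions, since \<open>\<lambda>t. \<bar>t\<bar> powr p\<close> is continuously differentiable for \<open>p > 1\<close>.\<close>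

lemma chain_rule_power:
  fixes u :: "'a::euclidean_space \<Rightarrow> real"
  assumes p: "p > 1" "p \<le> r" and w: "weak_partial b u A" and b: "b \<in> Basis"
    and ur: "pow_integrable r u" and Ar: "pow_integrable r A"
    and k: "bounded_support k" "bounded_support k'" "line_deriv b k k'"
  shows "(LINT x|lborel. k x * (p * (\<bar>u x\<bar> powr (p - 2) * u x) * A x)) = - (LINT x|lborel. k' x * \<bar>u x\<bar> powr p)"
proof -
  have r: "r \<ge> 1" using p by simp
  obtain \<rho> :: "nat \<Rightarrow> 'a \<Rightarrow> real" where \<rho>: "mollifier \<rho>" using mollifier_exists by blast
  have lu: "loc_integrable u" "loc_integrable A" using w unfolding weak_partial_def by auto
  define U where "U n = moll (\<rho> n) u" for n
  define P where "P n = moll (\<rho> n) A" for n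
  have lU: "locally_bounded (U n)" and lP: "locally_bounded (P n)" for n
    unfolding U_def P_def by (intro moll_locally_bounded[OF mollifierD(5)[OF \<rho>]] lu)+
  have dU: "line_deriv b (U n) (P n)" for n
    unfolding U_def P_def by (rule moll_line_deriv_weak[OF w mollifierD(1)[OF \<rho>] b])
  have dUp: "line_deriv b (\<lambda>x. \<bar>U n x\<bar> powr p) (\<lambda>x. p * (\<bar>U n x\<bar> powr (p - 2) * U n x) * P n x)" for n
    unfolding line_deriv_def
  proof
    fix x
    have "((\<lambda>t. U n (x + t *\<^sub>R b)) has_real_derivative P n x) (at 0)"
      using dU unfolding line_deriv_def by blast
    from DERIV_chain2[OF DERIV_abs_powr[OF p(1)] this]
    show "((\<lambda>t. \<bar>U n (x + t *\<^sub>R b)\<bar> powr p) has_real_derivative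
        p * (\<bar>U n x\<bar> powr (p - 2) * U n x) * P n x) (at 0)" by simp
  qed
  have step: "(LINT x|lborel. k x * (p * (\<bar>U n x\<bar> powr (p - 2) * U n x) * P n x))
      = - (LINT x|lborel. k' x * \<bar>U n x\<bar> powr p)" for n
  proof -
    have lb: "locally_bounded (\<lambda>x. \<bar>U n x\<bar> powr p)" "locally_bounded (\<lambda>x. p * (\<bar>U n x\<bar> powr (p - 2) * U n x) * P n x)"
      using p by (intro locally_bounded_abs_powr locally_bounded_mult locally_bounded_signed_powr lU lP locally_bounded_const; simp)+
    have bs: "bounded_support (\<lambda>x. k x * \<bar>U n x\<bar> powr p)" "bounded_support (\<lambda>x. k' x * \<bar>U n x\<bar> powr p)"
      "bounded_support (\<lambda>x. k x * (p * (\<bar>U n x\<bar> powr (p - 2) * U n x) * P n x))"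
      by (intro bounded_support_mult k lb)+
    have "(LINT x|lborel. k' x * \<bar>U n x\<bar> powr p + k x * (p * (\<bar>U n x\<bar> powr (p - 2) * U n x) * P n x)) = 0"
      by (rule integral_line_deriv_zero[OF bs(1) bounded_support_add[OF bs(2,3)] line_deriv_mult[OF k(3) dUp]])
    then show ?thesis
      using bounded_support_integrable[OF bs(2)] bounded_support_integrable[OF bs(3)] by simp
  qed
  have "\<exists>\<sigma>. \<forall>(s, F, f)\<in>{(r, U, u), (r, P, A)}. dominated_pow s (\<lambda>n. F (\<sigma> n)) f"
  proof (rule dominated_subsequence)
    show "s \<ge> 1 \<and> converges_pow s F f" if "(s, F, f) \<in> {(r, U, u), (r, P, A)}" for s F f
      using that r moll_converges_pow[OF \<rho> ur r] moll_converges_pow[OF \<rho> Ar r]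
      unfolding U_def[abs_def] P_def[abs_def] by auto
  qed simp
  then obtain \<sigma> where dU: "dominated_pow r (\<lambda>n. U (\<sigma> n)) u" and dP: "dominated_pow r (\<lambda>n. P (\<sigma> n)) A" by auto
  obtain G where G: "integrable lborel G" "\<And>n. AE x in lborel. \<bar>U (\<sigma> n) x\<bar> powr r \<le> G x"
    using dU unfolding dominated_pow_def by blast
  obtain H where H: "integrable lborel H" "\<And>n. AE x in lborel. \<bar>P (\<sigma> n) x\<bar> powr r \<le> H x"
    using dP unfolding dominated_pow_def by blast
  have cU: "AE x in lborel. (\<lambda>n. U (\<sigma> n) x) \<longlonglongrightarrow> u x" and cP: "AE x in lborel. (\<lambda>n. P (\<sigma> n) x) \<longlonglongrightarrow> A x"
    using dU dP unfolding dominated_pow_def by blast+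
  have [measurable]: "U n \<in> borel_measurable borel" "P n \<in> borel_measurable borel"
    "u \<in> borel_measurable borel" "A \<in> borel_measurable borel" for n
    using locally_bounded_borel[OF lU] locally_bounded_borel[OF lP] pow_integrable_borel[OF ur] pow_integrable_borel[OF Ar] by auto
  note [measurable] = bounded_support_borel[OF k(1)] bounded_support_borel[OF k(2)]
  have lM: "loc_integrable (\<lambda>x. 2 + G x + H x)"
  proof -
    have l: "loc_integrable G" "loc_integrable H" "loc_integrable (\<lambda>x::'a. 2)"
      by (intro integrable_loc_integrable G H loc_integrable_locally_bounded locally_bounded_const)+
    then show ?thesis unfolding loc_integrable_def by (auto simp: distrib_left)
  qed
  have kM: "integrable lborel (\<lambda>x. C * \<bar>\<kappa> x * (2 + G x + H x)\<bar>)" if "bounded_support \<kappa>" for \<kappa> :: "'a \<Rightarrow> real" and C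
    by (intro integrable_mult_right integrable_abs integrable_bounded_support_mult that lM)
  have pw: "\<bar>t\<bar> powr p \<le> 1 + m" if "\<bar>t\<bar> powr r \<le> m" for t m :: real
    using abs_powr_le_one_add_powr[of p r t] p that by linarith
  have lim1: "(\<lambda>n. LINT x|lborel. k x * (p * (\<bar>U (\<sigma> n) x\<bar> powr (p - 2) * U (\<sigma> n) x) * P (\<sigma> n) x))
      \<longlonglongrightarrow> (LINT x|lborel. k x * (p * (\<bar>u x\<bar> powr (p - 2) * u x) * A x))"
  proof (rule integral_dominated_convergence)
    show "integrable lborel (\<lambda>x. p * \<bar>k x * (2 + G x + H x)\<bar>)" by (rule kM[OF k(1)])
    show "AE x in lborel. (\<lambda>n. k x * (p * (\<bar>U (\<sigma> n) x\<bar> powr (p - 2) * U (\<sigma> n) x) * P (\<sigma> n) x))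
        \<longlonglongrightarrow> k x * (p * (\<bar>u x\<bar> powr (p - 2) * u x) * A x)"
      using cU cP
    proof eventually_elim
      fix x assume "(\<lambda>n. U (\<sigma> n) x) \<longlonglongrightarrow> u x" and P: "(\<lambda>n. P (\<sigma> n) x) \<longlonglongrightarrow> A x"
      note L = isCont_tendsto_compose[OF isCont_signed_powr[OF p(1)] this(1)]
      show "(\<lambda>n. k x * (p * (\<bar>U (\<sigma> n) x\<bar> powr (p - 2) * U (\<sigma> n) x) * P (\<sigma> n) x))
        \<longlonglongrightarrow> k x * (p * (\<bar>u x\<bar> powr (p - 2) * u x) * A x)"
        by (rule tendsto_mult[OF tendsto_const tendsto_mult[OF tendsto_mult[OF tendsto_const L] P]])
    qed
    show "AE x in lborel. norm (k x * (p * (\<bar>U (\<sigma> n) x\<bar> powr (p - 2) * U (\<sigma> n) x) * P (\<sigma> n) x))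
        \<le> p * \<bar>k x * (2 + G x + H x)\<bar>" for n
      using G(2)[of n] H(2)[of n]
    proof eventually_elim
      fix x assume 1: "\<bar>U (\<sigma> n) x\<bar> powr r \<le> G x" "\<bar>P (\<sigma> n) x\<bar> powr r \<le> H x"
      have "\<bar>U (\<sigma> n) x\<bar> powr (p - 1) * \<bar>P (\<sigma> n) x\<bar> \<le> \<bar>U (\<sigma> n) x\<bar> powr p + \<bar>P (\<sigma> n) x\<bar> powr p"
        using p by (intro powr_mult_le_add_powr) auto
      also have "\<dots> \<le> (1 + G x) + (1 + H x)" by (intro add_mono pw 1)
      also have "\<dots> = 2 + G x + H x" by simp
      finally have le: "\<bar>U (\<sigma> n) x\<bar> powr (p - 1) * \<bar>P (\<sigma> n) x\<bar> \<le> \<bar>2 + G x + H x\<bar>" by linarith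
      have "norm (k x * (p * (\<bar>U (\<sigma> n) x\<bar> powr (p - 2) * U (\<sigma> n) x) * P (\<sigma> n) x))
        = \<bar>k x\<bar> * (p * (\<bar>\<bar>U (\<sigma> n) x\<bar> powr (p - 2) * U (\<sigma> n) x\<bar> * \<bar>P (\<sigma> n) x\<bar>))"
        using p by (simp add: abs_mult)
      also have "\<dots> = \<bar>k x\<bar> * (p * (\<bar>U (\<sigma> n) x\<bar> powr (p - 1) * \<bar>P (\<sigma> n) x\<bar>))"
        by (simp only: abs_signed_powr)
      also have "\<dots> \<le> \<bar>k x\<bar> * (p * \<bar>2 + G x + H x\<bar>)"
        using p by (intro mult_left_mono le) auto
      also have "\<dots> = p * \<bar>k x * (2 + G x + H x)\<bar>" by (simp add: abs_mult)
      finally show "norm (k x * (p * (\<bar>U (\<sigma> n) x\<bar> powr (p - 2) * U (\<sigma> n) x) * P (\<sigma> n) x))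
        \<le> p * \<bar>k x * (2 + G x + H x)\<bar>" .
    qed
  qed measurable
  have lim2: "(\<lambda>n. LINT x|lborel. k' x * \<bar>U (\<sigma> n) x\<bar> powr p) \<longlonglongrightarrow> (LINT x|lborel. k' x * \<bar>u x\<bar> powr p)"
  proof (rule integral_dominated_convergence)
    show "integrable lborel (\<lambda>x. 1 * \<bar>k' x * (2 + G x + H x)\<bar>)" by (rule kM[OF k(2)])
    show "AE x in lborel. (\<lambda>n. k' x * \<bar>U (\<sigma> n) x\<bar> powr p) \<longlonglongrightarrow> k' x * \<bar>u x\<bar> powr p"
      using cU
    proof eventually_elim
      fix x assume "(\<lambda>n. U (\<sigma> n) x) \<longlonglongrightarrow> u x"
      then show "(\<lambda>n. k' x * \<bar>U (\<sigma> n) x\<bar> powr p) \<longlonglongrightarrow> k' x * \<bar>u x\<bar> powr p"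
        using p by (intro tendsto_mult tendsto_const tendsto_powr' tendsto_rabs) auto
    qed
    show "AE x in lborel. norm (k' x * \<bar>U (\<sigma> n) x\<bar> powr p) \<le> 1 * \<bar>k' x * (2 + G x + H x)\<bar>" for n
      using G(2)[of n] H(2)[of n]
    proof eventually_elim
      fix x assume 1: "\<bar>U (\<sigma> n) x\<bar> powr r \<le> G x" "\<bar>P (\<sigma> n) x\<bar> powr r \<le> H x"
      have "0 \<le> \<bar>P (\<sigma> n) x\<bar> powr r" by simp
      then have "\<bar>U (\<sigma> n) x\<bar> powr p \<le> \<bar>2 + G x + H x\<bar>" using pw[OF 1(1)] 1(2) by linarith
      then show "norm (k' x * \<bar>U (\<sigma> n) x\<bar> powr p) \<le> 1 * \<bar>k' x * (2 + G x + H x)\<bar>"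
        by (simp add: abs_mult mult_left_mono)
    qed
  qed measurable
  show ?thesis
    using LIMSEQ_unique[OF lim1[unfolded step] tendsto_minus[OF lim2]] .
qed

section \<open>The nonlocal term under a vector field\<close>

lemma locally_bounded_continuous:
  fixes F :: "'a::euclidean_space \<Rightarrow> real"
  assumes "continuous_on UNIV F" shows "locally_bounded F"
  unfolding locally_bounded_def
proof (intro conjI allI)
  show "F \<in> borel_measurable borel" by (rule borel_measurable_continuous_onI[OF assms])
  fix R
  have "compact (F ` cball 0 R)"
    using assms by (intro compact_continuous_image continuous_on_subset[OF assms]) auto
  then show "\<exists>C. \<forall>x. norm x \<le> R \<longrightarrow> \<bar>F x\<bar> \<le> C"
    using compact_imp_bounded[of "F ` cball 0 R"] unfolding bounded_iff
    by (metis imageI mem_cball_0 real_norm_def)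
qed

definition reg_kernel :: "real \<Rightarrow> real \<Rightarrow> 'a::euclidean_space \<Rightarrow> real" where
  "reg_kernel \<nu> \<delta> z = ((norm z)\<^sup>2 + \<delta>\<^sup>2) powr (- (\<nu> / 2))"

text \<open>The gradient of the regularised kernel at \<open>z\<close> is this multiple of \<open>z\<close>.\<close>

definition reg_kernel_rate :: "real \<Rightarrow> real \<Rightarrow> 'a::euclidean_space \<Rightarrow> real" where
  "reg_kernel_rate \<nu> \<delta> z = - \<nu> * ((norm z)\<^sup>2 + \<delta>\<^sup>2) powr (- (\<nu> / 2) - 1)"

lemma reg_kernel_base_pos: "\<delta> > 0 \<Longrightarrow> (norm z)\<^sup>2 + \<delta>\<^sup>2 > (0::real)"
  by (simp add: add_nonneg_pos)

lemma reg_kernel_continuous: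
  assumes "\<delta> > 0"
  shows "continuous_on UNIV (\<lambda>x::'a::euclidean_space. reg_kernel \<nu> \<delta> (x - y))"
    "continuous_on UNIV (\<lambda>x::'a. reg_kernel_rate \<nu> \<delta> (x - y))"
proof -
  have "(norm (x - y))\<^sup>2 + \<delta>\<^sup>2 \<noteq> 0" for x :: 'a
    using reg_kernel_base_pos[OF assms, of "x - y"] assms by simp
  then show "continuous_on UNIV (\<lambda>x::'a. reg_kernel \<nu> \<delta> (x - y))"
    "continuous_on UNIV (\<lambda>x::'a. reg_kernel_rate \<nu> \<delta> (x - y))"
    unfolding reg_kernel_def reg_kernel_rate_def by (intro continuous_intros; simp)+
qed

lemma reg_kernel_borel [measurable]:
  "reg_kernel \<nu> \<delta> \<in> borel_measurable borel" "reg_kernel_rate \<nu> \<delta> \<in> borel_measurable borel"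
  unfolding reg_kernel_def[abs_def] reg_kernel_rate_def[abs_def] by measurable

lemma reg_kernel_line_deriv:
  assumes "\<delta> > 0"
  shows "line_deriv c (\<lambda>x. reg_kernel \<nu> \<delta> (x - y)) (\<lambda>x. reg_kernel_rate \<nu> \<delta> (x - y) * ((x - y) \<bullet> c))"
  unfolding line_deriv_def
proof
  fix x
  define z where "z = x - y"
  let ?q = "\<lambda>t. (norm z)\<^sup>2 + \<delta>\<^sup>2 + 2 * t * (z \<bullet> c) + t * t * (c \<bullet> c)"
  have q: "(?q has_real_derivative 2 * (z \<bullet> c)) (at 0)"
    by (auto intro!: derivative_eq_intros)
  have eq: "(\<lambda>t. (norm (x + t *\<^sub>R c - y))\<^sup>2 + \<delta>\<^sup>2) = ?q"
  proof
    fix t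
    have e: "x + t *\<^sub>R c - y = z + t *\<^sub>R c" by (simp add: z_def)
    show "(norm (x + t *\<^sub>R c - y))\<^sup>2 + \<delta>\<^sup>2 = ?q t" unfolding e power2_norm_eq_inner
      by (simp add: inner_add_left inner_add_right inner_commute[of c z] algebra_simps)
  qed
  have "((\<lambda>t. (norm (x + t *\<^sub>R c - y))\<^sup>2 + \<delta>\<^sup>2) has_real_derivative 2 * (z \<bullet> c)) (at 0)"
    unfolding eq by (rule q)
  note dQ = this
  have "((\<lambda>t. ((norm (x + t *\<^sub>R c - y))\<^sup>2 + \<delta>\<^sup>2) powr (- (\<nu> / 2))) has_real_derivative
      (- (\<nu> / 2) * ((norm (x + 0 *\<^sub>R c - y))\<^sup>2 + \<delta>\<^sup>2) powr (- (\<nu> / 2) - 1)) * (2 * (z \<bullet> c))) (at 0)"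
    by (rule DERIV_chain2[OF has_real_derivative_powr dQ]) (rule reg_kernel_base_pos[OF assms])
  then show "((\<lambda>t. reg_kernel \<nu> \<delta> (x + t *\<^sub>R c - y)) has_real_derivative
      reg_kernel_rate \<nu> \<delta> (x - y) * ((x - y) \<bullet> c)) (at 0)"
    unfolding reg_kernel_def reg_kernel_rate_def by (simp add: z_def mult_ac)
qed

lemma reg_kernel_le:
  assumes "\<nu> > 0" "z \<noteq> 0"
  shows "reg_kernel \<nu> \<delta> z \<le> norm z powr (- \<nu>)"
proof -
  have "reg_kernel \<nu> \<delta> z \<le> ((norm z)\<^sup>2) powr (- (\<nu> / 2))"
    unfolding reg_kernel_def using assms by (intro powr_mono2') auto
  also have "\<dots> = norm z powr (- \<nu>)"
    using assms by (simp add: powr_powr flip: powr_numeral)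
  finally show ?thesis .
qed

lemma reg_kernel_rate_eq:
  assumes "\<delta> > 0"
  shows "reg_kernel_rate \<nu> \<delta> z = - \<nu> * reg_kernel \<nu> \<delta> z / ((norm z)\<^sup>2 + \<delta>\<^sup>2)"
  unfolding reg_kernel_rate_def reg_kernel_def
  using reg_kernel_base_pos[OF assms, of z] by (simp add: powr_diff)

lemma reg_kernel_nonneg: "0 \<le> reg_kernel \<nu> \<delta> z"
  by (simp add: reg_kernel_def)

text \<open>The directional derivative of \<open>\<bar>u\<bar> powr p\<close> along the field \<open>X\<close>.\<close>

definition power_flux :: "real \<Rightarrow> ('a::euclidean_space \<Rightarrow> real) \<Rightarrow> ('a \<Rightarrow> 'a \<Rightarrow> real) \<Rightarrow> ('a \<Rightarrow> 'a) \<Rightarrow> 'a \<Rightarrow> real" where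
  "power_flux p u A X x = (\<Sum>c\<in>Basis. (X x \<bullet> c) * (p * (\<bar>u x\<bar> powr (p - 2) * u x) * A c x))"

text \<open>Membership in \<open>W\<^bsup>1,r\<^esup>\<close> with the weak gradient given explicitly, so that the same gradient can be used
  for different exponents.\<close>

definition sobolev_pow :: "real \<Rightarrow> ('a::euclidean_space \<Rightarrow> real) \<Rightarrow> ('a \<Rightarrow> 'a \<Rightarrow> real) \<Rightarrow> bool" where
  "sobolev_pow r u A \<longleftrightarrow> pow_integrable r u \<and>
     (\<forall>b\<in>Basis. pow_integrable r (A b) \<and> weak_partial b u (A b))"

text \<open>Here \<open>d b c\<close> is the derivative of the component \<open>c\<close> in the direction \<open>b\<close>.\<close>

definition cutoff_field :: "('a::euclidean_space \<Rightarrow> 'a) \<Rightarrow> ('a \<Rightarrow> 'a \<Rightarrow> 'a \<Rightarrow> real) \<Rightarrow> bool" where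
  "cutoff_field X d \<longleftrightarrow> (\<forall>c\<in>Basis. bounded_support (\<lambda>x. X x \<bullet> c) \<and>
     (\<forall>b\<in>Basis. bounded_support (d b c) \<and> line_deriv b (\<lambda>x. X x \<bullet> c) (d b c)))"

lemma cutoff_fieldD:
  assumes "cutoff_field X d"
  shows "c \<in> Basis \<Longrightarrow> bounded_support (\<lambda>x. X x \<bullet> c)"
    "b \<in> Basis \<Longrightarrow> c \<in> Basis \<Longrightarrow> bounded_support (d b c)"
    "b \<in> Basis \<Longrightarrow> c \<in> Basis \<Longrightarrow> line_deriv b (\<lambda>x. X x \<bullet> c) (d b c)"
  using assms unfolding cutoff_field_def by auto

lemma cutoff_field_borel:
  fixes X :: "'a::euclidean_space \<Rightarrow> 'a"
  assumes "cutoff_field X d" shows "X \<in> borel_measurable borel"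
  by (subst borel_measurable_euclidean_space) (use cutoff_fieldD(1)[OF assms] bounded_support_borel in blast)

lemma cutoff_field_bounded:
  fixes X :: "'a::euclidean_space \<Rightarrow> 'a"
  assumes "cutoff_field X d"
  obtains C where "C \<ge> 0" "\<And>x. norm (X x) \<le> C"
proof -
  have "\<exists>C. \<forall>x. \<bar>X x \<bullet> c\<bar> \<le> C" if "c \<in> Basis" for c
    using cutoff_fieldD(1)[OF assms that] unfolding bounded_support_def by blast
  then obtain C where C: "\<And>c x. c \<in> Basis \<Longrightarrow> \<bar>X x \<bullet> c\<bar> \<le> C c" by metis
  have le: "norm (X x) \<le> (\<Sum>c\<in>Basis. C c)" for x
    by (rule order_trans[OF norm_le_l1]) (intro sum_mono C)
  have "0 \<le> (\<Sum>c\<in>Basis. C c)" using le[of 0] norm_ge_zero order_trans by blast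
  then show ?thesis using le that by blast
qed

definition divergence :: "('a::euclidean_space \<Rightarrow> 'a \<Rightarrow> 'a \<Rightarrow> real) \<Rightarrow> 'a \<Rightarrow> real" where
  "divergence d x = (\<Sum>c\<in>Basis. d c c x)"

lemma divergence_bounded_support:
  assumes "cutoff_field X d" shows "bounded_support (divergence d)"
  unfolding divergence_def[abs_def] by (intro bounded_support_sum cutoff_fieldD[OF assms])

lemma power_flux_pow_integrable:
  fixes u :: "'a::euclidean_space \<Rightarrow> real"
  assumes u: "sobolev_pow (\<theta> * p) u A" and X: "cutoff_field X d" and p: "p > 1" and \<theta>: "\<theta> > 1"
  shows "pow_integrable \<theta> (power_flux p u A X)"
  unfolding power_flux_def[abs_def]
proof (rule pow_integrable_sum)
  fix c :: 'a assume c: "c \<in> Basis"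
  obtain C where C: "\<And>x. \<bar>X x \<bullet> c\<bar> \<le> C" using cutoff_fieldD(1)[OF X c] unfolding bounded_support_def by blast
  have "pow_integrable \<theta> (\<lambda>x. (\<bar>u x\<bar> powr (p - 2) * u x) * A c x)"
    using u c by (intro pow_integrable_signed_powr_mult p \<theta>) (auto simp: sobolev_pow_def)
  moreover have "(\<lambda>x. p * (X x \<bullet> c)) \<in> borel_measurable borel"
    using bounded_support_borel[OF cutoff_fieldD(1)[OF X c]] by simp
  moreover have "\<bar>p * (X x \<bullet> c)\<bar> \<le> p * C" for x using C[of x] p by (simp add: abs_mult)
  ultimately have "pow_integrable \<theta> (\<lambda>x. (p * (X x \<bullet> c)) * ((\<bar>u x\<bar> powr (p - 2) * u x) * A c x))"
    by (rule pow_integrable_bounded_mult) (use \<theta> in simp)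
  then show "pow_integrable \<theta> (\<lambda>x. (X x \<bullet> c) * (p * (\<bar>u x\<bar> powr (p - 2) * u x) * A c x))"
    by (simp add: mult_ac)
qed (use \<theta> in simp)

text \<open>Integration by parts of \<open>X \<bullet> \<nabla>\<bar>u\<bar>\<^sup>p\<close> against the regularised kernel with pole \<open>y\<close>.\<close>

lemma reg_kernel_flux:
  fixes u :: "'a::euclidean_space \<Rightarrow> real"
  assumes u: "sobolev_pow (\<theta> * p) u A" and X: "cutoff_field X d" and p: "p > 1" and \<theta>: "\<theta> > 1" and \<delta>: "\<delta> > 0"
  shows "(LINT x|lborel. reg_kernel \<nu> \<delta> (x - y) * power_flux p u A X x)
    = - (LINT x|lborel. (reg_kernel \<nu> \<delta> (x - y) * divergence d x + reg_kernel_rate \<nu> \<delta> (x - y) * ((x - y) \<bullet> X x)) * \<bar>u x\<bar> powr p)"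
proof -
  have ur: "pow_integrable (\<theta> * p) u" using u unfolding sobolev_pow_def by blast
  have A: "pow_integrable (\<theta> * p) (A c)" "weak_partial c u (A c)" if "c \<in> Basis" for c
    using u that unfolding sobolev_pow_def by auto
  have pr: "p \<le> \<theta> * p" using p \<theta> by simp
  let ?R = "\<lambda>x. reg_kernel \<nu> \<delta> (x - y)" and ?S = "\<lambda>x. reg_kernel_rate \<nu> \<delta> (x - y)"
  let ?s = "\<lambda>c x. p * (\<bar>u x\<bar> powr (p - 2) * u x) * A c x"
  have lR: "locally_bounded ?R" by (rule locally_bounded_continuous[OF reg_kernel_continuous(1)[OF \<delta>]])
  have lS: "locally_bounded (\<lambda>x. ?S x * ((x - y) \<bullet> c))" for c
    by (intro locally_bounded_continuous continuous_intros reg_kernel_continuous[OF \<delta>])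
  let ?k = "\<lambda>c x. (X x \<bullet> c) * ?R x" and ?k' = "\<lambda>c x. d c c x * ?R x + (X x \<bullet> c) * (?S x * ((x - y) \<bullet> c))"
  have k: "bounded_support (?k c)" "bounded_support (?k' c)" "line_deriv c (?k c) (?k' c)" if c: "c \<in> Basis" for c
    by (intro bounded_support_add bounded_support_mult line_deriv_mult reg_kernel_line_deriv[OF \<delta>]
        cutoff_fieldD[OF X] lR lS c)+
  have chain: "(LINT x|lborel. ?k c x * ?s c x) = - (LINT x|lborel. ?k' c x * \<bar>u x\<bar> powr p)" if c: "c \<in> Basis" for c
    by (rule chain_rule_power[OF p pr A(2)[OF c] c ur A(1)[OF c] k[OF c]])
  have ls: "loc_integrable (\<lambda>x. (\<bar>u x\<bar> powr (p - 2) * u x) * A c x)" if c: "c \<in> Basis" for c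
    using pow_integrable_signed_powr_mult[OF ur A(1)[OF c] p \<theta>] by (rule pow_integrable_loc_integrable) (use \<theta> in simp)
  have i1: "integrable lborel (\<lambda>x. ?k c x * ?s c x)" if c: "c \<in> Basis" for c
    using integrable_mult_right[OF integrable_bounded_support_mult[OF k(1)[OF c] ls[OF c]], of p] by (simp add: mult_ac)
  have lp: "loc_integrable (\<lambda>x. \<bar>u x\<bar> powr p)"
    by (rule pow_integrable_loc_integrable[OF pow_integrable_abs_powr[OF ur]]) (use \<theta> in simp)
  have i2: "integrable lborel (\<lambda>x. ?k' c x * \<bar>u x\<bar> powr p)" if c: "c \<in> Basis" for c
    by (rule integrable_bounded_support_mult[OF k(2)[OF c] lp])
  have "(LINT x|lborel. ?R x * power_flux p u A X x) = (LINT x|lborel. (\<Sum>c\<in>Basis. ?k c x * ?s c x))"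
    unfolding power_flux_def sum_distrib_left by (intro Bochner_Integration.integral_cong sum.cong refl) simp
  also have "\<dots> = (\<Sum>c\<in>Basis. LINT x|lborel. ?k c x * ?s c x)" by (intro Bochner_Integration.integral_sum i1)
  also have "\<dots> = (\<Sum>c\<in>Basis. - (LINT x|lborel. ?k' c x * \<bar>u x\<bar> powr p))" by (intro sum.cong refl chain)
  also have "\<dots> = - (LINT x|lborel. (\<Sum>c\<in>Basis. ?k' c x * \<bar>u x\<bar> powr p))"
    by (subst Bochner_Integration.integral_sum[OF i2]) (simp_all add: sum_negf)
  also have "(\<lambda>x. \<Sum>c\<in>Basis. ?k' c x * \<bar>u x\<bar> powr p)
      = (\<lambda>x. (?R x * divergence d x + ?S x * ((x - y) \<bullet> X x)) * \<bar>u x\<bar> powr p)"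
  proof
    fix x
    have "(\<Sum>c\<in>Basis. ?k' c x) = ?R x * divergence d x + ?S x * ((x - y) \<bullet> X x)"
      unfolding divergence_def euclidean_inner[of "x - y" "X x"] sum_distrib_left sum.distrib[symmetric]
      by (intro sum.cong refl) (simp add: mult_ac)
    then show "(\<Sum>c\<in>Basis. ?k' c x * \<bar>u x\<bar> powr p)
      = (?R x * divergence d x + ?S x * ((x - y) \<bullet> X x)) * \<bar>u x\<bar> powr p"
      by (simp only: sum_distrib_right[symmetric])
  qed
  finally show ?thesis .
qed

abbreviation (input) lborel2 :: "('a::euclidean_space \<times> 'a) measure" where
  "lborel2 \<equiv> lborel \<Otimes>\<^sub>M lborel"

lemma AE_off_diagonal: "AE z in (lborel2 :: ('a::euclidean_space \<times> 'a) measure). fst z \<noteq> snd z"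
proof (rule lborel_pair.AE_pair_measure)
  show "{z \<in> space (lborel2 :: ('a \<times> 'a) measure). fst z \<noteq> snd z} \<in> sets lborel2" by measurable
  show "AE x in lborel. AE y in lborel. fst (x, y) \<noteq> (snd (x, y) :: 'a)"
  proof (rule AE_I2)
    fix x :: 'a
    show "AE y in lborel. fst (x, y) \<noteq> snd (x, y)"
      using AE_lborel_singleton[of x] by eventually_elim simp
  qed
qed

text \<open>The bound is asked off the diagonal only, where the regularised kernels are below the singular one;
  at the diagonal the singular kernel has the value \<open>0 powr _ = 0\<close>.\<close>

lemma integrable_kernel_bound:
  fixes f g :: "'a::euclidean_space \<Rightarrow> real"
  assumes i: "integrable lborel2 (\<lambda>(x, y). norm (x - y) powr (- \<nu>) * (f x * g y))"
    and [measurable]: "f \<in> borel_measurable borel" "g \<in> borel_measurable borel"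
    and M: "(\<lambda>(x, y). M x y) \<in> borel_measurable (borel \<Otimes>\<^sub>M borel)"
    and b: "\<And>x y. x \<noteq> y \<Longrightarrow> \<bar>M x y\<bar> \<le> C * norm (x - y) powr (- \<nu>)"
  shows "integrable lborel2 (\<lambda>(x, y). M x y * (f x * g y))"
proof (rule Bochner_Integration.integrable_bound)
  show "integrable lborel2 (\<lambda>z. C * (case z of (x, y) \<Rightarrow> norm (x - y) powr (- \<nu>) * (f x * g y)))"
    using i by simp
  have [measurable]: "(\<lambda>z. M (fst z) (snd z)) \<in> borel_measurable (borel \<Otimes>\<^sub>M borel)"
    using M by (simp add: case_prod_beta)
  have [measurable]: "(\<lambda>z. M (fst z) (snd z)) \<in> borel_measurable lborel2"
    by (simp cong: measurable_cong_sets sets_pair_measure_cong)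
  show "(\<lambda>(x, y). M x y * (f x * g y)) \<in> borel_measurable lborel2"
    unfolding case_prod_beta by measurable
  show "AE z in lborel2. norm (case z of (x, y) \<Rightarrow> M x y * (f x * g y))
      \<le> norm (C * (case z of (x, y) \<Rightarrow> norm (x - y) powr (- \<nu>) * (f x * g y)))"
    using AE_off_diagonal
  proof eventually_elim
    fix z :: "'a \<times> 'a" assume "fst z \<noteq> snd z"
    then obtain x y where z: "z = (x, y)" "x \<noteq> y" by (cases z) auto
    have "\<bar>M x y\<bar> * \<bar>f x * g y\<bar> \<le> \<bar>C * norm (x - y) powr (- \<nu>)\<bar> * \<bar>f x * g y\<bar>"
      using b[OF z(2)] by (intro mult_right_mono) auto
    then show "norm (case z of (x, y) \<Rightarrow> M x y * (f x * g y))
      \<le> norm (C * (case z of (x, y) \<Rightarrow> norm (x - y) powr (- \<nu>) * (f x * g y)))"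
      using z by (simp add: abs_mult mult.assoc)
  qed
qed

text \<open>A crude bound, depending on \<open>\<delta>\<close>, that makes Fubini's theorem applicable at fixed \<open>\<delta>\<close>.\<close>

lemma reg_kernel_rate_bound:
  fixes z w :: "'a::euclidean_space"
  assumes "\<delta> > 0" "\<nu> > 0" "norm w \<le> m"
  shows "\<bar>reg_kernel_rate \<nu> \<delta> z * (z \<bullet> w)\<bar> \<le> (\<nu> * m / \<delta>) * reg_kernel \<nu> \<delta> z"
proof -
  let ?q = "(norm z)\<^sup>2 + \<delta>\<^sup>2"
  have q: "?q > 0" by (rule reg_kernel_base_pos[OF assms(1)])
  have m: "m \<ge> 0" using assms(3) norm_ge_zero order_trans by blast
  have "2 * (norm z * \<delta>) \<le> ?q" using sum_squares_bound[of "norm z" \<delta>] by simp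
  moreover have "0 \<le> norm z * \<delta>" using assms(1) by simp
  ultimately have "norm z * \<delta> \<le> ?q" by linarith
  then have zq: "norm z / ?q \<le> 1 / \<delta>" using q assms(1) by (simp add: field_simps)
  have "\<bar>z \<bullet> w\<bar> \<le> norm z * m"
    by (rule order_trans[OF Cauchy_Schwarz_ineq2]) (intro mult_left_mono assms norm_ge_zero)
  then have "\<bar>z \<bullet> w\<bar> / ?q \<le> norm z * m / ?q" using q by (intro divide_right_mono) auto
  also have "\<dots> = norm z / ?q * m" by simp
  also have "\<dots> \<le> 1 / \<delta> * m" by (intro mult_right_mono zq m)
  finally have le: "\<bar>z \<bullet> w\<bar> / ?q \<le> m / \<delta>" by simp
  have "\<bar>reg_kernel_rate \<nu> \<delta> z * (z \<bullet> w)\<bar> = \<nu> * reg_kernel \<nu> \<delta> z * (\<bar>z \<bullet> w\<bar> / ?q)"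
    using assms q reg_kernel_nonneg[of \<nu> \<delta> z] by (simp add: reg_kernel_rate_eq abs_mult)
  also have "\<dots> \<le> \<nu> * reg_kernel \<nu> \<delta> z * (m / \<delta>)"
    using assms reg_kernel_nonneg[of \<nu> \<delta> z] by (intro mult_left_mono le) auto
  finally show ?thesis by (simp add: mult_ac)
qed

text \<open>For a vector of size at most \<open>L\<close> times the distance to the pole the bound is uniform in \<open>\<delta>\<close>.\<close>

lemma reg_kernel_rate_Lipschitz_bound:
  fixes z w :: "'a::euclidean_space"
  assumes "\<delta> > 0" "\<nu> > 0" "norm w \<le> L * norm z" and L: "L \<ge> 0"
  shows "\<bar>reg_kernel_rate \<nu> \<delta> z * (z \<bullet> w)\<bar> \<le> (\<nu> * L) * reg_kernel \<nu> \<delta> z"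
proof -
  let ?q = "(norm z)\<^sup>2 + \<delta>\<^sup>2"
  have q: "?q > 0" by (rule reg_kernel_base_pos[OF assms(1)])
  have "\<bar>z \<bullet> w\<bar> \<le> norm z * (L * norm z)"
    by (rule order_trans[OF Cauchy_Schwarz_ineq2]) (intro mult_left_mono assms norm_ge_zero)
  also have "\<dots> = L * (norm z)\<^sup>2" by (simp add: power2_eq_square)
  also have "\<dots> \<le> L * ?q" using L by (intro mult_left_mono) auto
  finally have le: "\<bar>z \<bullet> w\<bar> / ?q \<le> L" using q by (simp add: divide_le_eq)
  have "\<bar>reg_kernel_rate \<nu> \<delta> z * (z \<bullet> w)\<bar> = \<nu> * reg_kernel \<nu> \<delta> z * (\<bar>z \<bullet> w\<bar> / ?q)"
    using assms q reg_kernel_nonneg[of \<nu> \<delta> z] by (simp add: reg_kernel_rate_eq abs_mult)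
  also have "\<dots> \<le> \<nu> * reg_kernel \<nu> \<delta> z * L"
    using assms reg_kernel_nonneg[of \<nu> \<delta> z] by (intro mult_left_mono le) auto
  finally show ?thesis by (simp add: mult_ac)
qed

text \<open>Serves both limits of the argument, that of the regularisation and that of the cutoff.\<close>

lemma kernel_dominated_convergence:
  fixes f g :: "'a::euclidean_space \<Rightarrow> real"
  assumes i: "integrable lborel2 (\<lambda>(x, y). norm (x - y) powr (- \<nu>) * (f x * g y))"
    and f: "f \<in> borel_measurable borel" and g: "g \<in> borel_measurable borel"
    and Mn: "\<And>n::nat. (\<lambda>(x, y). M n x y) \<in> borel_measurable (borel \<Otimes>\<^sub>M borel)"
    and m: "(\<lambda>(x, y). m x y) \<in> borel_measurable (borel \<Otimes>\<^sub>M borel)"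
    and b: "\<And>n x y. x \<noteq> y \<Longrightarrow> \<bar>M n x y\<bar> \<le> C * norm (x - y) powr (- \<nu>)"
    and lim: "\<And>x y. x \<noteq> y \<Longrightarrow> (\<lambda>n. M n x y) \<longlonglongrightarrow> m x y"
  shows "(\<lambda>n. LINT z|lborel2. (case z of (x, y) \<Rightarrow> M n x y * (f x * g y)))
    \<longlonglongrightarrow> (LINT z|lborel2. (case z of (x, y) \<Rightarrow> m x y * (f x * g y)))"
proof (rule integral_dominated_convergence)
  show "integrable lborel2 (\<lambda>z. norm (C * (case z of (x, y) \<Rightarrow> norm (x - y) powr (- \<nu>) * (f x * g y))))"
    using i by (intro integrable_norm integrable_mult_right)
  have bm: "\<bar>m x y\<bar> \<le> C * norm (x - y) powr (- \<nu>)" if "x \<noteq> y" for x y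
    by (rule LIMSEQ_le_const2[OF tendsto_rabs[OF lim[OF that]]]) (use b[OF that] in blast)
  show "(\<lambda>(x, y). M n x y * (f x * g y)) \<in> borel_measurable lborel2" for n
    by (rule borel_measurable_integrable[OF integrable_kernel_bound[OF i f g Mn b]])
  show "(\<lambda>(x, y). m x y * (f x * g y)) \<in> borel_measurable lborel2"
    by (rule borel_measurable_integrable[OF integrable_kernel_bound[OF i f g m bm]])
  show "AE z in lborel2. (\<lambda>n. case z of (x, y) \<Rightarrow> M n x y * (f x * g y))
      \<longlonglongrightarrow> (case z of (x, y) \<Rightarrow> m x y * (f x * g y))"
    using AE_off_diagonal
  proof eventually_elim
    fix z :: "'a \<times> 'a" assume "fst z \<noteq> snd z"
    then obtain x y where z: "z = (x, y)" "x \<noteq> y" by (cases z) auto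
    show "(\<lambda>n. case z of (x, y) \<Rightarrow> M n x y * (f x * g y))
      \<longlonglongrightarrow> (case z of (x, y) \<Rightarrow> m x y * (f x * g y))"
      unfolding z(1) by (simp, intro tendsto_mult lim z(2) tendsto_const)
  qed
  show "AE z in lborel2. norm (case z of (x, y) \<Rightarrow> M n x y * (f x * g y))
      \<le> norm (C * (case z of (x, y) \<Rightarrow> norm (x - y) powr (- \<nu>) * (f x * g y)))" for n
    using AE_off_diagonal
  proof eventually_elim
    fix z :: "'a \<times> 'a" assume "fst z \<noteq> snd z"
    then obtain x y where z: "z = (x, y)" "x \<noteq> y" by (cases z) auto
    have "\<bar>M n x y\<bar> * \<bar>f x * g y\<bar> \<le> \<bar>C * norm (x - y) powr (- \<nu>)\<bar> * \<bar>f x * g y\<bar>"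
      using b[OF z(2), of n] by (intro mult_right_mono) auto
    then show "norm (case z of (x, y) \<Rightarrow> M n x y * (f x * g y))
      \<le> norm (C * (case z of (x, y) \<Rightarrow> norm (x - y) powr (- \<nu>) * (f x * g y)))"
      using z by (simp add: abs_mult mult.assoc)
  qed
qed

definition reg_virial :: "real \<Rightarrow> real \<Rightarrow> ('a::euclidean_space \<Rightarrow> 'a) \<Rightarrow> ('a \<Rightarrow> 'a \<Rightarrow> 'a \<Rightarrow> real) \<Rightarrow> 'a \<Rightarrow> 'a \<Rightarrow> real" where
  "reg_virial \<nu> \<delta> X d x y =
     reg_kernel \<nu> \<delta> (x - y) * divergence d x + reg_kernel_rate \<nu> \<delta> (x - y) * ((x - y) \<bullet> X x)"

lemma reg_virial_measurable:
  assumes "cutoff_field X d"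
  shows "(\<lambda>(x, y). reg_virial \<nu> \<delta> X d x y) \<in> borel_measurable (borel \<Otimes>\<^sub>M borel)"
proof -
  note [measurable] = cutoff_field_borel[OF assms] bounded_support_borel[OF divergence_bounded_support[OF assms]]
  show ?thesis unfolding reg_virial_def[abs_def] by measurable
qed

lemma reg_virial_bound:
  fixes X :: "'a::euclidean_space \<Rightarrow> 'a"
  assumes X: "cutoff_field X d" and "\<nu> > 0" "\<delta> > 0"
  obtains C where "\<And>x y. x \<noteq> y \<Longrightarrow> \<bar>reg_virial \<nu> \<delta> X d x y\<bar> \<le> C * norm (x - y) powr (- \<nu>)"
proof -
  obtain m where m: "m \<ge> 0" "\<And>x. norm (X x) \<le> m" using cutoff_field_bounded[OF X] by blast
  obtain D where D: "D > 0" "\<And>x. \<bar>divergence d x\<bar> \<le> D"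
    using divergence_bounded_support[OF X] by (rule bounded_supportE) blast
  have "\<bar>reg_virial \<nu> \<delta> X d x y\<bar> \<le> (D + \<nu> * m / \<delta>) * norm (x - y) powr (- \<nu>)" if "x \<noteq> y" for x y
  proof -
    let ?R = "reg_kernel \<nu> \<delta> (x - y)"
    have R: "?R \<ge> 0" by (rule reg_kernel_nonneg)
    have "\<bar>?R * divergence d x\<bar> \<le> ?R * D" using R D(2)[of x] by (simp add: abs_mult mult_left_mono)
    moreover have "\<bar>reg_kernel_rate \<nu> \<delta> (x - y) * ((x - y) \<bullet> X x)\<bar> \<le> (\<nu> * m / \<delta>) * ?R"
      by (rule reg_kernel_rate_bound[OF assms(3,2) m(2)])
    ultimately have "\<bar>reg_virial \<nu> \<delta> X d x y\<bar> \<le> ?R * D + (\<nu> * m / \<delta>) * ?R" unfolding reg_virial_def by linarith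
    also have "\<dots> = (D + \<nu> * m / \<delta>) * ?R" by (simp add: algebra_simps)
    also have "\<dots> \<le> (D + \<nu> * m / \<delta>) * norm (x - y) powr (- \<nu>)"
      using reg_kernel_le[OF assms(2), of "x - y" \<delta>] that D(1) m(1) assms by (intro mult_left_mono) auto
    finally show ?thesis .
  qed
  then show ?thesis by (rule that)
qed

lemma reg_kernel_measurable2: "(\<lambda>(x, y). reg_kernel \<nu> \<delta> (x - y :: 'a::euclidean_space)) \<in> borel_measurable (borel \<Otimes>\<^sub>M borel)"
  by measurable

lemma reg_kernel_bound2:
  "\<nu> > 0 \<Longrightarrow> x \<noteq> y \<Longrightarrow> \<bar>reg_kernel \<nu> \<delta> (x - y)\<bar> \<le> 1 * norm (x - y) powr (- \<nu>)"
  using reg_kernel_le[of \<nu> "x - y" \<delta>] reg_kernel_nonneg[of \<nu> \<delta> "x - y"] by simp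

lemma reg_virial_identity:
  fixes u g :: "'a::euclidean_space \<Rightarrow> real"
  assumes \<alpha>: "0 < \<alpha>" "\<alpha> < real DIM('a)"
    and \<theta>: "\<theta> > 1" "\<tau> > 1" "1 / \<theta> + 1 / \<tau> = (real DIM('a) + \<alpha>) / real DIM('a)"
    and p: "p > 1" and u: "sobolev_pow (\<theta> * p) u A" and g: "pow_integrable \<tau> g"
    and X: "cutoff_field X d" and \<delta>: "\<delta> > 0"
  defines "\<nu> \<equiv> real DIM('a) - \<alpha>"
  shows "(LINT z|lborel2. (case z of (x, y) \<Rightarrow> reg_kernel \<nu> \<delta> (x - y) * (power_flux p u A X x * g y)))
    = - (LINT z|lborel2. (case z of (x, y) \<Rightarrow> reg_virial \<nu> \<delta> X d x y * (\<bar>u x\<bar> powr p * g y)))"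
proof -
  have \<nu>: "\<nu> > 0" using \<alpha> by (simp add: \<nu>_def)
  have fl: "pow_integrable \<theta> (power_flux p u A X)" by (rule power_flux_pow_integrable[OF u X p \<theta>(1)])
  have up: "pow_integrable \<theta> (\<lambda>x. \<bar>u x\<bar> powr p)"
    using u unfolding sobolev_pow_def by (intro pow_integrable_abs_powr) blast
  note h1 = hls_integrable[OF \<alpha> \<theta> fl g, folded \<nu>_def] and h2 = hls_integrable[OF \<alpha> \<theta> up g, folded \<nu>_def]
  have i1: "integrable lborel2 (\<lambda>(x, y). reg_kernel \<nu> \<delta> (x - y) * (power_flux p u A X x * g y))"
    by (rule integrable_kernel_bound[OF h1 pow_integrable_borel[OF fl] pow_integrable_borel[OF g]
          reg_kernel_measurable2 reg_kernel_bound2[OF \<nu>]])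
  obtain C where C: "\<And>x y. x \<noteq> y \<Longrightarrow> \<bar>reg_virial \<nu> \<delta> X d x y\<bar> \<le> C * norm (x - y) powr (- \<nu>)"
    using reg_virial_bound[OF X \<nu> \<delta>] by blast
  have i2: "integrable lborel2 (\<lambda>(x, y). reg_virial \<nu> \<delta> X d x y * (\<bar>u x\<bar> powr p * g y))"
    by (rule integrable_kernel_bound[OF h2 pow_integrable_borel[OF up] pow_integrable_borel[OF g]
          reg_virial_measurable[OF X] C])
  have "(LINT z|lborel2. (case z of (x, y) \<Rightarrow> reg_kernel \<nu> \<delta> (x - y) * (power_flux p u A X x * g y)))
      = (LINT y|lborel. LINT x|lborel. reg_kernel \<nu> \<delta> (x - y) * (power_flux p u A X x * g y))"
    by (rule lborel_pair.integral_snd[OF i1, symmetric])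
  also have "\<dots> = (LINT y|lborel. - (LINT x|lborel. reg_virial \<nu> \<delta> X d x y * (\<bar>u x\<bar> powr p * g y)))"
  proof (rule Bochner_Integration.integral_cong[OF refl])
    fix y
    have "(LINT x|lborel. reg_kernel \<nu> \<delta> (x - y) * (power_flux p u A X x * g y))
        = (LINT x|lborel. reg_kernel \<nu> \<delta> (x - y) * power_flux p u A X x) * g y"
      by (simp only: mult.assoc[symmetric] integral_mult_left_zero)
    also have "\<dots> = - (LINT x|lborel. reg_virial \<nu> \<delta> X d x y * \<bar>u x\<bar> powr p) * g y"
      unfolding reg_kernel_flux[OF u X p \<theta>(1) \<delta>] reg_virial_def ..
    also have "\<dots> = - (LINT x|lborel. reg_virial \<nu> \<delta> X d x y * (\<bar>u x\<bar> powr p * g y))"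
      by (simp only: mult.assoc[symmetric] integral_mult_left_zero mult_minus_left)
    finally show "(LINT x|lborel. reg_kernel \<nu> \<delta> (x - y) * (power_flux p u A X x * g y))
      = - (LINT x|lborel. reg_virial \<nu> \<delta> X d x y * (\<bar>u x\<bar> powr p * g y))" .
  qed
  also have "\<dots> = - (LINT y|lborel. LINT x|lborel. reg_virial \<nu> \<delta> X d x y * (\<bar>u x\<bar> powr p * g y))"
    by simp
  also have "\<dots> = - (LINT z|lborel2. (case z of (x, y) \<Rightarrow> reg_virial \<nu> \<delta> X d x y * (\<bar>u x\<bar> powr p * g y)))"
    by (simp only: lborel_pair.integral_snd[OF i2])
  finally show ?thesis .
qed

text \<open>The limit, as \<open>\<delta>\<close> tends to 0, of \<open>reg_virial\<close> symmetrised in \<open>x\<close> and \<open>y\<close>. For the field \<open>X x = x\<close> it is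
  \<open>2 N - \<nu>\<close> times the kernel.\<close>

definition virial :: "real \<Rightarrow> ('a::euclidean_space \<Rightarrow> 'a) \<Rightarrow> ('a \<Rightarrow> 'a \<Rightarrow> 'a \<Rightarrow> real) \<Rightarrow> 'a \<Rightarrow> 'a \<Rightarrow> real" where
  "virial \<nu> X d x y = norm (x - y) powr (- \<nu>) *
     (divergence d x + divergence d y - \<nu> * ((x - y) \<bullet> (X x - X y)) / (norm (x - y))\<^sup>2)"

lemma integral_lborel2_swap:
  fixes F :: "'a::euclidean_space \<Rightarrow> 'a \<Rightarrow> real"
  assumes "(\<lambda>(x, y). F x y) \<in> borel_measurable lborel2"
  shows "(LINT z|lborel2. (case z of (x, y) \<Rightarrow> F y x)) = (LINT z|lborel2. (case z of (x, y) \<Rightarrow> F x y))"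
  using lborel_pair.integral_product_swap[OF assms] by (simp add: case_prod_unfold)

lemma reg_kernel_tendsto:
  assumes z: "z \<noteq> 0" and \<delta>: "\<delta> \<longlonglongrightarrow> 0"
  shows "(\<lambda>n. reg_kernel \<nu> (\<delta> n) z) \<longlonglongrightarrow> norm z powr (- \<nu>)"
    "(\<lambda>n. reg_kernel_rate \<nu> (\<delta> n) z) \<longlonglongrightarrow> - \<nu> * norm z powr (- \<nu>) / (norm z)\<^sup>2"
proof -
  have q: "(\<lambda>n. (norm z)\<^sup>2 + (\<delta> n)\<^sup>2) \<longlonglongrightarrow> (norm z)\<^sup>2"
    using tendsto_add[OF tendsto_const tendsto_power[OF \<delta>, of 2], of "(norm z)\<^sup>2"] by simp
  have nz: "(norm z)\<^sup>2 \<noteq> 0" using z by simp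
  have e: "((norm z)\<^sup>2) powr (- (\<nu> / 2)) = norm z powr (- \<nu>)"
    using z by (simp add: powr_powr flip: powr_numeral)
  show "(\<lambda>n. reg_kernel \<nu> (\<delta> n) z) \<longlonglongrightarrow> norm z powr (- \<nu>)"
    unfolding reg_kernel_def using tendsto_powr[OF q tendsto_const nz, of "- (\<nu> / 2)"] by (simp add: e)
  have "((norm z)\<^sup>2) powr (- (\<nu> / 2) - 1) = norm z powr (- \<nu>) / (norm z)\<^sup>2"
    using z by (simp add: powr_diff e)
  then show "(\<lambda>n. reg_kernel_rate \<nu> (\<delta> n) z) \<longlonglongrightarrow> - \<nu> * norm z powr (- \<nu>) / (norm z)\<^sup>2"
    unfolding reg_kernel_rate_def
    using tendsto_mult[OF tendsto_const tendsto_powr[OF q tendsto_const nz, of "- (\<nu> / 2) - 1"], of "- \<nu>"]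
    by simp
qed

lemma virial_measurable:
  assumes "cutoff_field X d"
  shows "(\<lambda>(x, y). virial \<nu> X d x y) \<in> borel_measurable (borel \<Otimes>\<^sub>M borel)"
proof -
  note [measurable] = cutoff_field_borel[OF assms] bounded_support_borel[OF divergence_bounded_support[OF assms]]
  show ?thesis unfolding virial_def[abs_def] by measurable
qed

text \<open>Adding the identities of the two unknowns, the second with its variables exchanged, pairs the gradient
  of the kernel with \<open>X x - X y\<close>, because the kernel is even and its gradient is odd. The result is bounded
  by a multiple of the singular kernel, so that \<open>\<delta>\<close> can tend to 0.\<close>

lemma virial_identity:
  fixes u v :: "'a::euclidean_space \<Rightarrow> real"
  assumes \<alpha>: "0 < \<alpha>" "\<alpha> < real DIM('a)"
    and \<theta>: "\<theta> > 1" "\<tau> > 1" "1 / \<theta> + 1 / \<tau> = (real DIM('a) + \<alpha>) / real DIM('a)"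
    and p: "p > 1" and q: "q > 1"
    and u: "sobolev_pow (\<theta> * p) u A" and v: "sobolev_pow (\<tau> * q) v B"
    and X: "cutoff_field X d" and L: "L \<ge> 0" "\<And>x y. norm (X x - X y) \<le> L * norm (x - y)"
  defines "\<nu> \<equiv> real DIM('a) - \<alpha>"
  shows "(LINT z|lborel2. (case z of (x, y) \<Rightarrow> norm (x - y) powr (- \<nu>) * (power_flux p u A X x * \<bar>v y\<bar> powr q)))
      + (LINT z|lborel2. (case z of (x, y) \<Rightarrow> norm (x - y) powr (- \<nu>) * (\<bar>u x\<bar> powr p * power_flux q v B X y)))
    = - (LINT z|lborel2. (case z of (x, y) \<Rightarrow> virial \<nu> X d x y * (\<bar>u x\<bar> powr p * \<bar>v y\<bar> powr q)))"
proof -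
  have \<nu>: "\<nu> > 0" using \<alpha> by (simp add: \<nu>_def)
  have \<theta>': "1 / \<tau> + 1 / \<theta> = (real DIM('a) + \<alpha>) / real DIM('a)" using \<theta>(3) by simp
  have fu: "pow_integrable \<theta> (power_flux p u A X)" by (rule power_flux_pow_integrable[OF u X p \<theta>(1)])
  have fv: "pow_integrable \<tau> (power_flux q v B X)" by (rule power_flux_pow_integrable[OF v X q \<theta>(2)])
  have up: "pow_integrable \<theta> (\<lambda>x. \<bar>u x\<bar> powr p)"
    using u unfolding sobolev_pow_def by (intro pow_integrable_abs_powr) blast
  have vq: "pow_integrable \<tau> (\<lambda>x. \<bar>v x\<bar> powr q)"
    using v unfolding sobolev_pow_def by (intro pow_integrable_abs_powr) blast
  note hls = hls_integrable[OF \<alpha> \<theta>, folded \<nu>_def]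
  note h1 = hls[OF fu vq] and h2 = hls[OF up fv] and h3 = hls[OF up vq]
  define \<delta> where "\<delta> n = 1 / real (Suc n)" for n
  have \<delta>: "\<delta> n > 0" for n by (simp add: \<delta>_def)
  have \<delta>0: "\<delta> \<longlonglongrightarrow> 0"
    unfolding \<delta>_def using LIMSEQ_inverse_real_of_nat by (simp only: inverse_eq_divide)
  let ?V = "\<lambda>n x y. reg_virial \<nu> (\<delta> n) X d x y + reg_virial \<nu> (\<delta> n) X d y x"
  have ident: "(LINT z|lborel2. (case z of (x, y) \<Rightarrow> reg_kernel \<nu> (\<delta> n) (x - y) * (power_flux p u A X x * \<bar>v y\<bar> powr q)))
      + (LINT z|lborel2. (case z of (x, y) \<Rightarrow> reg_kernel \<nu> (\<delta> n) (x - y) * (\<bar>u x\<bar> powr p * power_flux q v B X y)))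
    = - (LINT z|lborel2. (case z of (x, y) \<Rightarrow> ?V n x y * (\<bar>u x\<bar> powr p * \<bar>v y\<bar> powr q)))" for n
  proof -
    obtain C where C: "\<And>x y. x \<noteq> y \<Longrightarrow> \<bar>reg_virial \<nu> (\<delta> n) X d x y\<bar> \<le> C * norm (x - y) powr (- \<nu>)"
      using reg_virial_bound[OF X \<nu> \<delta>] by blast
    have i1: "integrable lborel2 (\<lambda>(x, y). reg_virial \<nu> (\<delta> n) X d x y * (\<bar>u x\<bar> powr p * \<bar>v y\<bar> powr q))"
      by (rule integrable_kernel_bound[OF h3 pow_integrable_borel[OF up] pow_integrable_borel[OF vq]
            reg_virial_measurable[OF X] C])
    have C': "\<bar>reg_virial \<nu> (\<delta> n) X d y x\<bar> \<le> C * norm (x - y) powr (- \<nu>)" if "x \<noteq> y" for x y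
      using C[of y x] that by (simp add: norm_minus_commute)
    have m': "(\<lambda>(x, y). reg_virial \<nu> (\<delta> n) X d y x) \<in> borel_measurable (borel \<Otimes>\<^sub>M borel)"
      using measurable_compose[OF measurable_pair_swap' reg_virial_measurable[OF X, of \<nu> "\<delta> n"]]
      by (simp add: case_prod_beta)
    have i2: "integrable lborel2 (\<lambda>(x, y). reg_virial \<nu> (\<delta> n) X d y x * (\<bar>u x\<bar> powr p * \<bar>v y\<bar> powr q))"
      by (rule integrable_kernel_bound[OF h3 pow_integrable_borel[OF up] pow_integrable_borel[OF vq] m' C'])
    have i3: "integrable lborel2 (\<lambda>(x, y). reg_kernel \<nu> (\<delta> n) (x - y) * (\<bar>u x\<bar> powr p * power_flux q v B X y))"
      by (rule integrable_kernel_bound[OF h2 pow_integrable_borel[OF up] pow_integrable_borel[OF fv]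
            reg_kernel_measurable2 reg_kernel_bound2[OF \<nu>]])
    have e: "reg_kernel \<nu> (\<delta> n) (y - x) = reg_kernel \<nu> (\<delta> n) (x - y)" for x y :: 'a
      by (simp add: reg_kernel_def norm_minus_commute)
    have s1: "(LINT z|lborel2. (case z of (x, y) \<Rightarrow> reg_kernel \<nu> (\<delta> n) (x - y) * (\<bar>u x\<bar> powr p * power_flux q v B X y)))
        = (LINT z|lborel2. (case z of (x, y) \<Rightarrow> reg_kernel \<nu> (\<delta> n) (x - y) * (power_flux q v B X x * \<bar>u y\<bar> powr p)))"
      using integral_lborel2_swap[OF borel_measurable_integrable[OF i3]] by (simp add: e mult_ac)
    have s2: "(LINT z|lborel2. (case z of (x, y) \<Rightarrow> reg_virial \<nu> (\<delta> n) X d x y * (\<bar>v x\<bar> powr q * \<bar>u y\<bar> powr p)))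
        = (LINT z|lborel2. (case z of (x, y) \<Rightarrow> reg_virial \<nu> (\<delta> n) X d y x * (\<bar>u x\<bar> powr p * \<bar>v y\<bar> powr q)))"
      using integral_lborel2_swap[OF borel_measurable_integrable[OF i2]] by (simp add: mult_ac)
    have "(LINT z|lborel2. (case z of (x, y) \<Rightarrow> ?V n x y * (\<bar>u x\<bar> powr p * \<bar>v y\<bar> powr q)))
      = (LINT z|lborel2. (case z of (x, y) \<Rightarrow> reg_virial \<nu> (\<delta> n) X d x y * (\<bar>u x\<bar> powr p * \<bar>v y\<bar> powr q)))
      + (LINT z|lborel2. (case z of (x, y) \<Rightarrow> reg_virial \<nu> (\<delta> n) X d y x * (\<bar>u x\<bar> powr p * \<bar>v y\<bar> powr q)))"
      by (subst Bochner_Integration.integral_add[OF i1 i2, symmetric]) (simp add: case_prod_unfold distrib_right)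
    then show ?thesis
      using reg_virial_identity[OF \<alpha> \<theta> p u vq X \<delta>, of n, folded \<nu>_def]
        reg_virial_identity[OF \<alpha> \<theta>(2,1) \<theta>' q v up X \<delta>, of n, folded \<nu>_def] s1 s2 by linarith
  qed
  obtain D where D: "D > 0" "\<And>x. \<bar>divergence d x\<bar> \<le> D"
    using divergence_bounded_support[OF X] by (rule bounded_supportE) blast
  have Veq: "?V n x y = reg_kernel \<nu> (\<delta> n) (x - y) * (divergence d x + divergence d y)
      + reg_kernel_rate \<nu> (\<delta> n) (x - y) * ((x - y) \<bullet> (X x - X y))" for n x y
  proof -
    have "reg_kernel \<nu> (\<delta> n) (y - x) = reg_kernel \<nu> (\<delta> n) (x - y)"
      "reg_kernel_rate \<nu> (\<delta> n) (y - x) = reg_kernel_rate \<nu> (\<delta> n) (x - y)"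
      by (simp_all add: reg_kernel_def reg_kernel_rate_def norm_minus_commute)
    then show ?thesis by (simp add: reg_virial_def inner_diff_left inner_diff_right algebra_simps)
  qed
  have Vb: "\<bar>?V n x y\<bar> \<le> (2 * D + \<nu> * L) * norm (x - y) powr (- \<nu>)" if "x \<noteq> y" for n x y
  proof -
    let ?R = "reg_kernel \<nu> (\<delta> n) (x - y)"
    have R: "?R \<ge> 0" by (rule reg_kernel_nonneg)
    have "\<bar>divergence d x + divergence d y\<bar> \<le> 2 * D" using D(2)[of x] D(2)[of y] by linarith
    then have "\<bar>?R * (divergence d x + divergence d y)\<bar> \<le> ?R * (2 * D)"
      using R by (simp add: abs_mult mult_left_mono)
    moreover have "\<bar>reg_kernel_rate \<nu> (\<delta> n) (x - y) * ((x - y) \<bullet> (X x - X y))\<bar> \<le> (\<nu> * L) * ?R"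
      by (rule reg_kernel_rate_Lipschitz_bound[OF \<delta> \<nu> L(2,1)])
    ultimately have "\<bar>?V n x y\<bar> \<le> ?R * (2 * D) + (\<nu> * L) * ?R" unfolding Veq by linarith
    also have "\<dots> = (2 * D + \<nu> * L) * ?R" by (simp add: algebra_simps)
    also have "\<dots> \<le> (2 * D + \<nu> * L) * norm (x - y) powr (- \<nu>)"
      using reg_kernel_le[OF \<nu>, of "x - y" "\<delta> n"] that D(1) L(1) \<nu> by (intro mult_left_mono) auto
    finally show ?thesis .
  qed
  have Vm: "(\<lambda>(x, y). ?V n x y) \<in> borel_measurable (borel \<Otimes>\<^sub>M borel)" for n
  proof -
    have "(\<lambda>(x, y). reg_virial \<nu> (\<delta> n) X d y x) \<in> borel_measurable (borel \<Otimes>\<^sub>M borel)"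
      using measurable_compose[OF measurable_pair_swap' reg_virial_measurable[OF X, of \<nu> "\<delta> n"]]
      by (simp add: case_prod_beta)
    from borel_measurable_add[OF reg_virial_measurable[OF X, of \<nu> "\<delta> n"] this]
    show ?thesis by (simp add: case_prod_beta)
  qed
  have Vlim: "(\<lambda>n. ?V n x y) \<longlonglongrightarrow> virial \<nu> X d x y" if "x \<noteq> y" for x y
  proof -
    have "x - y \<noteq> 0" using that by simp
    note lim = reg_kernel_tendsto[OF this \<delta>0, of \<nu>]
    have "(\<lambda>n. ?V n x y) \<longlonglongrightarrow> norm (x - y) powr (- \<nu>) * (divergence d x + divergence d y)
      + (- \<nu> * norm (x - y) powr (- \<nu>) / (norm (x - y))\<^sup>2) * ((x - y) \<bullet> (X x - X y))"
      unfolding Veq by (intro tendsto_add tendsto_mult lim tendsto_const)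
    moreover have "K * a + (- \<nu> * K / m) * s = K * (a - \<nu> * s / m)" for K a m s :: real
      by (simp add: right_diff_distrib mult_ac)
    ultimately show ?thesis unfolding virial_def by (simp only:)
  qed
  have Kb: "\<bar>reg_kernel \<nu> (\<delta> n) (x - y)\<bar> \<le> 1 * norm (x - y) powr (- \<nu>)" if "x \<noteq> y" for n and x y :: 'a
    by (rule reg_kernel_bound2[OF \<nu> that])
  have Kl: "(\<lambda>n. reg_kernel \<nu> (\<delta> n) (x - y)) \<longlonglongrightarrow> norm (x - y) powr (- \<nu>)" if "x \<noteq> y" for x y :: 'a
    by (rule reg_kernel_tendsto(1)[OF _ \<delta>0]) (use that in simp)
  have Km: "(\<lambda>(x, y). norm (x - y :: 'a) powr (- \<nu>)) \<in> borel_measurable (borel \<Otimes>\<^sub>M borel)" by measurable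
  note lim1 = kernel_dominated_convergence[OF h1 pow_integrable_borel[OF fu] pow_integrable_borel[OF vq]
      reg_kernel_measurable2 Km Kb Kl]
  note lim2 = kernel_dominated_convergence[OF h2 pow_integrable_borel[OF up] pow_integrable_borel[OF fv]
      reg_kernel_measurable2 Km Kb Kl]
  note lim3 = kernel_dominated_convergence[OF h3 pow_integrable_borel[OF up] pow_integrable_borel[OF vq]
      Vm virial_measurable[OF X] Vb Vlim]
  show ?thesis
    using LIMSEQ_unique[OF tendsto_add[OF lim1 lim2, unfolded ident] tendsto_minus[OF lim3]] .
qed

section \<open>Cutting off the dilation field\<close>

definition bump_base :: "real \<Rightarrow> 'a::euclidean_space \<Rightarrow> real" where
  "bump_base R x = max 0 (1 - (norm x / R)\<^sup>2)"

text \<open>The square of a Lipschitz function of the distance to the origin: it has a continuous gradient, and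
  the derivative of the cutoff field is bounded uniformly in the radius \<open>R\<close>.\<close>

definition cutoff :: "real \<Rightarrow> 'a::euclidean_space \<Rightarrow> real" where
  "cutoff R x = (bump_base R x)\<^sup>2"

definition cutoff_deriv :: "real \<Rightarrow> 'a \<Rightarrow> 'a::euclidean_space \<Rightarrow> real" where
  "cutoff_deriv R b x = - 4 * bump_base R x * (x \<bullet> b) / R\<^sup>2"

definition dilation :: "real \<Rightarrow> 'a::euclidean_space \<Rightarrow> 'a" where
  "dilation R x = cutoff R x *\<^sub>R x"

definition dilation_deriv :: "real \<Rightarrow> 'a \<Rightarrow> 'a \<Rightarrow> 'a::euclidean_space \<Rightarrow> real" where
  "dilation_deriv R b c x = cutoff_deriv R b x * (x \<bullet> c) + cutoff R x * (b \<bullet> c)"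

lemma DERIV_max_square: "((\<lambda>t. (max 0 t)\<^sup>2) has_real_derivative 2 * max 0 t) (at (t::real))"
proof -
  consider "t > 0" | "t < 0" | "t = 0" by linarith
  then show ?thesis
  proof cases
    case 1
    have "((\<lambda>t. t\<^sup>2) has_real_derivative 2 * max 0 t) (at t)"
      using 1 by (auto intro!: derivative_eq_intros)
    then show ?thesis
      by (rule has_field_derivative_transform_within_open[of _ _ _ "{0<..}"]) (use 1 in auto)
  next
    case 2
    have "((\<lambda>t. 0) has_real_derivative 2 * max 0 t) (at t)" using 2 by auto
    then show ?thesis
      by (rule has_field_derivative_transform_within_open[of _ _ _ "{..<0}"]) (use 2 in auto)
  next
    case 3
    have "((\<lambda>h::real. max 0 h) \<longlongrightarrow> max 0 0) (at 0)" by (intro tendsto_intros)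
    then have "((\<lambda>h::real. max 0 h) \<longlongrightarrow> 0) (at 0)" by simp
    then have "((\<lambda>h::real. ((max 0 (0 + h))\<^sup>2 - (max 0 0)\<^sup>2) / h) \<longlongrightarrow> 0) (at 0)"
      by (rule Lim_transform_eventually)
        (auto simp: eventually_at_filter max_def power2_eq_square)
    then show ?thesis using 3 by (simp add: DERIV_def)
  qed
qed

lemma bump_base_bounds: "0 \<le> bump_base R x" "bump_base R x \<le> 1"
  by (auto simp: bump_base_def)

lemma bump_base_support:
  assumes "R > 0" "R < norm x" shows "bump_base R x = 0"
proof -
  have "1 < norm x / R" using assms by simp
  then have "1 < (norm x / R)\<^sup>2" by (simp add: one_less_power)
  then show ?thesis by (simp add: bump_base_def)
qed

lemma cutoff_bounds: "0 \<le> cutoff R x" "cutoff R x \<le> 1"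
  using bump_base_bounds[of R x] by (auto simp: cutoff_def power_le_one)

lemma bump_base_borel [measurable]: "bump_base R \<in> borel_measurable borel"
  unfolding bump_base_def[abs_def] by measurable

lemma cutoff_borel [measurable]: "cutoff R \<in> borel_measurable borel" "cutoff_deriv R b \<in> borel_measurable borel"
  unfolding cutoff_def[abs_def] cutoff_deriv_def[abs_def] by measurable

lemma cutoff_deriv_bound:
  fixes x :: "'a::euclidean_space"
  assumes R: "R > 0" and b: "b \<in> Basis"
  shows "\<bar>cutoff_deriv R b x\<bar> \<le> 4 / R"
    "c \<in> Basis \<Longrightarrow> \<bar>cutoff_deriv R b x * (x \<bullet> c)\<bar> \<le> 4"
proof -
  have le: "bump_base R x * \<bar>x \<bullet> b\<bar> \<le> R"
  proof (cases "norm x \<le> R")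
    case True
    have "bump_base R x * \<bar>x \<bullet> b\<bar> \<le> 1 * norm x"
      using bump_base_bounds[of R x] Basis_le_norm[OF b, of x] by (intro mult_mono) auto
    then show ?thesis using True by simp
  qed (use bump_base_support[OF R, of x] R in simp)
  have e: "\<bar>cutoff_deriv R b x\<bar> = 4 * (bump_base R x * \<bar>x \<bullet> b\<bar>) / R\<^sup>2"
    using bump_base_bounds(1)[of R x] by (simp add: cutoff_deriv_def abs_mult)
  also have "\<dots> \<le> 4 * R / R\<^sup>2" using le by (intro divide_right_mono mult_left_mono) auto
  finally show 1: "\<bar>cutoff_deriv R b x\<bar> \<le> 4 / R" using R by (simp add: power2_eq_square)
  assume c: "c \<in> Basis"
  show "\<bar>cutoff_deriv R b x * (x \<bullet> c)\<bar> \<le> 4"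
  proof (cases "norm x \<le> R")
    case True
    have "\<bar>cutoff_deriv R b x * (x \<bullet> c)\<bar> \<le> (4 / R) * R"
      unfolding abs_mult using 1 Basis_le_norm[OF c, of x] True R by (intro mult_mono) auto
    then show ?thesis using R by simp
  qed (use bump_base_support[OF R, of x] in \<open>simp add: cutoff_deriv_def\<close>)
qed

lemma cutoff_bounded_support:
  assumes "R > 0" "b \<in> Basis"
  shows "bounded_support (cutoff R :: 'a::euclidean_space \<Rightarrow> real)"
    "bounded_support (cutoff_deriv R b :: 'a \<Rightarrow> real)"
proof -
  show "bounded_support (cutoff R :: 'a \<Rightarrow> real)"
  proof (rule bounded_supportI[where C=1 and R=R])
    show "\<bar>cutoff R x\<bar> \<le> 1" for x :: 'a using cutoff_bounds[of R x] by simp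
    show "R < norm x \<Longrightarrow> cutoff R x = 0" for x :: 'a
      using bump_base_support[OF assms(1), of x] by (simp add: cutoff_def)
  qed measurable
  show "bounded_support (cutoff_deriv R b :: 'a \<Rightarrow> real)"
  proof (rule bounded_supportI[where C="4 / R" and R=R])
    show "\<bar>cutoff_deriv R b x\<bar> \<le> 4 / R" for x by (rule cutoff_deriv_bound(1)[OF assms])
    show "R < norm x \<Longrightarrow> cutoff_deriv R b x = 0" for x
      using bump_base_support[OF assms(1), of x] by (simp add: cutoff_deriv_def)
  qed measurable
qed

lemma cutoff_line_deriv:
  fixes b :: "'a::euclidean_space"
  shows "line_deriv b (cutoff R) (cutoff_deriv R b)"
  unfolding line_deriv_def
proof
  fix x :: 'a
  let ?q = "\<lambda>t. 1 - ((norm x)\<^sup>2 + 2 * t * (x \<bullet> b) + t * t * (b \<bullet> b)) * (1 / R\<^sup>2)"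
  have "((\<lambda>t. 1 - ((norm x)\<^sup>2 + 2 * t * (x \<bullet> b) + t * t * (b \<bullet> b)) * k) has_real_derivative - (2 * (x \<bullet> b) * k)) (at 0)"
    for k :: real by (auto intro!: derivative_eq_intros)
  note q = this[of "1 / R\<^sup>2"]
  have eq: "(\<lambda>t. cutoff R (x + t *\<^sub>R b)) = (\<lambda>t. (max 0 (?q t))\<^sup>2)"
  proof
    fix t
    have "(norm (x + t *\<^sub>R b) / R)\<^sup>2 = ((norm x)\<^sup>2 + 2 * t * (x \<bullet> b) + t * t * (b \<bullet> b)) / R\<^sup>2"
      unfolding power_divide power2_norm_eq_inner
      by (simp add: inner_add_left inner_add_right inner_commute[of b x] algebra_simps)
    then show "cutoff R (x + t *\<^sub>R b) = (max 0 (?q t))\<^sup>2" by (simp add: cutoff_def bump_base_def)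
  qed
  have "((\<lambda>t. (max 0 (?q t))\<^sup>2) has_real_derivative 2 * max 0 (?q 0) * - (2 * (x \<bullet> b) * (1 / R\<^sup>2))) (at 0)"
    by (rule DERIV_chain2[OF DERIV_max_square q])
  moreover have "2 * max 0 (?q 0) * - (2 * (x \<bullet> b) * (1 / R\<^sup>2)) = cutoff_deriv R b x"
    by (simp add: cutoff_deriv_def bump_base_def power_divide)
  ultimately show "((\<lambda>t. cutoff R (x + t *\<^sub>R b)) has_real_derivative cutoff_deriv R b x) (at 0)"
    unfolding eq by simp
qed

lemma dilation_cutoff_field:
  assumes R: "R > 0"
  shows "cutoff_field (dilation R) (dilation_deriv R :: 'a::euclidean_space \<Rightarrow> 'a \<Rightarrow> 'a \<Rightarrow> real)"
  unfolding cutoff_field_def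
proof (intro ballI conjI)
  fix b c :: 'a assume c: "c \<in> Basis" and b: "b \<in> Basis"
  have l: "locally_bounded (\<lambda>x::'a. x \<bullet> c)" by (intro locally_bounded_continuous continuous_intros)
  have e: "(\<lambda>x::'a. dilation R x \<bullet> c) = (\<lambda>x. cutoff R x * (x \<bullet> c))" by (simp add: dilation_def)
  show "bounded_support (dilation_deriv R b c)"
    unfolding dilation_deriv_def[abs_def]
    by (intro bounded_support_add bounded_support_mult cutoff_bounded_support[OF R b] l locally_bounded_const)
  have "line_deriv b (\<lambda>x::'a. x \<bullet> c) (\<lambda>x. b \<bullet> c)"
    unfolding line_deriv_def by (auto intro!: derivative_eq_intros simp: inner_add_left)
  from line_deriv_mult[OF cutoff_line_deriv this]
  show "line_deriv b (\<lambda>x::'a. dilation R x \<bullet> c) (dilation_deriv R b c)"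
    unfolding e dilation_deriv_def[abs_def] .
next
  fix c :: 'a assume c: "c \<in> Basis"
  have l: "locally_bounded (\<lambda>x::'a. x \<bullet> c)" by (intro locally_bounded_continuous continuous_intros)
  have e: "(\<lambda>x::'a. dilation R x \<bullet> c) = (\<lambda>x. cutoff R x * (x \<bullet> c))" by (simp add: dilation_def)
  show "bounded_support (\<lambda>x::'a. dilation R x \<bullet> c)"
    unfolding e by (intro bounded_support_mult cutoff_bounded_support[OF R c] l)
qed

lemma dilation_deriv_bound:
  assumes "R > 0" "b \<in> Basis" "c \<in> Basis"
  shows "\<bar>dilation_deriv R b c x\<bar> \<le> 5"
proof -
  have "\<bar>cutoff R x * (b \<bullet> c)\<bar> \<le> 1"
    using cutoff_bounds[of R x] assms by (auto simp: abs_mult inner_Basis)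
  then show ?thesis
    using cutoff_deriv_bound(2)[OF assms, of x] unfolding dilation_deriv_def by linarith
qed

text \<open>The cutoff is \<open>4 / R\<close>-Lipschitz, and one of the two points may be taken in the ball of radius \<open>R\<close>, since
  the field vanishes outside.\<close>

lemma dilation_Lipschitz:
  fixes x y :: "'a::euclidean_space"
  assumes R: "R > 0"
  shows "norm (dilation R x - dilation R y) \<le> 5 * norm (x - y)"
proof -
  have base: "\<bar>bump_base R x - bump_base R y\<bar> \<le> 2 * norm (x - y) / R" for x y :: 'a
  proof -
    let ?s = "min 1 (norm x / R)" and ?t = "min 1 (norm y / R)"
    have e: "bump_base R w = 1 - (min 1 (norm w / R))\<^sup>2" for w :: 'a
    proof (cases "norm w / R \<le> 1")
      case True
      then have "(norm w / R)\<^sup>2 \<le> 1" using R by (simp add: power_le_one)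
      then show ?thesis using True by (simp add: bump_base_def)
    next
      case False
      then have "1 \<le> (norm w / R)\<^sup>2" by (simp add: one_le_power)
      then show ?thesis using False by (simp add: bump_base_def)
    qed
    have st: "0 \<le> ?s" "?s \<le> 1" "0 \<le> ?t" "?t \<le> 1" using R by auto
    have "\<bar>?s - ?t\<bar> \<le> \<bar>norm x / R - norm y / R\<bar>" by (auto simp: min_def)
    also have "\<dots> = \<bar>norm x - norm y\<bar> / R" using R by (simp add: diff_divide_distrib[symmetric])
    also have "\<dots> \<le> norm (x - y) / R" using R norm_triangle_ineq3[of x y] by (intro divide_right_mono) auto
    finally have d: "\<bar>?s - ?t\<bar> \<le> norm (x - y) / R" .
    have "bump_base R x - bump_base R y = (?t - ?s) * (?s + ?t)"
      unfolding e by (simp add: power2_eq_square algebra_simps)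
    then have "\<bar>bump_base R x - bump_base R y\<bar> = \<bar>?s - ?t\<bar> * (?s + ?t)"
      using st by (simp add: abs_mult abs_minus_commute)
    also have "\<dots> \<le> (norm (x - y) / R) * 2" using d st by (intro mult_mono) auto
    finally show ?thesis by (simp add: mult.commute)
  qed
  have cut: "\<bar>cutoff R x - cutoff R y\<bar> \<le> 4 * norm (x - y) / R" for x y :: 'a
  proof -
    have "cutoff R x - cutoff R y = (bump_base R x - bump_base R y) * (bump_base R x + bump_base R y)"
      by (simp add: cutoff_def power2_eq_square algebra_simps)
    then have "\<bar>cutoff R x - cutoff R y\<bar> = \<bar>bump_base R x - bump_base R y\<bar> * (bump_base R x + bump_base R y)"
      using bump_base_bounds[of R x] bump_base_bounds[of R y] by (simp add: abs_mult)
    also have "\<dots> \<le> (2 * norm (x - y) / R) * 2"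
      using base[of x y] bump_base_bounds[of R x] bump_base_bounds[of R y] by (intro mult_mono) auto
    finally show ?thesis by simp
  qed
  have inside: "norm (dilation R x - dilation R y) \<le> 5 * norm (x - y)" if x: "norm x \<le> R" for x y :: 'a
  proof -
    have "dilation R x - dilation R y = cutoff R y *\<^sub>R (x - y) + (cutoff R x - cutoff R y) *\<^sub>R x"
      by (simp add: dilation_def algebra_simps)
    then have "norm (dilation R x - dilation R y) \<le> norm (cutoff R y *\<^sub>R (x - y)) + norm ((cutoff R x - cutoff R y) *\<^sub>R x)"
      by (simp only:) (rule norm_triangle_ineq)
    also have "norm (cutoff R y *\<^sub>R (x - y)) \<le> norm (x - y)"
      using cutoff_bounds[of R y] by (simp add: mult_left_le_one_le)
    also have "norm ((cutoff R x - cutoff R y) *\<^sub>R x) \<le> (4 * norm (x - y) / R) * R"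
      unfolding norm_scaleR real_norm_def using cut[of x y] x R by (intro mult_mono) auto
    also have "\<dots> = 4 * norm (x - y)" using R by simp
    finally show ?thesis by simp
  qed
  have zero: "dilation R w = 0" if "\<not> norm w \<le> R" for w :: 'a
    using bump_base_support[OF R, of w] that by (simp add: dilation_def cutoff_def)
  show ?thesis
  proof (cases "norm x \<le> R")
    case False
    note f = this
    show ?thesis
    proof (cases "norm y \<le> R")
      case True
      from inside[OF this, of x] show ?thesis by (simp add: norm_minus_commute)
    qed (use f zero in simp)
  qed (rule inside)
qed

lemma cutoff_limits:
  fixes x :: "'a::euclidean_space"
  shows "(\<lambda>n. cutoff (real (Suc n)) x) \<longlonglongrightarrow> 1"
    "(\<lambda>n. cutoff_deriv (real (Suc n)) b x) \<longlonglongrightarrow> 0"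
    "(\<lambda>n. dilation_deriv (real (Suc n)) b c x) \<longlonglongrightarrow> b \<bullet> c"
    "(\<lambda>n. dilation (real (Suc n)) x) \<longlonglongrightarrow> x"
proof -
  have l: "(\<lambda>n. 1 / real (Suc n)) \<longlonglongrightarrow> 0"
    using LIMSEQ_inverse_real_of_nat by (simp only: inverse_eq_divide)
  have "(\<lambda>n. max 0 (1 - (norm x * (1 / real (Suc n)))\<^sup>2)) \<longlonglongrightarrow> max 0 (1 - (norm x * 0)\<^sup>2)"
    by (intro tendsto_intros l)
  then have b: "(\<lambda>n. bump_base (real (Suc n)) x) \<longlonglongrightarrow> 1" by (simp add: bump_base_def)
  from tendsto_power[OF this, of 2] show c1: "(\<lambda>n. cutoff (real (Suc n)) x) \<longlonglongrightarrow> 1"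
    by (simp add: cutoff_def)
  have "(\<lambda>n. - 4 * bump_base (real (Suc n)) x * (x \<bullet> b) * (1 / real (Suc n))\<^sup>2) \<longlonglongrightarrow> - 4 * 1 * (x \<bullet> b) * 0\<^sup>2"
    by (intro tendsto_mult tendsto_power tendsto_const b l)
  then show c2: "(\<lambda>n. cutoff_deriv (real (Suc n)) b x) \<longlonglongrightarrow> 0"
    by (simp add: cutoff_deriv_def power_divide)
  have "(\<lambda>n. cutoff_deriv (real (Suc n)) b x * (x \<bullet> c) + cutoff (real (Suc n)) x * (b \<bullet> c)) \<longlonglongrightarrow> 0 * (x \<bullet> c) + 1 * (b \<bullet> c)"
    by (intro tendsto_add tendsto_mult tendsto_const c1 c2)
  then show "(\<lambda>n. dilation_deriv (real (Suc n)) b c x) \<longlonglongrightarrow> b \<bullet> c" by (simp add: dilation_deriv_def)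
  from tendsto_scaleR[OF c1 tendsto_const[of x]] show "(\<lambda>n. dilation (real (Suc n)) x) \<longlonglongrightarrow> x"
    by (simp add: dilation_def)
qed

section \<open>The energy and Pohozaev identities of one equation\<close>

lemma bounded_multiplier_limit:
  fixes f :: "'a::euclidean_space \<Rightarrow> real"
  assumes f: "integrable lborel f" and k: "\<And>n. k n \<in> borel_measurable borel" "\<And>n x. \<bar>k n x\<bar> \<le> C"
    and lim: "\<And>x. (\<lambda>n. k n x) \<longlonglongrightarrow> l"
  shows "(\<lambda>n. LINT x|lborel. k n x * f x) \<longlonglongrightarrow> l * (LINT x|lborel. f x)"
proof -
  have [measurable]: "f \<in> borel_measurable borel" "k n \<in> borel_measurable borel" for n
    using borel_measurable_integrable[OF f] k(1) by auto
  have "(\<lambda>n. LINT x|lborel. k n x * f x) \<longlonglongrightarrow> (LINT x|lborel. l * f x)"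
  proof (rule integral_dominated_convergence)
    show "integrable lborel (\<lambda>x. C * \<bar>f x\<bar>)" using f by simp
    show "AE x in lborel. (\<lambda>n. k n x * f x) \<longlonglongrightarrow> l * f x"
      by (intro AE_I2 tendsto_mult lim tendsto_const)
    show "AE x in lborel. norm (k n x * f x) \<le> C * \<bar>f x\<bar>" for n
      by (intro AE_I2) (simp add: abs_mult mult_right_mono k(2))
  qed measurable
  then show ?thesis by simp
qed

lemma pow_integrable_2_mult:
  assumes f: "pow_integrable 2 f" and g: "pow_integrable 2 g"
  shows "integrable lborel (\<lambda>x. f x * g x)"
proof -
  note [measurable] = pow_integrable_borel[OF f] pow_integrable_borel[OF g]
  show ?thesis
  proof (rule Bochner_Integration.integrable_bound)
    show "integrable lborel (\<lambda>x. \<bar>f x\<bar> powr 2 + \<bar>g x\<bar> powr 2)"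
      by (intro Bochner_Integration.integrable_add pow_integrableD f g)
    show "AE x in lborel. norm (f x * g x) \<le> norm (\<bar>f x\<bar> powr 2 + \<bar>g x\<bar> powr 2)"
    proof (rule AE_I2)
      fix x
      have "2 * (\<bar>f x\<bar> * \<bar>g x\<bar>) \<le> (f x)\<^sup>2 + (g x)\<^sup>2" using sum_squares_bound[of "\<bar>f x\<bar>" "\<bar>g x\<bar>"] by simp
      moreover have "0 \<le> \<bar>f x\<bar> * \<bar>g x\<bar>" by simp
      ultimately have "\<bar>f x\<bar> * \<bar>g x\<bar> \<le> (f x)\<^sup>2 + (g x)\<^sup>2" by linarith
      then show "norm (f x * g x) \<le> norm (\<bar>f x\<bar> powr 2 + \<bar>g x\<bar> powr 2)" by (simp add: abs_mult)
    qed
  qed measurable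
qed

lemma energy_identity:
  fixes u :: "'a::euclidean_space \<Rightarrow> real"
  assumes r: "r \<ge> 1" and u2: "sobolev_pow 2 u A" and ur: "sobolev_pow r u A"
    and eq: "\<And>\<phi>. \<phi> \<in> test_functions UNIV \<Longrightarrow>
      (LINT x|lborel. (\<Sum>b\<in>Basis. A b x * partial_deriv b \<phi> x) + u x * \<phi> x) = (LINT x|lborel. F x * \<phi> x)"
    and F: "F \<in> borel_measurable borel" "\<And>h. pow_integrable r h \<Longrightarrow> integrable lborel (\<lambda>x. F x * h x)"
  shows "(LINT x|lborel. F x * u x) = (\<Sum>b\<in>Basis. LINT x|lborel. A b x * A b x) + (LINT x|lborel. u x * u x)"
proof -
  have u: "pow_integrable 2 u" "pow_integrable r u" "\<And>b. b \<in> Basis \<Longrightarrow> weak_partial b u (A b)"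
    "\<And>b. b \<in> Basis \<Longrightarrow> pow_integrable 2 (A b)"
    using u2 ur unfolding sobolev_pow_def by auto
  let ?R = "\<lambda>n. real (Suc n)"
  have id: "(LINT x|lborel. F x * (cutoff (?R n) x * u x))
    = (\<Sum>b\<in>Basis. (LINT x|lborel. cutoff_deriv (?R n) b x * (A b x * u x)) + (LINT x|lborel. cutoff (?R n) x * (A b x * A b x)))
      + (LINT x|lborel. cutoff (?R n) x * (u x * u x))" for n
    by (rule energy_half[OF r u(3,1,4,2) eq F])
      (use cutoff_bounded_support[of "?R n"] cutoff_line_deriv SOME_Basis in auto)
  have c: "\<bar>cutoff (?R n) x\<bar> \<le> 1" for n and x :: 'a using cutoff_bounds[of "?R n" x] by auto
  have c': "\<bar>cutoff_deriv (?R n) b x\<bar> \<le> 4" if "b \<in> Basis" for n b and x :: 'a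
  proof -
    have "4 / ?R n \<le> 4" by (simp add: field_simps)
    then show ?thesis using cutoff_deriv_bound(1)[of "?R n" b x] that by linarith
  qed
  have l1: "(\<lambda>n. LINT x|lborel. cutoff (?R n) x * f x) \<longlonglongrightarrow> 1 * (LINT x|lborel. f x)"
    if "integrable lborel f" for f :: "'a \<Rightarrow> real"
    by (rule bounded_multiplier_limit[OF that _ c cutoff_limits(1)]) measurable
  have l2: "(\<lambda>n. LINT x|lborel. cutoff_deriv (?R n) b x * f x) \<longlonglongrightarrow> 0 * (LINT x|lborel. f x)"
    if "integrable lborel f" "b \<in> Basis" for f :: "'a \<Rightarrow> real" and b
    by (rule bounded_multiplier_limit[OF that(1) _ c'[OF that(2)] cutoff_limits(2)]) measurable
  have "(\<lambda>n. LINT x|lborel. cutoff (?R n) x * (F x * u x)) \<longlonglongrightarrow> 1 * (LINT x|lborel. F x * u x)"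
    by (rule l1[OF F(2)[OF u(2)]])
  then have L: "(\<lambda>n. LINT x|lborel. F x * (cutoff (?R n) x * u x)) \<longlonglongrightarrow> (LINT x|lborel. F x * u x)"
    by (simp add: mult_ac)
  have "(\<lambda>n. LINT x|lborel. F x * (cutoff (?R n) x * u x)) \<longlonglongrightarrow>
    (\<Sum>b\<in>Basis. 0 * (LINT x|lborel. A b x * u x) + 1 * (LINT x|lborel. A b x * A b x)) + 1 * (LINT x|lborel. u x * u x)"
    unfolding id by (intro tendsto_add tendsto_sum l1 l2 pow_integrable_2_mult u)
  from LIMSEQ_unique[OF L this] show ?thesis by simp
qed

lemma pohozaev_limit:
  fixes u :: "'a::euclidean_space \<Rightarrow> real"
  assumes r: "r \<ge> 1" and u2: "sobolev_pow 2 u A" and ur: "sobolev_pow r u A"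
    and eq: "\<And>\<phi>. \<phi> \<in> test_functions UNIV \<Longrightarrow>
      (LINT x|lborel. (\<Sum>b\<in>Basis. A b x * partial_deriv b \<phi> x) + u x * \<phi> x) = (LINT x|lborel. F x * \<phi> x)"
    and F: "F \<in> borel_measurable borel" "\<And>h. pow_integrable r h \<Longrightarrow> integrable lborel (\<lambda>x. F x * h x)"
  shows "(\<lambda>n. LINT x|lborel. F x * (\<Sum>c\<in>Basis. (dilation (real (Suc n)) x \<bullet> c) * A c x)) \<longlonglongrightarrow>
    (1 - real DIM('a) / 2) * (\<Sum>b\<in>Basis. LINT x|lborel. A b x * A b x)
      - real DIM('a) / 2 * (LINT x|lborel. u x * u x)"
proof -
  have u: "pow_integrable 2 u" "\<And>b. b \<in> Basis \<Longrightarrow> weak_partial b u (A b)"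
    "\<And>b. b \<in> Basis \<Longrightarrow> pow_integrable 2 (A b)" "\<And>b. b \<in> Basis \<Longrightarrow> pow_integrable r (A b)"
    using u2 ur unfolding sobolev_pow_def by auto
  let ?R = "\<lambda>n. real (Suc n)"
  have R: "?R n > 0" for n by simp
  let ?d = "\<lambda>n. dilation_deriv (?R n)"
  have id: "(LINT x|lborel. F x * (\<Sum>c\<in>Basis. (dilation (?R n) x \<bullet> c) * A c x))
    = (\<Sum>b\<in>Basis. \<Sum>c\<in>Basis. (LINT x|lborel. ?d n b c x * (A b x * A c x))
        - (LINT x|lborel. ?d n c c x * (A b x * A b x)) / 2)
      - (\<Sum>c\<in>(Basis::'a set). (LINT x|lborel. ?d n c c x * (u x * u x)) / 2)" for n
    by (rule pohozaev_half[OF r u(2,1,3,4) eq F])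
      (use cutoff_fieldD[OF dilation_cutoff_field[OF R]] in auto)
  have l: "(\<lambda>n. LINT x|lborel. ?d n b c x * f x) \<longlonglongrightarrow> (b \<bullet> c) * (LINT x|lborel. f x)"
    if "integrable lborel f" "b \<in> Basis" "c \<in> Basis" for f :: "'a \<Rightarrow> real" and b c
    by (rule bounded_multiplier_limit[OF that(1) _ dilation_deriv_bound[OF R that(2,3)] cutoff_limits(3)])
      (rule bounded_support_borel[OF cutoff_fieldD(2)[OF dilation_cutoff_field[OF R] that(2,3)]])
  have "(\<lambda>n. LINT x|lborel. F x * (\<Sum>c\<in>Basis. (dilation (?R n) x \<bullet> c) * A c x)) \<longlonglongrightarrow>
    (\<Sum>b\<in>Basis. \<Sum>c\<in>Basis. (b \<bullet> c) * (LINT x|lborel. A b x * A c x)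
        - (c \<bullet> c) * (LINT x|lborel. A b x * A b x) / 2)
      - (\<Sum>c\<in>(Basis::'a set). (c \<bullet> c) * (LINT x|lborel. u x * u x) / 2)"
    unfolding id by (intro tendsto_diff tendsto_sum tendsto_divide tendsto_const l pow_integrable_2_mult u) auto
  moreover have "(\<Sum>c\<in>Basis. (b \<bullet> c) * (LINT x|lborel. A b x * A c x)) = (LINT x|lborel. A b x * A b x)"
    if b: "b \<in> Basis" for b
  proof -
    have "(\<Sum>c\<in>Basis. (b \<bullet> c) * (LINT x|lborel. A b x * A c x))
        = (\<Sum>c\<in>Basis. if c = b then (LINT x|lborel. A b x * A c x) else 0)"
      by (intro sum.cong refl) (use b in \<open>auto simp: inner_Basis\<close>)
    then show ?thesis using b by simp
  qed
  then have "(\<Sum>b\<in>Basis. \<Sum>c\<in>Basis. (b \<bullet> c) * (LINT x|lborel. A b x * A c x)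
        - (c \<bullet> c) * (LINT x|lborel. A b x * A b x) / 2)
      = (1 - real DIM('a) / 2) * (\<Sum>b\<in>Basis. LINT x|lborel. A b x * A b x)"
    unfolding sum_distrib_left by (intro sum.cong refl) (simp add: sum_subtractf algebra_simps)
  ultimately show ?thesis by simp
qed

text \<open>The chain rule with \<open>p = 2\<close>, tested with a component of the cut-off dilation field, shows that the
  integral of \<open>u\<^sup>2\<close> against the derivative of this component vanishes; the derivative tends to 1.\<close>

lemma zero_gradient_imp_zero:
  fixes u :: "'a::euclidean_space \<Rightarrow> real"
  assumes u2: "sobolev_pow 2 u A" and 0: "\<And>b. b \<in> Basis \<Longrightarrow> AE x in lborel. A b x = 0"
  shows "(LINT x|lborel. u x * u x) = 0"
proof -
  have u: "pow_integrable 2 u" "\<And>b. b \<in> Basis \<Longrightarrow> weak_partial b u (A b)"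
    "\<And>b. b \<in> Basis \<Longrightarrow> pow_integrable 2 (A b)"
    using u2 unfolding sobolev_pow_def by auto
  obtain c :: 'a where c: "c \<in> Basis" using SOME_Basis by blast
  let ?R = "\<lambda>n. real (Suc n)"
  have R: "?R n > 0" for n by simp
  note X = cutoff_fieldD[OF dilation_cutoff_field[OF R]]
  have "(LINT x|lborel. dilation_deriv (?R n) c c x * (u x * u x)) = 0" for n
  proof -
    have "(LINT x|lborel. (dilation (?R n) x \<bullet> c) * (2 * (\<bar>u x\<bar> powr (2 - 2) * u x) * A c x)) = 0"
    proof (rule integral_eq_zero_AE)
      show "AE x in lborel. (dilation (?R n) x \<bullet> c) * (2 * (\<bar>u x\<bar> powr (2 - 2) * u x) * A c x) = 0"
        using 0[OF c] by eventually_elim simp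
    qed
    then show ?thesis
      using chain_rule_power[OF _ _ u(2)[OF c] c u(1) u(3)[OF c] X(1)[OF c] X(2,3)[OF c c], of 2 n]
      by (simp add: power2_eq_square)
  qed
  moreover have "(\<lambda>n. LINT x|lborel. dilation_deriv (?R n) c c x * (u x * u x)) \<longlonglongrightarrow> (c \<bullet> c) * (LINT x|lborel. u x * u x)"
    by (rule bounded_multiplier_limit[OF pow_integrable_2_mult[OF u(1,1)] _ dilation_deriv_bound[OF R c c] cutoff_limits(3)])
      (rule bounded_support_borel[OF X(2)[OF c c]])
  ultimately have "(\<lambda>n. 0::real) \<longlonglongrightarrow> (LINT x|lborel. u x * u x)" using c by simp
  then show ?thesis using LIMSEQ_unique tendsto_const by blast
qed

section \<open>The nonexistence theorem\<close>

definition potential :: "real \<Rightarrow> ('a::euclidean_space \<Rightarrow> real) \<Rightarrow> 'a \<Rightarrow> real" where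
  "potential \<nu> g x = (LINT y|lborel. norm (x - y) powr (- \<nu>) * g y)"

lemma potential_borel [measurable]:
  assumes [measurable]: "g \<in> borel_measurable borel"
  shows "potential \<nu> g \<in> borel_measurable borel"
  unfolding potential_def[abs_def] by measurable

text \<open>Turns the nonlocal term of the equation into a double integral.\<close>

lemma potential_pairing:
  fixes w g :: "'a::euclidean_space \<Rightarrow> real"
  assumes \<alpha>: "0 < \<alpha>" "\<alpha> < real DIM('a)"
    and \<theta>: "\<theta> > 1" "\<tau> > 1" "1 / \<theta> + 1 / \<tau> = (real DIM('a) + \<alpha>) / real DIM('a)"
    and w: "pow_integrable \<theta> w" and g: "pow_integrable \<tau> g"
  defines "\<nu> \<equiv> real DIM('a) - \<alpha>"
  shows "integrable lborel (\<lambda>x. potential \<nu> g x * w x)"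
    and "(LINT x|lborel. potential \<nu> g x * w x)
      = (LINT z|lborel2. (case z of (x, y) \<Rightarrow> norm (x - y) powr (- \<nu>) * (w x * g y)))"
proof -
  note h = hls_integrable[OF \<alpha> \<theta> w g, folded \<nu>_def]
  have e: "(LINT y|lborel. norm (x - y) powr (- \<nu>) * (w x * g y)) = potential \<nu> g x * w x" for x
  proof -
    have "(\<lambda>y. norm (x - y) powr (- \<nu>) * (w x * g y)) = (\<lambda>y. w x * (norm (x - y) powr (- \<nu>) * g y))"
      by (simp add: mult_ac)
    then show ?thesis by (simp add: potential_def)
  qed
  show "integrable lborel (\<lambda>x. potential \<nu> g x * w x)"
    using lborel_pair.integrable_fst[OF h] by (simp add: e)
  show "(LINT x|lborel. potential \<nu> g x * w x)
      = (LINT z|lborel2. (case z of (x, y) \<Rightarrow> norm (x - y) powr (- \<nu>) * (w x * g y)))"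
    using lborel_pair.integral_fst[OF h] by (simp add: e)
qed

lemma signed_powr_mult_self:
  fixes t p :: real shows "(\<bar>t\<bar> powr (p - 2) * t) * t = \<bar>t\<bar> powr p"
proof (cases "t = 0")
  case False
  have "(\<bar>t\<bar> powr (p - 2) * t) * t = \<bar>t\<bar> powr (p - 2) * \<bar>t\<bar> powr 2" by (simp add: power2_eq_square)
  also have "\<dots> = \<bar>t\<bar> powr p" by (simp only: powr_add[symmetric]) simp
  finally show ?thesis .
qed simp

text \<open>The factor \<open>2 N\<close> comes from the two divergences, and \<open>-\<nu>\<close> from the homogeneity of the kernel.\<close>

lemma virial_dilation_limit:
  fixes f g :: "'a::euclidean_space \<Rightarrow> real"
  assumes \<nu>: "\<nu> > 0" and i: "integrable lborel2 (\<lambda>(x, y). norm (x - y) powr (- \<nu>) * (f x * g y))"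
    and f: "f \<in> borel_measurable borel" and g: "g \<in> borel_measurable borel"
  shows "(\<lambda>n. LINT z|lborel2. (case z of (x, y) \<Rightarrow>
        virial \<nu> (dilation (real (Suc n))) (dilation_deriv (real (Suc n))) x y * (f x * g y)))
    \<longlonglongrightarrow> (2 * real DIM('a) - \<nu>) * (LINT z|lborel2. (case z of (x, y) \<Rightarrow> norm (x - y) powr (- \<nu>) * (f x * g y)))"
proof -
  let ?N = "real DIM('a)" and ?R = "\<lambda>n. real (Suc n)"
  have R: "?R n > 0" for n by simp
  let ?V = "\<lambda>n. virial \<nu> (dilation (?R n)) (dilation_deriv (?R n) :: 'a \<Rightarrow> 'a \<Rightarrow> 'a \<Rightarrow> real)"
  let ?m = "\<lambda>x y::'a. norm (x - y) powr (- \<nu>) * (2 * ?N - \<nu>)"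
  have div: "\<bar>divergence (dilation_deriv (?R n)) x\<bar> \<le> ?N * 5" for n and x :: 'a
  proof -
    have "\<bar>divergence (dilation_deriv (?R n)) x\<bar> \<le> (\<Sum>c\<in>(Basis::'a set). \<bar>dilation_deriv (?R n) c c x\<bar>)"
      unfolding divergence_def by (rule sum_abs)
    also have "\<dots> \<le> (\<Sum>c\<in>(Basis::'a set). 5)" by (intro sum_mono dilation_deriv_bound R)
    finally show ?thesis by simp
  qed
  have b: "\<bar>?V n x y\<bar> \<le> (?N * 10 + \<nu> * 5) * norm (x - y) powr (- \<nu>)" if "x \<noteq> y" for n x y
  proof -
    let ?i = "(x - y) \<bullet> (dilation (?R n) x - dilation (?R n) y)"
    have q: "(norm (x - y))\<^sup>2 > 0" using that by simp
    have "\<bar>?i\<bar> \<le> norm (x - y) * (5 * norm (x - y))"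
      by (rule order_trans[OF Cauchy_Schwarz_ineq2]) (intro mult_left_mono dilation_Lipschitz[OF R] norm_ge_zero)
    then have "\<bar>?i\<bar> / (norm (x - y))\<^sup>2 \<le> 5" using q by (simp add: divide_le_eq power2_eq_square)
    then have "\<bar>\<nu> * ?i / (norm (x - y))\<^sup>2\<bar> \<le> \<nu> * 5"
      using \<nu> mult_left_mono[of "\<bar>?i\<bar> / (norm (x - y))\<^sup>2" 5 \<nu>] by (simp add: abs_mult)
    then have "\<bar>divergence (dilation_deriv (?R n)) x + divergence (dilation_deriv (?R n)) y
        - \<nu> * ?i / (norm (x - y))\<^sup>2\<bar> \<le> ?N * 10 + \<nu> * 5"
      using div[of n x] div[of n y] by linarith
    then show ?thesis unfolding virial_def abs_mult
      by (subst mult.commute) (intro mult_mono, auto)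
  qed
  have lim: "(\<lambda>n. ?V n x y) \<longlonglongrightarrow> ?m x y" if "x \<noteq> y" for x y
  proof -
    have d: "(\<lambda>n. divergence (dilation_deriv (?R n)) x) \<longlonglongrightarrow> ?N" for x :: 'a
    proof -
      have "(\<lambda>n. \<Sum>c\<in>(Basis::'a set). dilation_deriv (?R n) c c x) \<longlonglongrightarrow> (\<Sum>c\<in>(Basis::'a set). c \<bullet> c)"
        by (intro tendsto_sum cutoff_limits(3))
      then show ?thesis by (simp add: divergence_def)
    qed
    have "(\<lambda>n. ?V n x y) \<longlonglongrightarrow> norm (x - y) powr (- \<nu>) * (?N + ?N - \<nu> * ((x - y) \<bullet> (x - y)) / (norm (x - y))\<^sup>2)"
      unfolding virial_def using that
      by (intro tendsto_mult tendsto_const tendsto_diff tendsto_add tendsto_divide tendsto_inner d cutoff_limits(4)) auto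
    moreover have "((x - y) \<bullet> (x - y)) = (norm (x - y))\<^sup>2" by (rule power2_norm_eq_inner[symmetric])
    ultimately show ?thesis using that by simp
  qed
  have mm: "(\<lambda>(x, y). ?m x y) \<in> borel_measurable (borel \<Otimes>\<^sub>M borel)" by measurable
  have "(\<lambda>n. LINT z|lborel2. (case z of (x, y) \<Rightarrow> ?V n x y * (f x * g y)))
    \<longlonglongrightarrow> (LINT z|lborel2. (case z of (x, y) \<Rightarrow> ?m x y * (f x * g y)))"
    by (rule kernel_dominated_convergence[OF i f g virial_measurable[OF dilation_cutoff_field[OF R]] mm b lim])
  moreover have "(LINT z|lborel2. (case z of (x, y) \<Rightarrow> ?m x y * (f x * g y)))
      = (2 * ?N - \<nu>) * (LINT z|lborel2. (case z of (x, y) \<Rightarrow> norm (x - y) powr (- \<nu>) * (f x * g y)))"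
    by (subst integral_mult_right_zero[symmetric]) (simp add: case_prod_unfold mult_ac)
  ultimately show ?thesis by simp
qed

lemma zero_square_integral_AE:
  assumes "pow_integrable 2 f" "(LINT x|lborel. f x * f x) = 0"
  shows "AE x in lborel. f x = 0"
proof -
  have "AE x in lborel. f x * f x = 0"
    using assms(2) by (subst (asm) integral_nonneg_eq_0_iff_AE[OF pow_integrable_2_mult[OF assms(1,1)]]) auto
  then show ?thesis by simp
qed

text \<open>The theorem for Borel representatives, with the normalising constant of the Riesz potential replaced by
  an arbitrary number \<open>\<kappa>\<close>: it drops out with \<open>D\<close>.\<close>

lemma nonexistence_borel:
  fixes u v :: "'a::euclidean_space \<Rightarrow> real"
  assumes \<alpha>: "0 < \<alpha>" "\<alpha> < real DIM('a)"
    and \<theta>: "\<theta> > 1" "\<tau> > 1" "1 / \<theta> + 1 / \<tau> = (real DIM('a) + \<alpha>) / real DIM('a)"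
    and p: "p > 1" and q: "q > 1"
    and u2: "sobolev_pow 2 u A" and ur: "sobolev_pow (\<theta> * p) u A"
    and v2: "sobolev_pow 2 v B" and vr: "sobolev_pow (\<tau> * q) v B"
  defines "\<nu> \<equiv> real DIM('a) - \<alpha>"
  assumes equ: "\<And>\<phi>. \<phi> \<in> test_functions UNIV \<Longrightarrow>
      (LINT x|lborel. (\<Sum>b\<in>Basis. A b x * partial_deriv b \<phi> x) + u x * \<phi> x) =
      2 * p / (p + q) * (LINT x|lborel. \<kappa> * potential \<nu> (\<lambda>y. \<bar>v y\<bar> powr q) x * (\<bar>u x\<bar> powr (p - 2) * u x) * \<phi> x)"
    and eqv: "\<And>\<phi>. \<phi> \<in> test_functions UNIV \<Longrightarrow>
      (LINT x|lborel. (\<Sum>b\<in>Basis. B b x * partial_deriv b \<phi> x) + v x * \<phi> x) =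
      2 * q / (p + q) * (LINT x|lborel. \<kappa> * potential \<nu> (\<lambda>y. \<bar>u y\<bar> powr p) x * (\<bar>v x\<bar> powr (q - 2) * v x) * \<phi> x)"
    and range: "(p + q) * real DIM('a) \<le> 2 * (real DIM('a) + \<alpha>) \<or> (p + q) * (real DIM('a) - 2) \<ge> 2 * (real DIM('a) + \<alpha>)"
  shows "AE x in lborel. u x = 0 \<and> v x = 0"
proof -
  let ?N = "real DIM('a)"
  have \<nu>: "\<nu> > 0" using \<alpha> by (simp add: \<nu>_def)
  have N: "?N \<ge> 1" by (simp add: DIM_positive Suc_leI)
  have \<theta>': "1 / \<tau> + 1 / \<theta> = (?N + \<alpha>) / ?N" using \<theta>(3) by simp
  have r: "\<theta> * p \<ge> 1" "\<tau> * q \<ge> 1" using \<theta> p q mult_mono[of 1 \<theta> 1 p] mult_mono[of 1 \<tau> 1 q] by auto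
  have su: "pow_integrable 2 u" "pow_integrable (\<theta> * p) u" "\<And>b. b \<in> Basis \<Longrightarrow> pow_integrable 2 (A b)"
      "\<And>b. b \<in> Basis \<Longrightarrow> pow_integrable (\<theta> * p) (A b)"
    and sv: "pow_integrable 2 v" "pow_integrable (\<tau> * q) v" "\<And>b. b \<in> Basis \<Longrightarrow> pow_integrable 2 (B b)"
      "\<And>b. b \<in> Basis \<Longrightarrow> pow_integrable (\<tau> * q) (B b)"
    using u2 ur v2 vr unfolding sobolev_pow_def by auto
  note up = pow_integrable_abs_powr[OF su(2)] and vq = pow_integrable_abs_powr[OF sv(2)]
  note [measurable] = pow_integrable_borel[OF su(2)] pow_integrable_borel[OF sv(2)]
    pow_integrable_borel[OF up] pow_integrable_borel[OF vq]
  define Pu where "Pu = potential \<nu> (\<lambda>y. \<bar>u y\<bar> powr p)"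
  define Pv where "Pv = potential \<nu> (\<lambda>y. \<bar>v y\<bar> powr q)"
  have [measurable]: "Pu \<in> borel_measurable borel" "Pv \<in> borel_measurable borel"
    unfolding Pu_def Pv_def by measurable
  define c1 c2 where "c1 = 2 * p / (p + q) * \<kappa>" and "c2 = 2 * q / (p + q) * \<kappa>"
  define Fu where "Fu x = c1 * (Pv x * (\<bar>u x\<bar> powr (p - 2) * u x))" for x
  define Fv where "Fv x = c2 * (Pu x * (\<bar>v x\<bar> powr (q - 2) * v x))" for x
  have [measurable]: "Fu \<in> borel_measurable borel" "Fv \<in> borel_measurable borel"
    unfolding Fu_def[abs_def] Fv_def[abs_def] by measurable
  have Fuh: "Fu x * h = c1 * (Pv x * ((\<bar>u x\<bar> powr (p - 2) * u x) * h))"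
    and Fvh: "Fv x * h = c2 * (Pu x * ((\<bar>v x\<bar> powr (q - 2) * v x) * h))" for x h
    by (simp_all add: Fu_def Fv_def)
  have iFu: "integrable lborel (\<lambda>x. Fu x * h x)" if "pow_integrable (\<theta> * p) h" for h
    unfolding Fuh Pv_def \<nu>_def
    by (intro integrable_mult_right potential_pairing(1)[OF \<alpha> \<theta> pow_integrable_signed_powr_mult[OF su(2) that p \<theta>(1)] vq])
  have iFv: "integrable lborel (\<lambda>x. Fv x * h x)" if "pow_integrable (\<tau> * q) h" for h
    unfolding Fvh Pu_def \<nu>_def
    by (intro integrable_mult_right potential_pairing(1)[OF \<alpha> \<theta>(2,1) \<theta>' pow_integrable_signed_powr_mult[OF sv(2) that q \<theta>(2)] up])
  have eu: "(LINT x|lborel. (\<Sum>b\<in>Basis. A b x * partial_deriv b \<phi> x) + u x * \<phi> x) = (LINT x|lborel. Fu x * \<phi> x)"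
    if "\<phi> \<in> test_functions UNIV" for \<phi>
    unfolding equ[OF that] Fu_def c1_def Pv_def
    by (subst integral_mult_right_zero[symmetric]) (simp add: mult_ac)
  have ev: "(LINT x|lborel. (\<Sum>b\<in>Basis. B b x * partial_deriv b \<phi> x) + v x * \<phi> x) = (LINT x|lborel. Fv x * \<phi> x)"
    if "\<phi> \<in> test_functions UNIV" for \<phi>
    unfolding eqv[OF that] Fv_def c2_def Pu_def
    by (subst integral_mult_right_zero[symmetric]) (simp add: mult_ac)
  define K where "K x y = norm (x - y) powr (- \<nu>)" for x y :: 'a
  have Ksym: "K y x = K x y" for x y by (simp add: K_def norm_minus_commute)
  define I where "I w z = (LINT t|lborel2. (case t of (x, y) \<Rightarrow> K x y * (w x * z y)))" for w z :: "'a \<Rightarrow> real"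
  have Iswap: "I w z = I z w" if "w \<in> borel_measurable borel" "z \<in> borel_measurable borel" for w z
  proof -
    have [measurable]: "w \<in> borel_measurable borel" "z \<in> borel_measurable borel" using that by auto
    have "(\<lambda>(x, y). K x y * (w x * z y)) \<in> borel_measurable lborel2" unfolding K_def by measurable
    from integral_lborel2_swap[OF this] show ?thesis unfolding I_def by (simp add: Ksym mult_ac)
  qed
  have pairu: "(LINT x|lborel. Fu x * h x) = c1 * I (\<lambda>x. (\<bar>u x\<bar> powr (p - 2) * u x) * h x) (\<lambda>y. \<bar>v y\<bar> powr q)"
    if "pow_integrable (\<theta> * p) h" for h
    unfolding Fuh I_def K_def \<nu>_def
      potential_pairing(2)[OF \<alpha> \<theta> pow_integrable_signed_powr_mult[OF su(2) that p \<theta>(1)] vq, symmetric]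
    by (simp add: Pv_def \<nu>_def)
  have pairv: "(LINT x|lborel. Fv x * h x) = c2 * I (\<lambda>x. (\<bar>v x\<bar> powr (q - 2) * v x) * h x) (\<lambda>y. \<bar>u y\<bar> powr p)"
    if "pow_integrable (\<tau> * q) h" for h
    unfolding Fvh I_def K_def \<nu>_def
      potential_pairing(2)[OF \<alpha> \<theta>(2,1) \<theta>' pow_integrable_signed_powr_mult[OF sv(2) that q \<theta>(2)] up, symmetric]
    by (simp add: Pu_def \<nu>_def)
  define D where "D = I (\<lambda>x. \<bar>u x\<bar> powr p) (\<lambda>y. \<bar>v y\<bar> powr q)"
  define a b where "a = (\<Sum>b\<in>Basis. LINT x|lborel. A b x * A b x) + (\<Sum>b\<in>Basis. LINT x|lborel. B b x * B b x)"
    and "b = (LINT x|lborel. u x * u x) + (LINT x|lborel. v x * v x)"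
  have mF: "Fu \<in> borel_measurable borel" "Fv \<in> borel_measurable borel" by measurable
  have "c1 * D = (LINT x|lborel. Fu x * u x)"
    unfolding pairu[OF su(2)] signed_powr_mult_self D_def ..
  also have "\<dots> = (\<Sum>b\<in>Basis. LINT x|lborel. A b x * A b x) + (LINT x|lborel. u x * u x)"
    by (rule energy_identity[OF r(1) u2 ur eu mF(1) iFu])
  finally have E1: "c1 * D = (\<Sum>b\<in>Basis. LINT x|lborel. A b x * A b x) + (LINT x|lborel. u x * u x)" .
  have "c2 * D = (LINT x|lborel. Fv x * v x)"
    unfolding pairv[OF sv(2)] signed_powr_mult_self D_def
    by (subst Iswap[OF pow_integrable_borel[OF up] pow_integrable_borel[OF vq]]) (rule refl)
  also have "\<dots> = (\<Sum>b\<in>Basis. LINT x|lborel. B b x * B b x) + (LINT x|lborel. v x * v x)"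
    by (rule energy_identity[OF r(2) v2 vr ev mF(2) iFv])
  finally have E2: "c2 * D = (\<Sum>b\<in>Basis. LINT x|lborel. B b x * B b x) + (LINT x|lborel. v x * v x)" .
  have "p + q \<noteq> 0" using p q by simp
  then have "(2 * p + 2 * q) / (p + q) = 2" by (simp add: divide_eq_eq)
  then have "2 * p / (p + q) + 2 * q / (p + q) = 2" by (simp only: add_divide_distrib)
  then have "c1 + c2 = 2 * \<kappa>" unfolding c1_def c2_def by (simp only: distrib_right[symmetric])
  then have "2 * \<kappa> * D = c1 * D + c2 * D" by (simp only: distrib_right[symmetric])
  then have energy: "2 * \<kappa> * D = a + b"
    unfolding E1 E2 a_def b_def by linarith
  let ?X = "\<lambda>n. dilation (real (Suc n)) :: 'a \<Rightarrow> 'a"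
  let ?d = "\<lambda>n. dilation_deriv (real (Suc n)) :: 'a \<Rightarrow> 'a \<Rightarrow> 'a \<Rightarrow> real"
  have R: "real (Suc n) > 0" for n by simp
  \<comment> \<open>Dividing by the factor \<open>p\<close> or \<open>q\<close> of the chain rule gives both equations the same constant, so that the nonlocal terms can be added.\<close>
  define c0 where "c0 = 2 * \<kappa> / (p + q)"
  have dil: "pow_integrable s (\<lambda>x. \<Sum>c\<in>Basis. (?X n x \<bullet> c) * G c x)"
    if G: "\<And>c. c \<in> Basis \<Longrightarrow> pow_integrable s (G c)" and s: "s \<ge> 1" for s G n
  proof (rule pow_integrable_sum)
    fix c :: 'a assume c: "c \<in> Basis"
    note bs = cutoff_fieldD(1)[OF dilation_cutoff_field[OF R] c, of n]
    obtain C where "\<And>x. \<bar>?X n x \<bullet> c\<bar> \<le> C" using bs unfolding bounded_support_def by blast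
    then show "pow_integrable s (\<lambda>x. (?X n x \<bullet> c) * G c x)"
      using s by (intro pow_integrable_bounded_mult[OF G[OF c] bounded_support_borel[OF bs]]) auto
  qed (use s in simp)
  have fluxu: "(\<bar>u x\<bar> powr (p - 2) * u x) * (\<Sum>c\<in>Basis. (X x \<bullet> c) * A c x) = (1 / p) * power_flux p u A X x" for X x
    using p unfolding power_flux_def sum_distrib_left by (intro sum.cong refl) simp
  have fluxv: "(\<bar>v x\<bar> powr (q - 2) * v x) * (\<Sum>c\<in>Basis. (X x \<bullet> c) * B c x) = (1 / q) * power_flux q v B X x" for X x
    using q unfolding power_flux_def sum_distrib_left by (intro sum.cong refl) simp
  have Iscale: "I (\<lambda>x. k * w x) z = k * I w z" for k w z
    unfolding I_def by (subst integral_mult_right_zero[symmetric]) (simp add: case_prod_unfold mult_ac)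
  have lhs: "(LINT x|lborel. Fu x * (\<Sum>c\<in>Basis. (?X n x \<bullet> c) * A c x)) + (LINT x|lborel. Fv x * (\<Sum>c\<in>Basis. (?X n x \<bullet> c) * B c x))
    = - c0 * (LINT z|lborel2. (case z of (x, y) \<Rightarrow> virial \<nu> (?X n) (?d n) x y * (\<bar>u x\<bar> powr p * \<bar>v y\<bar> powr q)))" for n
  proof -
    note X = dilation_cutoff_field[OF R, of n]
    have 1: "(LINT x|lborel. Fu x * (\<Sum>c\<in>Basis. (?X n x \<bullet> c) * A c x))
        = c1 * ((1 / p) * I (power_flux p u A (?X n)) (\<lambda>y. \<bar>v y\<bar> powr q))"
    proof -
      have d: "pow_integrable (\<theta> * p) (\<lambda>x. \<Sum>c\<in>Basis. (?X n x \<bullet> c) * A c x)"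
        by (rule dil[OF su(4) r(1)])
      show ?thesis by (simp only: pairu[OF d] fluxu Iscale)
    qed
    have 2: "(LINT x|lborel. Fv x * (\<Sum>c\<in>Basis. (?X n x \<bullet> c) * B c x))
        = c2 * ((1 / q) * I (power_flux q v B (?X n)) (\<lambda>y. \<bar>u y\<bar> powr p))"
    proof -
      have d: "pow_integrable (\<tau> * q) (\<lambda>x. \<Sum>c\<in>Basis. (?X n x \<bullet> c) * B c x)"
        by (rule dil[OF sv(4) r(2)])
      show ?thesis by (simp only: pairv[OF d] fluxv Iscale)
    qed
    have 3: "I (power_flux q v B (?X n)) (\<lambda>y. \<bar>u y\<bar> powr p) = I (\<lambda>x. \<bar>u x\<bar> powr p) (power_flux q v B (?X n))"
      by (rule Iswap[OF pow_integrable_borel[OF power_flux_pow_integrable[OF vr X q \<theta>(2)]] pow_integrable_borel[OF up]])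
    have "c1 * (1 / p) = c0" "c2 * (1 / q) = c0" using p q by (simp_all add: c0_def c1_def c2_def)
    then have "c1 * ((1 / p) * s) + c2 * ((1 / q) * t) = c0 * (s + t)" for s t
      by (simp only: mult.assoc[symmetric] distrib_left)
    then show ?thesis
      unfolding 1 2 3
      using virial_identity[OF \<alpha> \<theta> p q ur vr X _ dilation_Lipschitz[OF R], folded \<nu>_def]
      by (simp add: I_def K_def)
  qed
  have i: "integrable lborel2 (\<lambda>(x, y). norm (x - y) powr (- \<nu>) * (\<bar>u x\<bar> powr p * \<bar>v y\<bar> powr q))"
    unfolding \<nu>_def by (rule hls_integrable[OF \<alpha> \<theta> up vq])
  have "(\<lambda>n. - c0 * (LINT z|lborel2. (case z of (x, y) \<Rightarrow> virial \<nu> (?X n) (?d n) x y * (\<bar>u x\<bar> powr p * \<bar>v y\<bar> powr q))))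
      \<longlonglongrightarrow> - c0 * ((2 * ?N - \<nu>) * D)"
    unfolding D_def I_def K_def
    by (intro tendsto_mult tendsto_const virial_dilation_limit[OF \<nu> i pow_integrable_borel[OF up] pow_integrable_borel[OF vq]])
  moreover have "(\<lambda>n. (LINT x|lborel. Fu x * (\<Sum>c\<in>Basis. (?X n x \<bullet> c) * A c x)) + (LINT x|lborel. Fv x * (\<Sum>c\<in>Basis. (?X n x \<bullet> c) * B c x)))
    \<longlonglongrightarrow> ((1 - ?N / 2) * (\<Sum>b\<in>Basis. LINT x|lborel. A b x * A b x) - ?N / 2 * (LINT x|lborel. u x * u x))
     + ((1 - ?N / 2) * (\<Sum>b\<in>Basis. LINT x|lborel. B b x * B b x) - ?N / 2 * (LINT x|lborel. v x * v x))"
    by (intro tendsto_add pohozaev_limit[OF r(1) u2 ur eu _ iFu] pohozaev_limit[OF r(2) v2 vr ev _ iFv]) measurable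
  ultimately have poh0: "- c0 * ((2 * ?N - \<nu>) * D) =
      ((1 - ?N / 2) * (\<Sum>b\<in>Basis. LINT x|lborel. A b x * A b x) - ?N / 2 * (LINT x|lborel. u x * u x))
     + ((1 - ?N / 2) * (\<Sum>b\<in>Basis. LINT x|lborel. B b x * B b x) - ?N / 2 * (LINT x|lborel. v x * v x))"
    unfolding lhs by (rule LIMSEQ_unique)
  \<comment> \<open>Half of the coefficient of \<open>D\<close> in the Pohozaev identity; note that \<open>2 * N - \<nu> = N + \<alpha>\<close>.\<close>
  define m where "m = (?N + \<alpha>) / (p + q)"
  have "c0 * ((2 * ?N - \<nu>) * D) = m * (2 * \<kappa> * D)"
    by (simp add: c0_def m_def \<nu>_def)
  also have "\<dots> = m * (a + b)" by (simp only: energy)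
  finally have "m * (a + b) = c0 * ((2 * ?N - \<nu>) * D)" by (rule sym)
  also have "\<dots> = (?N / 2 - 1) * a + ?N / 2 * b"
    using poh0 unfolding a_def b_def by (simp add: algebra_simps)
  finally have poh: "m * (a + b) = (?N / 2 - 1) * a + ?N / 2 * b" .
  have sq: "0 \<le> (LINT x|lborel. f x * f x)" for f :: "'a \<Rightarrow> real" by (rule Bochner_Integration.integral_nonneg) simp
  have a0: "a \<ge> 0" and b0: "b \<ge> 0" unfolding a_def b_def by (intro add_nonneg_nonneg sum_nonneg sq)+
  have pq: "p + q > 0" using p q by simp
  have "(LINT x|lborel. u x * u x) = 0 \<and> (LINT x|lborel. v x * v x) = 0"
    using range
  proof
    assume "(p + q) * ?N \<le> 2 * (?N + \<alpha>)"
    then have "?N / 2 \<le> m" using pq by (simp add: m_def field_simps)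
    then have "?N / 2 * (a + b) \<le> m * (a + b)" using a0 b0 by (intro mult_right_mono) auto
    then have "a \<le> 0" using poh by (simp add: algebra_simps)
    then have "a = 0" using a0 by simp
    then have "(\<Sum>b\<in>Basis. LINT x|lborel. A b x * A b x) = 0 \<and> (\<Sum>b\<in>Basis. LINT x|lborel. B b x * B b x) = 0"
      unfolding a_def by (subst (asm) add_nonneg_eq_0_iff) (auto intro: sum_nonneg sq)
    then have z: "(LINT x|lborel. A b x * A b x) = 0" "(LINT x|lborel. B b x * B b x) = 0" if "b \<in> Basis" for b
      using that by (simp_all add: sum_nonneg_eq_0_iff sq)
    have "AE x in lborel. A b x = 0" if "b \<in> Basis" for b
      by (rule zero_square_integral_AE[OF su(3)[OF that] z(1)[OF that]])
    moreover have "AE x in lborel. B b x = 0" if "b \<in> Basis" for b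
      by (rule zero_square_integral_AE[OF sv(3)[OF that] z(2)[OF that]])
    ultimately show ?thesis using zero_gradient_imp_zero[OF u2] zero_gradient_imp_zero[OF v2] by blast
  next
    assume "(p + q) * (?N - 2) \<ge> 2 * (?N + \<alpha>)"
    then have "m \<le> ?N / 2 - 1" using pq by (simp add: m_def field_simps)
    then have "m * (a + b) \<le> (?N / 2 - 1) * (a + b)" using a0 b0 by (intro mult_right_mono) auto
    then have "b \<le> 0" using poh by (simp add: algebra_simps)
    then show ?thesis using sq[of u] sq[of v] unfolding b_def by linarith
  qed
  then have "AE x in lborel. u x = 0" "AE x in lborel. v x = 0"
    using zero_square_integral_AE su(1) sv(1) by auto
  then show ?thesis by eventually_elim simp
qed

subsection \<open>Borel representatives\<close>

lemma locally_integrable_measurable: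
  fixes f :: "'a::euclidean_space \<Rightarrow> real"
  assumes "locally_integrable UNIV f"
  shows "f \<in> borel_measurable lebesgue"
proof (rule borel_measurable_LIMSEQ_real)
  show "(\<lambda>x. indicator (cball 0 (real n)) x *\<^sub>R f x) \<in> borel_measurable lebesgue" for n :: nat
    using assms unfolding locally_integrable_def set_integrable_def
    by (intro borel_measurable_integrable) auto
  fix x :: 'a
  obtain n0 :: nat where n0: "norm x \<le> real n0" using real_arch_simple by blast
  have "eventually (\<lambda>n. f x = indicator (cball 0 (real n)) x *\<^sub>R f x) sequentially"
    using eventually_ge_at_top[of n0] by eventually_elim (use n0 in auto)
  then show "(\<lambda>n. indicator (cball 0 (real n)) x *\<^sub>R f x) \<longlonglongrightarrow> f x"
    by (rule Lim_transform_eventually[OF tendsto_const])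
qed

text \<open>Weak derivatives, Sobolev spaces and the equation are defined with Lebesgue measurable functions. This
  lemma carries each of these notions over to Borel functions that agree almost everywhere.\<close>

lemma lebesgue_integral_representative:
  fixes f g :: "'a::euclidean_space \<Rightarrow> real"
  assumes "f \<in> borel_measurable lebesgue" "g \<in> borel_measurable borel" "AE x in lborel. f x = g x"
  shows "(LINT x|lebesgue. f x) = (LINT x|lborel. g x)"
    "integrable lebesgue f \<longleftrightarrow> integrable lborel g"
proof -
  have g: "g \<in> borel_measurable lborel" "g \<in> borel_measurable lebesgue" using assms(2) by (auto intro: measurable_completion)
  have ae: "AE x in lebesgue. f x = g x" by (rule AE_completion[OF assms(3)])
  show "(LINT x|lebesgue. f x) = (LINT x|lborel. g x)"
    using integral_cong_AE[OF assms(1) g(2) ae] integral_completion[OF g(1)] by simp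
  show "integrable lebesgue f \<longleftrightarrow> integrable lborel g"
    using integrable_cong_AE[OF assms(1) g(2) ae] integrable_completion[OF g(1)] by simp
qed

lemma borel_representative:
  assumes "f \<in> borel_measurable lebesgue"
  obtains g :: "'a::euclidean_space \<Rightarrow> real" where "g \<in> borel_measurable borel" "AE x in lborel. f x = g x"
  using completion_ex_borel_measurable_real[OF assms] by auto

lemma Lp_space_representative:
  assumes f: "f \<in> Lp_space s UNIV" and g: "g \<in> borel_measurable borel" "AE x in lborel. f x = g x"
  shows "pow_integrable s g"
proof -
  have fm: "f \<in> borel_measurable lebesgue" and fi: "integrable lebesgue (\<lambda>x. \<bar>f x\<bar> powr s)"
    using f unfolding Lp_space_def set_borel_measurable_def set_integrable_def by auto
  note [measurable] = fm g(1)
  have "integrable lborel (\<lambda>x. \<bar>g x\<bar> powr s)"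
    using fi by (subst (asm) lebesgue_integral_representative(2)[where g="\<lambda>x. \<bar>g x\<bar> powr s"]) (use g(2) in auto)
  then show ?thesis using g(1) unfolding pow_integrable_def by blast
qed

lemma locally_integrable_representative:
  fixes f g :: "'a::euclidean_space \<Rightarrow> real"
  assumes f: "locally_integrable UNIV f" and g: "g \<in> borel_measurable borel" "AE x in lborel. f x = g x"
  shows "loc_integrable g"
  unfolding loc_integrable_def
proof (intro conjI allI)
  fix R
  note [measurable] = locally_integrable_measurable[OF f] g(1)
  have [measurable]: "cball (0::'a) R \<in> sets borel" "cball (0::'a) R \<in> sets lebesgue" by auto
  have "integrable lebesgue (\<lambda>x. indicator (cball 0 R) x * f x)"
    using f unfolding locally_integrable_def set_integrable_def by auto
  then show "integrable lborel (\<lambda>x. indicator (cball 0 R) x * g x)"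
    by (subst (asm) lebesgue_integral_representative(2)[where g="\<lambda>x. indicator (cball 0 R) x * g x"]) (use g(2) in auto)
qed (rule g(1))

lemma weak_deriv_representative:
  fixes f g f' g' :: "'a::euclidean_space \<Rightarrow> real"
  assumes w: "has_weak_deriv UNIV [b] f g"
    and f': "f' \<in> borel_measurable borel" "AE x in lborel. f x = f' x"
    and g': "g' \<in> borel_measurable borel" "AE x in lborel. g x = g' x"
    and b: "b \<in> Basis"
  shows "weak_partial b f' g'"
  unfolding weak_partial_def
proof (intro conjI ballI)
  have l: "locally_integrable UNIV f" "locally_integrable UNIV g" using w unfolding has_weak_deriv_def by auto
  show "loc_integrable f'" "loc_integrable g'"
    using locally_integrable_representative l f' g' by blast+
  fix \<phi> :: "'a \<Rightarrow> real" assume \<phi>: "\<phi> \<in> test_functions UNIV"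
  have mb: "\<phi> \<in> borel_measurable borel" "partial_deriv b \<phi> \<in> borel_measurable borel"
    using bounded_support_borel[OF test_function_bounded_support] \<phi> test_function_partial[OF \<phi> b] by auto
  then have ml: "\<phi> \<in> borel_measurable lebesgue" "partial_deriv b \<phi> \<in> borel_measurable lebesgue"
    by (auto intro: measurable_completion)
  have "(LINT x|lebesgue. f x * partial_deriv b \<phi> x) = - (LINT x|lebesgue. g x * \<phi> x)"
    using w \<phi> unfolding has_weak_deriv_def set_lebesgue_integral_def by auto
  moreover have "(LINT x|lebesgue. f x * partial_deriv b \<phi> x) = (LINT x|lborel. f' x * partial_deriv b \<phi> x)"
    by (rule lebesgue_integral_representative(1))
      (use mb ml locally_integrable_measurable[OF l(1)] f' in auto)
  moreover have "(LINT x|lebesgue. g x * \<phi> x) = (LINT x|lborel. g' x * \<phi> x)"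
    by (rule lebesgue_integral_representative(1))
      (use mb ml locally_integrable_measurable[OF l(2)] g' in auto)
  ultimately show "(LINT x|lborel. f' x * partial_deriv b \<phi> x) = - (LINT x|lborel. g' x * \<phi> x)" by simp
qed

text \<open>The weak gradients in the definitions of the two Sobolev spaces and of the weak solution may differ
  on null sets; uniqueness identifies them.\<close>

lemma sobolev_representative:
  fixes f f' :: "'a::euclidean_space \<Rightarrow> real"
  assumes f: "f \<in> sobolev 1 s UNIV"
    and f': "f' \<in> borel_measurable borel" "AE x in lborel. f x = f' x"
    and A: "\<And>b. b \<in> Basis \<Longrightarrow> weak_partial b f' (A b)"
  shows "sobolev_pow s f' A"
  unfolding sobolev_pow_def
proof (intro conjI ballI)
  show "pow_integrable s f'" using f Lp_space_representative[OF _ f'] unfolding sobolev_def by blast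
  fix b :: 'a assume b: "b \<in> Basis"
  show wA: "weak_partial b f' (A b)" by (rule A[OF b])
  have "\<forall>bs. set bs \<subseteq> Basis \<and> length bs \<le> 1 \<longrightarrow> (\<exists>g\<in>Lp_space s UNIV. has_weak_deriv UNIV bs f g)"
    using f unfolding sobolev_def by blast
  from this[rule_format, of "[b]"] b obtain g where g: "g \<in> Lp_space s UNIV" "has_weak_deriv UNIV [b] f g"
    by auto
  have "locally_integrable UNIV g" using g(2) unfolding has_weak_deriv_def by blast
  from borel_representative[OF locally_integrable_measurable[OF this]]
  obtain g' where g': "g' \<in> borel_measurable borel" "AE x in lborel. g x = g' x" .
  have ae: "AE x in lborel. A b x = g' x"
    by (rule weak_partial_unique[OF wA weak_deriv_representative[OF g(2) f' g' b] b])
  have lA: "loc_integrable (A b)" using wA unfolding weak_partial_def by blast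
  show "pow_integrable s (A b)"
    by (rule pow_integrable_bound[OF pow_integrableD[OF Lp_space_representative[OF g(1) g']] loc_integrable_borel[OF lA]])
      (use ae in auto)
qed

lemma weak_gradient_representative:
  fixes f :: "'a::euclidean_space \<Rightarrow> real"
  assumes "has_weak_gradient f Df"
  obtains A where "\<And>b. b \<in> Basis \<Longrightarrow> A b \<in> borel_measurable borel"
    "\<And>b. b \<in> Basis \<Longrightarrow> AE x in lborel. Df x \<bullet> b = A b x"
    "\<And>b. b \<in> Basis \<Longrightarrow> (\<lambda>x. Df x \<bullet> b) \<in> borel_measurable lebesgue"
proof -
  have l: "locally_integrable UNIV (\<lambda>x. Df x \<bullet> b)" if "b \<in> Basis" for b
    using assms that unfolding has_weak_gradient_def has_weak_deriv_def by blast
  have "\<exists>g. g \<in> borel_measurable borel \<and> (AE x in lborel. Df x \<bullet> b = g x)" if "b \<in> Basis" for b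
    using borel_representative[OF locally_integrable_measurable[OF l[OF that]]] by blast
  then obtain A where "\<And>b. b \<in> Basis \<Longrightarrow> A b \<in> borel_measurable borel \<and> (AE x in lborel. Df x \<bullet> b = A b x)"
    by metis
  then show ?thesis using that locally_integrable_measurable[OF l] by blast
qed

lemma convolution_riesz_representative:
  fixes h h' :: "'a::euclidean_space \<Rightarrow> real"
  assumes h: "h \<in> borel_measurable lebesgue" and h': "h' \<in> borel_measurable borel" "AE x in lborel. h x = h' x"
  shows "convolution (riesz_potential \<alpha>) h x
    = Gamma ((real DIM('a) - \<alpha>) / 2) / (Gamma (\<alpha> / 2) * pi powr (real DIM('a) / 2) * 2 powr \<alpha>)
      * potential (real DIM('a) - \<alpha>) h' x"
proof -
  have m: "(\<lambda>y. riesz_potential \<alpha> (x - y)) \<in> borel_measurable borel"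
    unfolding riesz_potential_def by measurable
  then have ml: "(\<lambda>y. riesz_potential \<alpha> (x - y)) \<in> borel_measurable lebesgue"
    by (auto intro: measurable_completion)
  have "convolution (riesz_potential \<alpha>) h x = (LINT y|lborel. riesz_potential \<alpha> (x - y) * h' y)"
    unfolding convolution_def
    by (rule lebesgue_integral_representative(1)) (use m ml h h' in auto)
  then show ?thesis by (simp add: riesz_potential_def potential_def mult.assoc)
qed

lemma weak_equation_representative:
  fixes u u' h h' \<phi> :: "'a::euclidean_space \<Rightarrow> real"
  assumes \<phi>: "\<phi> \<in> test_functions UNIV"
    and u: "u \<in> borel_measurable lebesgue" and u': "u' \<in> borel_measurable borel" "AE x in lborel. u x = u' x"
    and h: "h \<in> borel_measurable lebesgue" and h': "h' \<in> borel_measurable borel" "AE x in lborel. h x = h' x"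
    and A: "\<And>b. b \<in> Basis \<Longrightarrow> A b \<in> borel_measurable borel"
      "\<And>b. b \<in> Basis \<Longrightarrow> AE x in lborel. Du x \<bullet> b = A b x"
      "\<And>b. b \<in> Basis \<Longrightarrow> (\<lambda>x. Du x \<bullet> b) \<in> borel_measurable lebesgue"
    and eq: "(LINT x|lebesgue. Du x \<bullet> gradient \<phi> x + u x * \<phi> x) =
      c * (LINT x|lebesgue. convolution (riesz_potential \<alpha>) h x * (\<bar>u x\<bar> powr (p - 2) * u x) * \<phi> x)"
  defines "\<kappa> \<equiv> Gamma ((real DIM('a) - \<alpha>) / 2) / (Gamma (\<alpha> / 2) * pi powr (real DIM('a) / 2) * 2 powr \<alpha>)"
  shows "(LINT x|lborel. (\<Sum>b\<in>Basis. A b x * partial_deriv b \<phi> x) + u' x * \<phi> x) =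
      c * (LINT x|lborel. \<kappa> * potential (real DIM('a) - \<alpha>) h' x * (\<bar>u' x\<bar> powr (p - 2) * u' x) * \<phi> x)"
proof -
  have mb: "\<phi> \<in> borel_measurable borel" "\<And>b. b \<in> Basis \<Longrightarrow> partial_deriv b \<phi> \<in> borel_measurable borel"
    using bounded_support_borel[OF test_function_bounded_support] \<phi> test_function_partial[OF \<phi>] by auto
  then have ml: "\<phi> \<in> borel_measurable lebesgue" "\<And>b. b \<in> Basis \<Longrightarrow> partial_deriv b \<phi> \<in> borel_measurable lebesgue"
    by (auto intro: measurable_completion)
  have g: "Du x \<bullet> gradient \<phi> x = (\<Sum>b\<in>Basis. (Du x \<bullet> b) * partial_deriv b \<phi> x)" for x
    by (simp add: gradient_def inner_sum_right mult.commute)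
  have 1: "(LINT x|lebesgue. Du x \<bullet> gradient \<phi> x + u x * \<phi> x)
      = (LINT x|lborel. (\<Sum>b\<in>Basis. A b x * partial_deriv b \<phi> x) + u' x * \<phi> x)"
    unfolding g
  proof (rule lebesgue_integral_representative(1))
    show "(\<lambda>x. (\<Sum>b\<in>Basis. (Du x \<bullet> b) * partial_deriv b \<phi> x) + u x * \<phi> x) \<in> borel_measurable lebesgue"
      by (intro borel_measurable_add borel_measurable_sum borel_measurable_times A ml u)
    show "(\<lambda>x. (\<Sum>b\<in>Basis. A b x * partial_deriv b \<phi> x) + u' x * \<phi> x) \<in> borel_measurable borel"
      by (intro borel_measurable_add borel_measurable_sum borel_measurable_times A mb u')
    have "AE x in lborel. \<forall>b\<in>Basis. Du x \<bullet> b = A b x"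
      by (rule AE_finite_allI) (use A(2) in auto)
    then show "AE x in lborel. (\<Sum>b\<in>Basis. (Du x \<bullet> b) * partial_deriv b \<phi> x) + u x * \<phi> x
        = (\<Sum>b\<in>Basis. A b x * partial_deriv b \<phi> x) + u' x * \<phi> x"
      using u'(2) by eventually_elim simp
  qed
  have pb: "potential (real DIM('a) - \<alpha>) h' \<in> borel_measurable borel" by (rule potential_borel[OF h'(1)])
  then have pl: "potential (real DIM('a) - \<alpha>) h' \<in> borel_measurable lebesgue" by (auto intro: measurable_completion)
  have 2: "(LINT x|lebesgue. convolution (riesz_potential \<alpha>) h x * (\<bar>u x\<bar> powr (p - 2) * u x) * \<phi> x)
      = (LINT x|lborel. \<kappa> * potential (real DIM('a) - \<alpha>) h' x * (\<bar>u' x\<bar> powr (p - 2) * u' x) * \<phi> x)"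
    unfolding convolution_riesz_representative[OF h h'] \<kappa>_def[symmetric]
  proof (rule lebesgue_integral_representative(1))
    note [measurable] = pb pl mb(1) ml(1) u u'(1)
    show "(\<lambda>x. \<kappa> * potential (real DIM('a) - \<alpha>) h' x * (\<bar>u x\<bar> powr (p - 2) * u x) * \<phi> x) \<in> borel_measurable lebesgue"
      by measurable
    show "(\<lambda>x. \<kappa> * potential (real DIM('a) - \<alpha>) h' x * (\<bar>u' x\<bar> powr (p - 2) * u' x) * \<phi> x) \<in> borel_measurable borel"
      by measurable
  qed (use u'(2) in auto)
  show ?thesis using eq unfolding 1 2 .
qed

subsection \<open>The theorem\<close>

theorem theorem1p8:
  fixes u v :: "'a::euclidean_space \<Rightarrow> real"
    and \<alpha> p q \<theta>1 \<theta>2 :: real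
  defines "N \<equiv> real DIM('a)"
  assumes "0 < \<alpha>" and "\<alpha> < N" and "p > 1" and "q > 1"
    and "\<theta>1 > 1" and "\<theta>2 > 1" and "1 / \<theta>1 + 1 / \<theta>2 = (N + \<alpha>) / N"
    and "u \<in> sobolev 1 2 UNIV \<inter> sobolev_loc 2 2 UNIV \<inter> sobolev 1 (\<theta>1 * p) UNIV"
    and "v \<in> sobolev 1 2 UNIV \<inter> sobolev_loc 2 2 UNIV \<inter> sobolev 1 (\<theta>2 * q) UNIV"
    and "weak_solution \<alpha> p q u v"
    and "(p + q) * N \<le> 2 * (N + \<alpha>) \<or> (p + q) * (N - 2) \<ge> 2 * (N + \<alpha>)"
  shows "AE x in lebesgue. u x = 0 \<and> v x = 0"
proof -
  have su: "u \<in> sobolev 1 2 UNIV" "u \<in> sobolev 1 (\<theta>1 * p) UNIV"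
    and sv: "v \<in> sobolev 1 2 UNIV" "v \<in> sobolev 1 (\<theta>2 * q) UNIV"
    using assms(9,10) by auto
  from assms(11) obtain Du Dv where Du: "has_weak_gradient u Du" and Dv: "has_weak_gradient v Dv"
    and equ: "\<And>\<phi>. \<phi> \<in> test_functions UNIV \<Longrightarrow> (LINT x|lebesgue. Du x \<bullet> gradient \<phi> x + u x * \<phi> x) =
          2 * p / (p + q) *
          (LINT x|lebesgue. convolution (riesz_potential \<alpha>) (\<lambda>y. \<bar>v y\<bar> powr q) x *
             (\<bar>u x\<bar> powr (p - 2) * u x) * \<phi> x)"
    and eqv: "\<And>\<phi>. \<phi> \<in> test_functions UNIV \<Longrightarrow> (LINT x|lebesgue. Dv x \<bullet> gradient \<phi> x + v x * \<phi> x) =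
          2 * q / (p + q) *
          (LINT x|lebesgue. convolution (riesz_potential \<alpha>) (\<lambda>y. \<bar>u y\<bar> powr p) x *
             (\<bar>v x\<bar> powr (q - 2) * v x) * \<phi> x)"
    unfolding weak_solution_def by blast
  have m: "u \<in> borel_measurable lebesgue" "v \<in> borel_measurable lebesgue"
    using su(1) sv(1) unfolding sobolev_def Lp_space_def set_borel_measurable_def by auto
  obtain u' where u': "u' \<in> borel_measurable borel" "AE x in lborel. u x = u' x"
    using borel_representative[OF m(1)] .
  obtain v' where v': "v' \<in> borel_measurable borel" "AE x in lborel. v x = v' x"
    using borel_representative[OF m(2)] .
  obtain A where A: "\<And>b. b \<in> Basis \<Longrightarrow> A b \<in> borel_measurable borel"
    "\<And>b. b \<in> Basis \<Longrightarrow> AE x in lborel. Du x \<bullet> b = A b x"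
    "\<And>b. b \<in> Basis \<Longrightarrow> (\<lambda>x. Du x \<bullet> b) \<in> borel_measurable lebesgue"
    using weak_gradient_representative[OF Du] by blast
  obtain B where B: "\<And>b. b \<in> Basis \<Longrightarrow> B b \<in> borel_measurable borel"
    "\<And>b. b \<in> Basis \<Longrightarrow> AE x in lborel. Dv x \<bullet> b = B b x"
    "\<And>b. b \<in> Basis \<Longrightarrow> (\<lambda>x. Dv x \<bullet> b) \<in> borel_measurable lebesgue"
    using weak_gradient_representative[OF Dv] by blast
  have wA: "weak_partial b u' (A b)" if "b \<in> Basis" for b
    using Du that by (intro weak_deriv_representative[OF _ u' A(1,2)]) (auto simp: has_weak_gradient_def)
  have wB: "weak_partial b v' (B b)" if "b \<in> Basis" for b
    using Dv that by (intro weak_deriv_representative[OF _ v' B(1,2)]) (auto simp: has_weak_gradient_def)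
  have pu: "(\<lambda>x. \<bar>u x\<bar> powr p) \<in> borel_measurable lebesgue" "(\<lambda>x. \<bar>u' x\<bar> powr p) \<in> borel_measurable borel"
      "AE x in lborel. \<bar>u x\<bar> powr p = \<bar>u' x\<bar> powr p"
    and pv: "(\<lambda>x. \<bar>v x\<bar> powr q) \<in> borel_measurable lebesgue" "(\<lambda>x. \<bar>v' x\<bar> powr q) \<in> borel_measurable borel"
      "AE x in lborel. \<bar>v x\<bar> powr q = \<bar>v' x\<bar> powr q"
    using m u' v' by auto
  have "AE x in lborel. u' x = 0 \<and> v' x = 0"
    by (rule nonexistence_borel[OF assms(2,3)[unfolded N_def] assms(6,7) assms(8)[unfolded N_def] assms(4,5)
          sobolev_representative[OF su(1) u' wA] sobolev_representative[OF su(2) u' wA]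
          sobolev_representative[OF sv(1) v' wB] sobolev_representative[OF sv(2) v' wB]
          weak_equation_representative[OF _ m(1) u' pv A equ] weak_equation_representative[OF _ m(2) v' pu B eqv]
          assms(12)[unfolded N_def]])
  then have "AE x in lborel. u x = 0 \<and> v x = 0"
    using u'(2) v'(2) by eventually_elim simp
  then show ?thesis by (rule AE_completion)
qed

end
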